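(* Suppose that $\alpha\in(0,\infty)$ and $p\in(1,\infty)$. The imbedding of $W^{\alpha,p}(\mathbb{R}^N)$ into $L^q(\mathbb{R}^N)$ is $\mathcal{D}_{\mathbb{Z}^N}$-cocompact whenever $p<q<p_\alpha^*$. Moreover, for such $q$, the imbedding $W^{\alpha+\gamma,p}(\mathbb{R}^N)\subset W^{\gamma,q}(\mathbb{R}^N)$ is $\mathcal{D}_{\mathbb{Z}^N}$-cocompact for every $\gamma>0$.
   Context: **Spaces.** Functions are complex valued. For real $\alpha>0$ and $p\in(1,\infty)$, $W^{\alpha,p}(\mathbb{R}^N)$ is the space of $f\in L^p(\mathbb{R}^N)$ such that $(1+|\xi|^2)^{\alpha/2}\widehat f(\xi)$ is the Fourier transform of a function in $L^p(\mathbb{R}^N)$, normed by the $L^p$ norm of that function, i.e. $\|f\|_{W^{\alpha,p}}=\|(I-\Delta)^{\alpha/2}f\|_{L^p}$. For integer $\alpha$ this is the classical Sobolev space up to equivalence of norms. **Critical exponent.** $p_\alpha^*=\frac{pN}{N-\alpha p}$ if $N>\alpha p$ and $p_\alpha^*=\infty$ if $N\le\alpha p$. By the Sobolev--Peetre theorem, the inclusions considered here are continuous. **Group.** $\mathcal{D}_{\mathbb{Z}^N}=\{g_y\}_{y\in\mathbb{Z}^N}$ with $g_yu=u(\cdot-y)$ (lattice shifts). **Cocompactness.** For a Banach space $A$ and a group $\mathcal{D}$ of continuous linear bijections of $A$, a sequence $\{u_k\}$ in $A$ is $\mathcal{D}$-weakly convergent to $u\in A$ if $g_k(u_k-u)\rightharpoonup0$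 weakly in $A$ for every sequence $\{g_k\}$ in $\mathcal{D}$. A continuous imbedding of $A$ into a Banach space $B$ is $\mathcal{D}$-cocompact if every $\mathcal{D}$-weakly convergent sequence in $A$ converges in the norm of $B$. *)

theory Defs
  imports "HOL-Analysis.Analysis"
begin

section \<open>Cocompact imbeddings of function spaces\<close>

text \<open>A normed space of complex functions is given by representatives: a linear space of
  functions with a seminorm, where functions at seminorm distance 0 (here: functions that
  agree almost everywhere) represent the same element. A functional that is bounded by the
  seminorm takes equal values on such functions, so \<open>dual A\<close> below is the dual of
  the quotient.\<close>

record 'a fspace =
  carr :: "('a \<Rightarrow> complex) set"
  fnorm :: "('a \<Rightarrow> complex) \<Rightarrow> real"

definition dual :: "'a fspace \<Rightarrow> (('a \<Rightarrow> complex) \<Rightarrow> complex) set" where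
  "dual A = {l.
     (\<forall>f\<in>carr A. \<forall>g\<in>carr A. l (\<lambda>x. f x + g x) = l f + l g) \<and>
     (\<forall>c. \<forall>f\<in>carr A. l (\<lambda>x. c * f x) = c * l f) \<and>
     (\<exists>C. \<forall>f\<in>carr A. cmod (l f) \<le> C * fnorm A f)}"

definition weakly_null :: "'a fspace \<Rightarrow> (nat \<Rightarrow> 'a \<Rightarrow> complex) \<Rightarrow> bool" where
  "weakly_null A v \<longleftrightarrow> (\<forall>l\<in>dual A. (\<lambda>k. l (v k)) \<longlonglongrightarrow> 0)"

definition D_weakly_convergent ::
  "(('a \<Rightarrow> complex) \<Rightarrow> ('a \<Rightarrow> complex)) set \<Rightarrow> 'a fspace
    \<Rightarrow> (nat \<Rightarrow> 'a \<Rightarrow> complex) \<Rightarrow> ('a \<Rightarrow> complex) \<Rightarrow> bool" where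
  "D_weakly_convergent D A u w \<longleftrightarrow>
     (\<forall>g. (\<forall>k. g k \<in> D) \<longrightarrow> weakly_null A (\<lambda>k. g k (\<lambda>x. u k x - w x)))"

definition continuous_imbedding :: "'a fspace \<Rightarrow> 'a fspace \<Rightarrow> bool" where
  "continuous_imbedding A B \<longleftrightarrow>
     carr A \<subseteq> carr B \<and> (\<exists>C. \<forall>f\<in>carr A. fnorm B f \<le> C * fnorm A f)"

text \<open>Meant for Banach spaces \<open>A\<close>, \<open>B\<close> and a group \<open>D\<close> of continuous linear
  bijections of \<open>A\<close>. Then a sequence that is \<open>D\<close>-weakly convergent to \<open>w\<close> is weakly
  convergent to \<open>w\<close>, and if it converges in the norm of \<open>B\<close>, its limit is \<open>w\<close>.\<close>

definition cocompact_imbedding ::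
  "(('a \<Rightarrow> complex) \<Rightarrow> ('a \<Rightarrow> complex)) set \<Rightarrow> 'a fspace \<Rightarrow> 'a fspace \<Rightarrow> bool" where
  "cocompact_imbedding D A B \<longleftrightarrow>
     continuous_imbedding A B \<and>
     (\<forall>u w. (\<forall>k. u k \<in> carr A) \<longrightarrow> w \<in> carr A \<longrightarrow> D_weakly_convergent D A u w
        \<longrightarrow> (\<lambda>k. fnorm B (\<lambda>x. u k x - w x)) \<longlonglongrightarrow> 0)"

definition lattice_shifts :: "((real^'n \<Rightarrow> complex) \<Rightarrow> (real^'n \<Rightarrow> complex)) set" where
  "lattice_shifts = {(\<lambda>u x. u (x - y)) | y. \<forall>i. y $ i \<in> \<int>}"


section \<open>Lebesgue spaces\<close>

text \<open>Every Lebesgue measurable function has a Borel representative, so Borel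
  measurability gives the usual space of equivalence classes.\<close>

definition Lp :: "real \<Rightarrow> (real^'n) fspace" where
  "Lp p = \<lparr>
     carr = {f \<in> borel_measurable lborel. integrable lborel (\<lambda>x. cmod (f x) powr p)},
     fnorm = (\<lambda>f. (\<integral>x. cmod (f x) powr p \<partial>lborel) powr (1 / p)) \<rparr>"


section \<open>Fourier transform on tempered distributions\<close>

fun iter_partial :: "'n list \<Rightarrow> (real^'n \<Rightarrow> complex) \<Rightarrow> real^'n \<Rightarrow> complex" where
  "iter_partial [] f = f"
| "iter_partial (i # is) f =
     (\<lambda>x. frechet_derivative (iter_partial is f) (at x) (axis i 1))"

definition schwartz :: "(real^'n \<Rightarrow> complex) set" where
  "schwartz = {\<phi>. \<forall>is. (\<forall>x. iter_partial is \<phi> differentiable at x) \<and>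
     (\<forall>m::nat. \<exists>C. \<forall>x. (1 + norm x) ^ m * cmod (iter_partial is \<phi> x) \<le> C)}"

text \<open>With \<open>\<i> (\<xi> \<bullet> x)\<close> in the exponent, without a factor \<open>2 \<pi>\<close>, the operator
  \<open>I - \<Delta>\<close> has the symbol \<open>1 + (norm \<xi>)\<^sup>2\<close>.\<close>

definition fourier :: "(real^'n \<Rightarrow> complex) \<Rightarrow> real^'n \<Rightarrow> complex" where
  "fourier \<phi> \<xi> = complex_of_real ((2 * pi) powr (- real CARD('n) / 2)) *
     (\<integral>x. exp (- \<i> * complex_of_real (\<xi> \<bullet> x)) * \<phi> x \<partial>lborel)"

text \<open>For \<open>p > 2\<close> the Fourier transform of an \<open>L\<^sup>p\<close> function need not be a function.
  It is the tempered distribution (a functional on \<open>schwartz\<close>) defined by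
  \<open>\<langle>f^, \<phi>\<rangle> = \<langle>f, \<phi>^\<rangle>\<close>.\<close>

definition fourier_dist ::
  "(real^'n \<Rightarrow> complex) \<Rightarrow> (real^'n \<Rightarrow> complex) \<Rightarrow> complex" where
  "fourier_dist f \<phi> = (\<integral>x. f x * fourier \<phi> x \<partial>lborel)"

definition mult_dist ::
  "(real^'n \<Rightarrow> complex) \<Rightarrow> ((real^'n \<Rightarrow> complex) \<Rightarrow> complex)
    \<Rightarrow> (real^'n \<Rightarrow> complex) \<Rightarrow> complex" where
  "mult_dist m T \<phi> = T (\<lambda>\<xi>. m \<xi> * \<phi> \<xi>)"


section \<open>Sobolev spaces\<close>

definition bessel_symbol :: "real \<Rightarrow> real^'n \<Rightarrow> complex" where
  "bessel_symbol \<alpha> \<xi> = complex_of_real ((1 + (norm \<xi>)\<^sup>2) powr (\<alpha> / 2))"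

text \<open>This says that \<open>g\<close> is the image of \<open>f\<close> under the power \<open>\<alpha> / 2\<close> of
  \<open>I - \<Delta>\<close>. It determines \<open>g\<close> up to a null set, so the norm of \<open>sobolev\<close>
  does not depend on the choice made there.\<close>

definition is_bessel_image ::
  "real \<Rightarrow> real \<Rightarrow> (real^'n \<Rightarrow> complex) \<Rightarrow> (real^'n \<Rightarrow> complex) \<Rightarrow> bool" where
  "is_bessel_image \<alpha> p f g \<longleftrightarrow> g \<in> carr (Lp p) \<and>
     (\<forall>\<phi>\<in>schwartz. mult_dist (bessel_symbol \<alpha>) (fourier_dist f) \<phi> = fourier_dist g \<phi>)"

definition sobolev :: "real \<Rightarrow> real \<Rightarrow> (real^'n) fspace" where
  "sobolev \<alpha> p = \<lparr>
     carr = {f \<in> carr (Lp p). \<exists>g. is_bessel_image \<alpha> p f g},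
     fnorm = (\<lambda>f. fnorm (Lp p) (SOME g. is_bessel_image \<alpha> p f g)) \<rparr>"

definition critical_exponent :: "nat \<Rightarrow> real \<Rightarrow> real \<Rightarrow> ereal" where
  "critical_exponent N \<alpha> p =
     (if real N > \<alpha> * p then ereal (p * real N / (real N - \<alpha> * p)) else \<infinity>)"

end

theory Submission
  imports Defs "HOL-Probability.Probability"
begin

text \<open>The spectral power \<open>- \<alpha> / 2\<close> of \<open>I - \<Delta>\<close> is the mean of the heat semigroup \<open>exp (s \<Delta>)\<close> over
  a gamma distribution of \<open>s\<close>. For \<open>h\<close> in \<open>L\<^sup>p\<close>, Jensen's inequality bounds \<open>exp (s \<Delta>) h\<close> in \<open>L\<^sup>q\<close>
  by a power of \<open>s\<close> which is integrable for the gamma distribution exactly when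
  \<open>N (1 / p - 1 / q) < \<alpha>\<close>, that is, below the critical exponent; this gives the imbedding without
  Hardy-Littlewood-Sobolev. For cocompactness write the elements of the sequence as Bessel potentials of functions
  \<open>h\<^sub>k\<close>, which are bounded in \<open>L\<^sup>p\<close>. Weak convergence of all lattice translates and compactness of the
  unit cube make \<open>exp (s \<Delta>) h\<^sub>k\<close> tend to 0 uniformly for each fixed \<open>s\<close>, hence, being bounded
  in \<open>L\<^sup>p\<close>, also in \<open>L\<^sup>q\<close>, and dominated convergence in \<open>s\<close> concludes. For the imbedding into
  \<open>W\<^sup>\<gamma>\<^sup>,\<^sup>q\<close> the same Bessel potential of order \<open>\<alpha>\<close> is the Bessel image of order \<open>\<gamma>\<close>.\<close>

section \<open>The Gaussian measure\<close>

text \<open>For p > 2 the Fourier transform of an element of the space is only a distribution, so a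
  Bessel image is known solely through pairings with Fourier transforms of Schwartz functions. All
  multipliers are therefore put on the test function. The heat kernel and the Bessel kernel enter as
  laws of random vectors: pairing a mean of translates with \<open>fourier \<psi>\<close> puts the
  characteristic function in front of \<psi>, and for a gamma mixture of Gaussians this is the
  Bessel symbol of negative order. The way back from pairings to functions is
  \<open>fourier_injective\<close>, which turns the defining equation of a Bessel image into an
  almost everywhere representation of f as a potential. The obstacle in the limit is the heat bound
  from p to q, of order \<open>s powr (- \<sigma>)\<close> with
  \<open>\<sigma> = N / 2 * (1 / p - 1 / q)\<close>: smallness at each fixed time says nothing about
  times near 0. Moving \<open>s powr \<sigma>\<close> out of the gamma density of shape \<alpha> / 2
  cancels this blow-up and leaves, up to a constant, another probability measure, on which Jensen's
  inequality and a constant majorant are available.\<close>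

lemma lborel_shift:
  fixes c :: "'a::euclidean_space"
  shows "distr lborel borel (\<lambda>x. x + c) = lborel"
  using lborel_distr_plus[of c] by (simp add: add.commute[of _ c])

lemma nn_integral_lborel_shift:
  fixes f :: "'a::euclidean_space \<Rightarrow> ennreal"
  assumes [measurable]: "f \<in> borel_measurable borel"
  shows "(\<integral>\<^sup>+x. f (x + c) \<partial>lborel) = (\<integral>\<^sup>+x. f x \<partial>lborel)"
  by (subst (2) lborel_shift[of c, symmetric], subst nn_integral_distr) auto

lemma integral_lborel_shift:
  fixes f :: "'a::euclidean_space \<Rightarrow> 'b::{banach,second_countable_topology}"
  assumes [measurable]: "f \<in> borel_measurable borel"
  shows "(\<integral>x. f (x + c) \<partial>lborel) = (\<integral>x. f x \<partial>lborel)"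
  by (subst (2) lborel_shift[of c, symmetric], subst integral_distr) auto

lemma integrable_lborel_shift:
  fixes f :: "'a::euclidean_space \<Rightarrow> 'b::{banach,second_countable_topology}"
  assumes "integrable lborel f"
  shows "integrable lborel (\<lambda>x. f (x + c))"
proof -
  have [measurable]: "f \<in> borel_measurable borel" using assms by auto
  have "integrable (distr lborel borel (\<lambda>x. x + c)) f"
    using assms by (simp add: lborel_shift)
  then show ?thesis by (subst (asm) integrable_distr_eq) auto
qed

lemma nn_integral_lborel_scale:
  fixes f :: "'a::euclidean_space \<Rightarrow> ennreal"
  assumes [measurable]: "f \<in> borel_measurable borel" and c: "c > 0"
  shows "(\<integral>\<^sup>+z. f (x - c *\<^sub>R z) \<partial>lborel) = ennreal ((1 / c) ^ DIM('a)) * (\<integral>\<^sup>+z. f z \<partial>lborel)"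
proof -
  have "(\<integral>\<^sup>+z. f z \<partial>lborel) = ennreal (c ^ DIM('a)) * (\<integral>\<^sup>+z. f (x - c *\<^sub>R z) \<partial>lborel)"
    using c by (subst lborel_affine[of "-c" x])
      (auto simp: nn_integral_density nn_integral_distr nn_integral_cmult)
  moreover have "ennreal ((1 / c) ^ DIM('a)) * ennreal (c ^ DIM('a)) = 1"
    using c by (simp flip: ennreal_mult add: power_mult_distrib[symmetric])
  ultimately show ?thesis
    by (metis mult.assoc mult_1)
qed

lemma integral_lborel_scale:
  fixes f :: "'a::euclidean_space \<Rightarrow> 'b::{banach,second_countable_topology}"
  assumes [measurable]: "f \<in> borel_measurable borel" and c: "c > 0"
  shows "(\<integral>z. f (x - c *\<^sub>R z) \<partial>lborel) = ((1 / c) ^ DIM('a)) *\<^sub>R (\<integral>z. f z \<partial>lborel)"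
proof -
  have "(\<integral>z. f z \<partial>lborel) = (c ^ DIM('a)) *\<^sub>R (\<integral>z. f (x - c *\<^sub>R z) \<partial>lborel)"
    using c by (subst lborel_affine[of "-c" x])
      (auto simp: integral_density integral_distr)
  then show ?thesis using c by (simp add: power_one_over)
qed

text \<open>Fubini on the finite product of real lines, carried over by \<open>lborel_eq\<close>. It
  reduces the Gaussian and the integrable weight below to integrals in one variable.\<close>

lemma lborel_prod_coordinates:
  fixes f :: "'a::euclidean_space \<Rightarrow> real \<Rightarrow> complex"
  assumes "\<And>b. b \<in> Basis \<Longrightarrow> integrable lborel (f b)"
  shows "integrable lborel (\<lambda>x. \<Prod>b\<in>Basis. f b (x \<bullet> b))"
    and "(\<integral>x. (\<Prod>b\<in>Basis. f b (x \<bullet> b)) \<partial>lborel) = (\<Prod>b\<in>Basis. \<integral>x. f b x \<partial>lborel)"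
proof -
  interpret product_sigma_finite "\<lambda>b::'a. lborel :: real measure" ..
  have [measurable]: "f b \<in> borel_measurable borel" if "b \<in> Basis" for b
    using assms[OF that] by auto
  have m [measurable]: "(\<lambda>x. \<Prod>b\<in>Basis. f b (x \<bullet> b)) \<in> borel_measurable borel" by measurable
  have s: "(\<lambda>g. \<Sum>b\<in>Basis. g b *\<^sub>R b) \<in> (\<Pi>\<^sub>M b\<in>Basis. lborel) \<rightarrow>\<^sub>M (borel :: 'a measure)"
    by measurable
  have i: "(\<Sum>b\<in>Basis. g b *\<^sub>R b) \<bullet> b' = g b'" if "b' \<in> Basis" for b' :: 'a and g
    using that by (simp add: inner_sum_left inner_Basis if_distrib[of "\<lambda>x. g _ * x"] cong: if_cong)
  have e: "(\<Prod>b\<in>Basis. f b ((\<Sum>b\<in>Basis. g b *\<^sub>R b) \<bullet> b)) = (\<Prod>b\<in>Basis. f b (g b))" for g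
    by (rule prod.cong) (auto simp: i)
  show "integrable lborel (\<lambda>x. \<Prod>b\<in>Basis. f b (x \<bullet> b))"
    by (subst lborel_eq, subst integrable_distr_eq[OF s m]) (simp add: e product_integrable_prod assms)
  show "(\<integral>x. (\<Prod>b\<in>Basis. f b (x \<bullet> b)) \<partial>lborel) = (\<Prod>b\<in>Basis. \<integral>x. f b x \<partial>lborel)"
    by (subst lborel_eq, subst integral_distr[OF s m]) (simp add: e product_integral_prod assms)
qed

lemma le_one_plus_powr:
  fixes t q :: real
  assumes "0 \<le> t" "1 \<le> q"
  shows "t \<le> 1 + t powr q"
proof (cases "t \<le> 1")
  case False
  then show ?thesis using powr_mono[of 1 q t] assms by auto
qed (use powr_ge_zero[of t q] in linarith)

text \<open>Jensen's inequality for the convex function \<open>t powr q\<close>. Measurability is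
  the only assumption on \<open>F\<close>: an infinite right-hand side makes the claim trivial, and
  a finite one makes \<open>F\<close> integrable because the measure is finite.\<close>

lemma (in prob_space) powr_norm_expectation_le:
  fixes F :: "'a \<Rightarrow> complex"
  assumes [measurable]: "F \<in> borel_measurable M" and q: "1 \<le> q"
  shows "ennreal (cmod (expectation F) powr q) \<le> (\<integral>\<^sup>+x. ennreal (cmod (F x) powr q) \<partial>M)"
proof (cases "q = 1")
  case True
  then show ?thesis
    by (cases "integrable M F") (auto simp: not_integrable_integral_eq intro: integral_norm_bound_ennreal)
next
  case False
  then have q1: "q > 1" using q by simp
  define r where "r = q / (q - 1)"
  have r: "r > 1" "1 / q + 1 / r = 1" using q1 by (auto simp: r_def field_simps)
  show ?thesis
  proof (cases "(\<integral>\<^sup>+x. ennreal (cmod (F x) powr q) \<partial>M) = \<infinity>")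
    case False
    then have i: "integrable M (\<lambda>x. cmod (F x) powr q)"
      by (subst integrable_iff_bounded) (auto simp: top.not_eq_extremum)
    have iF: "integrable M F"
      by (rule Bochner_Integration.integrable_bound[of _ "\<lambda>x. 1 + cmod (F x) powr q"])
        (use q in \<open>auto simp: i le_one_plus_powr\<close>)
    define m where "m = cmod (expectation F)"
    have m: "m \<le> expectation (\<lambda>x. cmod (F x))" unfolding m_def by (rule integral_norm_bound)
    show ?thesis
    proof (cases "m = 0")
      case False
      then have m0: "m > 0" unfolding m_def by simp
      \<comment> \<open>Young's inequality with second factor \<open>m powr (q - 1)\<close>, whose
        conjugate power is \<open>m powr q\<close>. After integration the left side is at least
        \<open>m powr q\<close>, and cancelling \<open>m powr q / r\<close> leaves
        \<open>m powr q / q\<close>.\<close>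
      have "m powr (q - 1) * cmod (F x) \<le> cmod (F x) powr q / q + m powr q / r" for x
        using Youngs_inequality[of q r "cmod (F x)" "m powr (q - 1)"] r q1
        by (simp add: powr_powr r_def mult.commute)
      then have "expectation (\<lambda>x. m powr (q - 1) * cmod (F x)) \<le> expectation (\<lambda>x. cmod (F x) powr q / q + m powr q / r)"
        by (intro integral_mono) (use i iF in auto)
      then have "m powr (q - 1) * expectation (\<lambda>x. cmod (F x)) \<le> expectation (\<lambda>x. cmod (F x) powr q) / q + m powr q / r"
        using i by (simp add: prob_space)
      moreover have "m powr (q - 1) * m \<le> m powr (q - 1) * expectation (\<lambda>x. cmod (F x))"
        by (rule mult_left_mono[OF m]) auto
      moreover have "m powr (q - 1) * m = m powr q"
        using m0 by (simp add: powr_diff)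
      moreover have "m powr q = m powr q / q + m powr q / r"
        using r(2) by (metis (no_types) add_divide_distrib distrib_left mult.right_neutral times_divide_eq_right)
      ultimately have "m powr q / q \<le> expectation (\<lambda>x. cmod (F x) powr q) / q" by linarith
      then have "m powr q \<le> expectation (\<lambda>x. cmod (F x) powr q)" using q1 by (simp add: divide_le_cancel)
      then show ?thesis
        unfolding m_def[symmetric] using i by (subst nn_integral_eq_integral) auto
    qed (simp add: m_def)
  qed simp
qed

section \<open>The standard Gaussian and its characteristic function\<close>

definition gauss_density :: "real^'n \<Rightarrow> real" where
  "gauss_density x = (2 * pi) powr (- real CARD('n) / 2) * exp (- (norm x)\<^sup>2 / 2)"

definition gaussian :: "(real^'n) measure" where
  "gaussian = density lborel (\<lambda>x. ennreal (gauss_density x))"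

lemma gauss_density_nonneg [simp]: "0 \<le> gauss_density x"
  and gauss_density_measurable [measurable]: "gauss_density \<in> borel_measurable borel"
  and sets_gaussian [measurable_cong, simp]: "sets gaussian = sets borel"
  and space_gaussian [simp]: "space gaussian = UNIV"
  unfolding gaussian_def by (auto simp: gauss_density_def[abs_def])

lemma norm_sq_eq_sum_Basis: "(norm x)\<^sup>2 = (\<Sum>b\<in>Basis. (x \<bullet> b)\<^sup>2)"
  unfolding power2_norm_eq_inner by (subst euclidean_inner) (simp add: power2_eq_square)

lemma gauss_density_prod:
  fixes x :: "real^'n"
  shows "gauss_density x = (\<Prod>b\<in>Basis. std_normal_density (x \<bullet> b))"
proof -
  note norm_sq_eq_sum_Basis[of x]
  moreover have "(2 * pi) powr - (real CARD('n) / 2) = (1 / sqrt (2 * pi)) ^ CARD('n)"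
  proof -
    have "1 / sqrt (2 * pi) = (2 * pi) powr (- 1 / 2)"
      using powr_minus_divide[of "2 * pi" "1 / 2"] by (simp add: powr_half_sqrt)
    moreover have "(1 / sqrt (2 * pi)) ^ CARD('n) = (1 / sqrt (2 * pi)) powr real CARD('n)"
      by (rule powr_realpow[symmetric]) simp
    ultimately show ?thesis by (simp only: powr_powr) simp
  qed
  ultimately show ?thesis
    by (simp add: gauss_density_def std_normal_density_def prod_dividef power_one_over exp_sum sum_divide_distrib
        flip: sum_negf)
qed

text \<open>The integrand is a product over the coordinates, and each factor integrates to the
  characteristic function of the standard normal distribution.\<close>

lemma gauss_fourier:
  fixes \<xi> :: "real^'n"
  shows "integrable lborel (\<lambda>z. exp (\<i> * complex_of_real (\<xi> \<bullet> z)) * gauss_density z)"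
    and "(\<integral>z. exp (\<i> * complex_of_real (\<xi> \<bullet> z)) * gauss_density z \<partial>lborel) = exp (- (norm \<xi>)\<^sup>2 / 2)"
proof -
  let ?f = "\<lambda>b t. exp (\<i> * complex_of_real ((\<xi> \<bullet> b) * t)) * complex_of_real (std_normal_density t)"
  have int: "integrable lborel (?f b)" for b
    by (rule Bochner_Integration.integrable_bound[of _ "std_normal_density"])
      (auto simp: norm_mult)
  have eq: "exp (\<i> * complex_of_real (\<xi> \<bullet> z)) * gauss_density z = (\<Prod>b\<in>Basis. ?f b (z \<bullet> b))" for z
    by (simp add: gauss_density_prod prod.distrib exp_sum[symmetric] euclidean_inner[of \<xi> z] sum_distrib_left)
  show "integrable lborel (\<lambda>z. exp (\<i> * complex_of_real (\<xi> \<bullet> z)) * gauss_density z)"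
    unfolding eq by (rule lborel_prod_coordinates[OF int])
  have "(\<integral>t. ?f b t \<partial>lborel) = exp (- (\<xi> \<bullet> b)\<^sup>2 / 2)" for b
  proof -
    have "(\<integral>t. ?f b t \<partial>lborel) = char std_normal_distribution (\<xi> \<bullet> b)"
      unfolding char_def by (subst integral_density) (auto simp: scaleR_conv_of_real mult.commute intro!: Bochner_Integration.integral_cong)
    then show ?thesis by (simp add: char_std_normal_distribution)
  qed
  then have "(\<integral>z. exp (\<i> * complex_of_real (\<xi> \<bullet> z)) * gauss_density z \<partial>lborel) = (\<Prod>b\<in>Basis. complex_of_real (exp (- (\<xi> \<bullet> b)\<^sup>2 / 2)))"
    unfolding eq by (subst lborel_prod_coordinates(2)[OF int]) simp
  also have "\<dots> = complex_of_real (exp (\<Sum>b\<in>Basis. - (\<xi> \<bullet> b)\<^sup>2 / 2))"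
    by (simp add: exp_sum)
  also have "(\<Sum>b\<in>Basis. - (\<xi> \<bullet> b)\<^sup>2 / 2) = - (norm \<xi>)\<^sup>2 / 2"
    by (simp add: norm_sq_eq_sum_Basis sum_negf sum_divide_distrib)
  finally show "(\<integral>z. exp (\<i> * complex_of_real (\<xi> \<bullet> z)) * gauss_density z \<partial>lborel) = exp (- (norm \<xi>)\<^sup>2 / 2)" .
qed

lemma gauss_integrable: "integrable lborel gauss_density"
  and gauss_integral: "(\<integral>z. gauss_density z \<partial>lborel) = 1"
proof -
  show "integrable lborel gauss_density"
    using gauss_fourier(1)[of 0] by (simp add: complex_of_real_integrable_eq)
  show "(\<integral>z. gauss_density z \<partial>lborel) = 1"
    using gauss_fourier(2)[of 0] by simp
qed

lemma prob_space_gaussian: "prob_space gaussian"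
  by (rule prob_spaceI)
    (simp add: gaussian_def emeasure_density nn_integral_eq_integral gauss_integrable gauss_integral)

lemma gaussian_char:
  "(\<integral>z. exp (\<i> * complex_of_real (\<xi> \<bullet> z)) \<partial>gaussian) = exp (- (norm \<xi>)\<^sup>2 / 2)"
  using gauss_fourier(2)[of \<xi>] unfolding gaussian_def
  by (subst integral_density) (auto simp: scaleR_conv_of_real mult.commute)

text \<open>The Gaussian density is replaced by its maximum, and the scaling of Lebesgue measure
  supplies the power of \<open>c\<close>. At \<open>c = sqrt (2 * s)\<close> the constant is the
  maximum of the heat kernel at time s, \<open>(4 * pi * s) powr (- N / 2)\<close>.\<close>

lemma nn_integral_gaussian_scale_le:
  fixes f :: "real^'n \<Rightarrow> ennreal"
  assumes [measurable]: "f \<in> borel_measurable borel" and c: "c > 0"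
  shows "(\<integral>\<^sup>+z. f (x - c *\<^sub>R z) \<partial>gaussian) \<le> ennreal ((2 * pi * c\<^sup>2) powr (- real CARD('n) / 2)) * (\<integral>\<^sup>+z. f z \<partial>lborel)"
proof -
  have "(\<integral>\<^sup>+z. f (x - c *\<^sub>R z) \<partial>gaussian) = (\<integral>\<^sup>+z. gauss_density z * f (x - c *\<^sub>R z) \<partial>lborel)"
    unfolding gaussian_def by (subst nn_integral_density) auto
  also have "\<dots> \<le> (\<integral>\<^sup>+z. ennreal ((2 * pi) powr (- real CARD('n) / 2)) * f (x - c *\<^sub>R z) \<partial>lborel)"
    by (intro nn_integral_mono mult_right_mono) (auto simp: gauss_density_def intro!: ennreal_leI mult_right_le_one_le)
  also have "\<dots> = ennreal ((2 * pi) powr (- real CARD('n) / 2)) * (ennreal ((1 / c) ^ CARD('n)) * (\<integral>\<^sup>+z. f z \<partial>lborel))"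
    by (subst nn_integral_cmult) (use c in \<open>auto simp: nn_integral_lborel_scale\<close>)
  also have "\<dots> = ennreal ((2 * pi) powr (- real CARD('n) / 2) * (1 / c) ^ CARD('n)) * (\<integral>\<^sup>+z. f z \<partial>lborel)"
    using c by (subst mult.assoc[symmetric], subst ennreal_mult'[symmetric]) auto
  also have "(2 * pi) powr (- real CARD('n) / 2) * (1 / c) ^ CARD('n) = (2 * pi * c\<^sup>2) powr (- real CARD('n) / 2)"
  proof -
    have "(c\<^sup>2) powr (- real CARD('n) / 2) = c powr (- real CARD('n))"
      using c powr_powr[of c 2 "- real CARD('n) / 2"] by simp
    also have "\<dots> = (1 / c) ^ CARD('n)"
      using c by (simp add: powr_minus powr_realpow power_one_over inverse_eq_divide)
    finally show ?thesis using c by (subst powr_mult) auto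
  qed
  finally show ?thesis .
qed

section \<open>Schwartz functions and their Fourier transforms\<close>

definition partial :: "'n \<Rightarrow> (real^'n \<Rightarrow> complex) \<Rightarrow> real^'n \<Rightarrow> complex" where
  "partial i f x = frechet_derivative f (at x) (axis i 1)"

lemma partial_eqI: "(f has_derivative D) (at x) \<Longrightarrow> partial i f x = D (axis i 1)"
  unfolding partial_def by (metis frechet_derivative_at)

lemma partial_add:
  assumes "f differentiable at x" "g differentiable at x"
  shows "partial i (\<lambda>x. f x + g x) x = partial i f x + partial i g x"
  by (subst partial_eqI[OF has_derivative_add[OF assms[unfolded frechet_derivative_works]]]) (simp add: partial_def)

lemma partial_mult:
  assumes "f differentiable at x" "g differentiable at x"
  shows "partial i (\<lambda>x. f x * g x) x = f x * partial i g x + partial i f x * g x"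
  by (subst partial_eqI[OF has_derivative_mult[OF assms[unfolded frechet_derivative_works]]]) (simp add: partial_def)

text \<open>The recursion of \<open>iter_partial\<close> splits off the outermost derivative;
  splitting off the innermost one instead shows that a partial derivative of a Schwartz function is
  again one.\<close>

lemma iter_partial_append: "iter_partial (is @ [i]) f = iter_partial is (partial i f)"
  by (induction "is") (auto simp: partial_def[abs_def])

text \<open>The Schwartz space is the greatest class of differentiable, rapidly decreasing functions
  that is closed under partial derivatives. Membership is shown by exhibiting any such class
  \<open>S\<close>, so the product rule is applied to one derivative at a time.\<close>

lemma schwartz_coinduct:
  assumes "\<phi> \<in> S"
    and diff: "\<And>f x. f \<in> S \<Longrightarrow> f differentiable at x"
    and decay: "\<And>f m. f \<in> S \<Longrightarrow> \<exists>C. \<forall>x. (1 + norm x) ^ m * cmod (f x) \<le> C"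
    and closed: "\<And>f i. f \<in> S \<Longrightarrow> partial i f \<in> S"
  shows "\<phi> \<in> schwartz"
proof -
  have "iter_partial is \<phi> \<in> S" for "is"
  proof (induction "is")
    case (Cons i "is")
    then show ?case using closed[of "iter_partial is \<phi>" i] by (simp add: partial_def[abs_def])
  qed (simp add: assms)
  then show ?thesis unfolding schwartz_def using diff decay by blast
qed

lemma schwartz_differentiable: "\<phi> \<in> schwartz \<Longrightarrow> \<phi> differentiable at x"
  unfolding schwartz_def by (auto dest: spec[of _ "[]"])

lemma schwartz_decay: "\<phi> \<in> schwartz \<Longrightarrow> \<exists>C. \<forall>x. (1 + norm x) ^ m * cmod (\<phi> x) \<le> C"
  unfolding schwartz_def by (auto dest: spec[of _ "[]"])

lemma schwartz_partial: "\<phi> \<in> schwartz \<Longrightarrow> partial i \<phi> \<in> schwartz"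
  unfolding schwartz_def by (simp flip: iter_partial_append)

text \<open>A syntactic class of multipliers of polynomial growth. The generators are the
  multipliers that occur, namely powers of \<open>1 + (norm x)\<^sup>2\<close> for the Bessel
  symbols and characters for translations, together with the coordinates and constants that their
  derivatives bring in.\<close>

inductive_set slow :: "(real^'n \<Rightarrow> complex) set" where
  const: "(\<lambda>x. c) \<in> slow"
| coord: "(\<lambda>x. complex_of_real (x $ i)) \<in> slow"
| bracket: "(\<lambda>x. complex_of_real ((1 + (norm x)\<^sup>2) powr s)) \<in> slow"
| character: "(\<lambda>x. exp (\<i> * complex_of_real (x \<bullet> y))) \<in> slow"
| add: "f \<in> slow \<Longrightarrow> g \<in> slow \<Longrightarrow> (\<lambda>x. f x + g x) \<in> slow"
| mult: "f \<in> slow \<Longrightarrow> g \<in> slow \<Longrightarrow> (\<lambda>x. f x * g x) \<in> slow"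

lemma norm_sq_derivative: "((\<lambda>x. (norm x)\<^sup>2) has_derivative (\<lambda>h. 2 * (x \<bullet> h))) (at x)" for x :: "real^'n"
  unfolding power2_norm_eq_inner
  by (auto intro!: derivative_eq_intros simp: inner_commute)

lemma bracket_derivative:
  fixes x :: "real^'n"
  shows "((\<lambda>x. complex_of_real ((1 + (norm x)\<^sup>2) powr s)) has_derivative
    (\<lambda>h. complex_of_real (s * (1 + (norm x)\<^sup>2) powr (s - 1) * (2 * (x \<bullet> h))))) (at x)"
proof -
  have pos: "0 < 1 + (norm x)\<^sup>2" by (simp add: add_pos_nonneg)
  have "((\<lambda>x. 1 + (norm x)\<^sup>2) has_derivative (\<lambda>h. 2 * (x \<bullet> h))) (at x)"
    by (auto intro!: derivative_eq_intros norm_sq_derivative)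
  from DERIV_compose_FDERIV[OF has_real_derivative_powr[OF pos, of s] this]
  have "((\<lambda>x. (1 + (norm x)\<^sup>2) powr s) has_derivative
    (\<lambda>h. s * (1 + (norm x)\<^sup>2) powr (s - 1) * (2 * (x \<bullet> h)))) (at x)"
    by (simp add: mult.commute)
  then show ?thesis
    by (rule has_derivative_of_real)
qed

lemma character_derivative:
  fixes x :: "real^'n"
  shows "((\<lambda>x. exp (\<i> * complex_of_real (x \<bullet> y))) has_derivative
    (\<lambda>h. exp (\<i> * complex_of_real (x \<bullet> y)) * (\<i> * complex_of_real (h \<bullet> y)))) (at x)"
proof -
  have "((\<lambda>x. \<i> * complex_of_real (x \<bullet> y)) has_derivative (\<lambda>h. \<i> * complex_of_real (h \<bullet> y))) (at x)"
    by (auto intro!: derivative_eq_intros)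
  from has_derivative_compose[OF this DERIV_exp[unfolded has_field_derivative_def]] show ?thesis by simp
qed

lemma coord_derivative:
  "((\<lambda>x. complex_of_real (x $ i)) has_derivative (\<lambda>h. complex_of_real (h $ i))) (at x)"
  by (intro has_derivative_of_real bounded_linear_imp_has_derivative bounded_linear_vec_nth)

lemma slow_differentiable: "f \<in> slow \<Longrightarrow> f differentiable at x"
proof (induction rule: slow.induct)
  case (coord i) then show ?case using coord_derivative unfolding differentiable_def by blast
next
  case (bracket s) then show ?case using bracket_derivative unfolding differentiable_def by blast
next
  case (character y) then show ?case using character_derivative unfolding differentiable_def by blast
qed auto

lemma slow_partial: "f \<in> slow \<Longrightarrow> partial i f \<in> slow"
proof (induction rule: slow.induct)
  case (const c)
  have "partial i (\<lambda>x. c) = (\<lambda>x. 0)" by (rule ext, rule partial_eqI, simp)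
  then show ?case by (metis slow.const)
next
  case (coord j)
  have "partial i (\<lambda>x. complex_of_real (x $ j)) = (\<lambda>x. complex_of_real (axis i 1 $ j))"
    by (rule ext, rule partial_eqI, rule coord_derivative)
  then show ?case by (metis slow.const)
next
  case (bracket s)
  have "partial i (\<lambda>x. complex_of_real ((1 + (norm x)\<^sup>2) powr s)) =
     (\<lambda>x. (complex_of_real (2 * s) * complex_of_real (x $ i)) * complex_of_real ((1 + (norm x)\<^sup>2) powr (s - 1)))"
    by (rule ext, subst partial_eqI[OF bracket_derivative]) (simp add: inner_axis)
  then show ?case by (auto intro!: slow.intros)
next
  case (character y)
  have "partial i (\<lambda>x. exp (\<i> * complex_of_real (x \<bullet> y))) =
     (\<lambda>x. (\<i> * complex_of_real (y $ i)) * exp (\<i> * complex_of_real (x \<bullet> y)))"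
    by (rule ext, subst partial_eqI[OF character_derivative]) (simp add: inner_axis')
  then show ?case by (auto intro!: slow.intros)
next
  case (add f g)
  then have "partial i (\<lambda>x. f x + g x) = (\<lambda>x. partial i f x + partial i g x)"
    using partial_add slow_differentiable by blast
  then show ?case using add by (auto intro!: slow.intros)
next
  case (mult f g)
  then have "partial i (\<lambda>x. f x * g x) = (\<lambda>x. f x * partial i g x + partial i f x * g x)"
    using partial_mult slow_differentiable by blast
  then show ?case using mult by (auto intro!: slow.intros)
qed

lemma slow_bound: "f \<in> slow \<Longrightarrow> \<exists>C m. 0 \<le> C \<and> (\<forall>x. cmod (f x) \<le> C * (1 + norm x) ^ m)"
proof (induction rule: slow.induct)
  case (const c)
  show ?case by (rule exI[of _ "cmod c"], rule exI[of _ 0]) simp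
next
  case (coord i)
  have "\<bar>x $ i\<bar> \<le> 1 * (1 + norm x) ^ 1" for x using component_le_norm_cart[of x i] by simp
  then show ?case by (intro exI[of _ 1] exI[of _ 1]) auto
next
  case (bracket s)
  obtain m :: nat where m: "s \<le> real m" using real_arch_simple by blast
  have "(1 + (norm x)\<^sup>2) powr s \<le> 1 * (1 + norm x) ^ (2 * m)" for x :: "real^'n"
  proof -
    have "(1 + (norm x)\<^sup>2) powr s \<le> (1 + (norm x)\<^sup>2) powr real m"
      using m by (intro powr_mono) auto
    also have "\<dots> = (1 + (norm x)\<^sup>2) ^ m" by (rule powr_realpow) (simp add: add_pos_nonneg)
    also have "\<dots> \<le> ((1 + norm x)\<^sup>2) ^ m" by (intro power_mono) (auto simp: power2_sum)
    finally show ?thesis by (simp add: power_mult)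
  qed
  then show ?case by (intro exI[of _ 1] exI[of _ "2 * m"]) auto
next
  case (character y)
  show ?case by (rule exI[of _ 1], rule exI[of _ 0]) simp
next
  case (add f g)
  then obtain C m D n where f: "0 \<le> C" "\<And>x. cmod (f x) \<le> C * (1 + norm x) ^ m"
    and g: "0 \<le> D" "\<And>x. cmod (g x) \<le> D * (1 + norm x) ^ n" by metis
  have "cmod (f x + g x) \<le> (C + D) * (1 + norm x) ^ (m + n)" for x
  proof -
    have "cmod (f x + g x) \<le> C * (1 + norm x) ^ m + D * (1 + norm x) ^ n"
      using f(2)[of x] g(2)[of x] norm_triangle_ineq[of "f x" "g x"] by linarith
    also have "\<dots> \<le> C * (1 + norm x) ^ (m + n) + D * (1 + norm x) ^ (m + n)"
      using f g by (intro add_mono mult_left_mono power_increasing) auto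
    finally show ?thesis by (simp add: algebra_simps)
  qed
  then show ?case using f g by (intro exI[of _ "C + D"] exI[of _ "m + n"]) auto
next
  case (mult f g)
  then obtain C m D n where f: "0 \<le> C" "\<And>x. cmod (f x) \<le> C * (1 + norm x) ^ m"
    and g: "0 \<le> D" "\<And>x. cmod (g x) \<le> D * (1 + norm x) ^ n" by metis
  have "cmod (f x * g x) \<le> (C * D) * (1 + norm x) ^ (m + n)" for x
    using mult_mono[OF f(2)[of x] g(2)[of x]] f(1) by (simp add: norm_mult power_add mult_ac)
  then show ?case using f g by (intro exI[of _ "C * D"] exI[of _ "m + n"]) auto
qed

text \<open>A factor of growth order \<open>n\<close> costs \<open>n\<close> orders of decay, and
  the other factor has decay of every order.\<close>

lemma slow_mult_decay:
  assumes "f \<in> slow" and decay: "\<And>m. \<exists>C. \<forall>x. (1 + norm x) ^ m * cmod (g x) \<le> C"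
  shows "\<exists>C. \<forall>x. (1 + norm x) ^ m * cmod (f x * g x) \<le> C"
proof -
  obtain C n where f: "0 \<le> C" "\<And>x. cmod (f x) \<le> C * (1 + norm x) ^ n" using slow_bound[OF assms(1)] by metis
  obtain D where g: "\<And>x. (1 + norm x) ^ (m + n) * cmod (g x) \<le> D" using decay by blast
  have "(1 + norm x) ^ m * cmod (f x * g x) \<le> C * D" for x
  proof -
    have "(1 + norm x) ^ m * cmod (f x * g x) \<le> (1 + norm x) ^ m * ((C * (1 + norm x) ^ n) * cmod (g x))"
      unfolding norm_mult by (intro mult_left_mono mult_right_mono f) auto
    also have "\<dots> = C * ((1 + norm x) ^ (m + n) * cmod (g x))" by (simp add: power_add)
    also have "\<dots> \<le> C * D" by (intro mult_left_mono g f)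
    finally show ?thesis .
  qed
  then show ?thesis by blast
qed

text \<open>A class for \<open>schwartz_coinduct\<close>: the product rule turns one product of a
  slow and a Schwartz function into two, so sums of such products are needed for closure under
  derivatives.\<close>

inductive_set schwartz_span :: "(real^'n \<Rightarrow> complex) set" where
  mult: "f \<in> slow \<Longrightarrow> \<phi> \<in> schwartz \<Longrightarrow> (\<lambda>x. f x * \<phi> x) \<in> schwartz_span"
| add: "f \<in> schwartz_span \<Longrightarrow> g \<in> schwartz_span \<Longrightarrow> (\<lambda>x. f x + g x) \<in> schwartz_span"

lemma schwartz_span_differentiable: "f \<in> schwartz_span \<Longrightarrow> f differentiable at x"
proof (induction rule: schwartz_span.induct)
  case (mult f \<phi>)
  then show ?case by (intro differentiable_mult slow_differentiable schwartz_differentiable)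
qed (rule differentiable_add)

lemma schwartz_span_subset: "schwartz_span \<subseteq> schwartz"
proof
  fix \<phi> assume "\<phi> \<in> schwartz_span"
  then show "\<phi> \<in> schwartz"
  proof (rule schwartz_coinduct)
    fix f m assume "f \<in> schwartz_span"
    then show "\<exists>C. \<forall>x. (1 + norm x) ^ m * cmod (f x) \<le> C"
    proof (induction rule: schwartz_span.induct)
      case (mult f \<phi>) then show ?case by (intro slow_mult_decay schwartz_decay)
    next
      case (add f g)
      then obtain C D where "\<And>x. (1 + norm x) ^ m * cmod (f x) \<le> C" "\<And>x. (1 + norm x) ^ m * cmod (g x) \<le> D"
        by blast
      then have "(1 + norm x) ^ m * cmod (f x + g x) \<le> C + D" for x
        using mult_left_mono[OF norm_triangle_ineq[of "f x" "g x"], of "(1 + norm x) ^ m"]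
        by (simp add: distrib_left) (smt (verit, best))
      then show ?case by blast
    qed
  next
    fix f i assume "f \<in> schwartz_span"
    then show "partial i f \<in> schwartz_span"
    proof (induction rule: schwartz_span.induct)
      case (mult f \<phi>)
      then have "partial i (\<lambda>x. f x * \<phi> x) = (\<lambda>x. f x * partial i \<phi> x + partial i f x * \<phi> x)"
        using partial_mult slow_differentiable schwartz_differentiable by blast
      then show ?case using mult by (auto intro!: schwartz_span.intros slow_partial schwartz_partial)
    next
      case (add f g)
      then have "partial i (\<lambda>x. f x + g x) = (\<lambda>x. partial i f x + partial i g x)"
        using partial_add schwartz_span_differentiable by blast
      then show ?case using add by (auto intro!: schwartz_span.intros)
    qed
  qed (rule schwartz_span_differentiable)
qed

lemma schwartz_mult: "f \<in> slow \<Longrightarrow> \<phi> \<in> schwartz \<Longrightarrow> (\<lambda>x. f x * \<phi> x) \<in> schwartz"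
  using schwartz_span.mult schwartz_span_subset by blast

lemma schwartz_diff: "\<phi> \<in> schwartz \<Longrightarrow> \<psi> \<in> schwartz \<Longrightarrow> (\<lambda>x. \<phi> x - \<psi> x) \<in> schwartz"
  using schwartz_span.add[OF schwartz_span.mult[OF slow.const[of 1], of \<phi>] schwartz_span.mult[OF slow.const[of "-1"], of \<psi>]]
    schwartz_span_subset by auto

text \<open>Each derivative of the Gaussian is a slow function times the Gaussian, so these products
  form a class closed under partial derivatives.\<close>

lemma schwartz_gauss:
  assumes c: "c > 0"
  shows "(\<lambda>x. complex_of_real (exp (- (c * (norm x)\<^sup>2)))) \<in> (schwartz :: (real^'n \<Rightarrow> complex) set)"
proof -
  let ?g = "\<lambda>x::real^'n. complex_of_real (exp (- (c * (norm x)\<^sup>2)))"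
  have der: "(?g has_derivative (\<lambda>h. complex_of_real (exp (- (c * (norm x)\<^sup>2)) * (- (c * (2 * (x \<bullet> h))))))) (at x)" for x
  proof -
    have "((\<lambda>x. - (c * (norm x)\<^sup>2)) has_derivative (\<lambda>h. - (c * (2 * (x \<bullet> h))))) (at x)"
      by (auto intro!: derivative_eq_intros norm_sq_derivative)
    from has_derivative_of_real[OF has_derivative_exp[OF this], where 'a = complex] show ?thesis by (simp add: mult.commute)
  qed
  then have dg: "?g differentiable at x" for x unfolding differentiable_def by blast
  define S where "S = {(\<lambda>x. f x * ?g x) | f. f \<in> slow}"
  have "(\<lambda>x. 1 * ?g x) \<in> S" unfolding S_def by (rule CollectI, rule exI[of _ "\<lambda>x. 1"]) (simp add: slow.const)
  then have "?g \<in> S" by simp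
  then show ?thesis
  proof (rule schwartz_coinduct)
    fix f x assume "f \<in> S"
    then obtain h where "h \<in> slow" "f = (\<lambda>x. h x * ?g x)" unfolding S_def by blast
    then show "f differentiable at x" using differentiable_mult[OF slow_differentiable dg] by blast
  next
    fix f m assume "f \<in> S"
    \<comment> \<open>One term of the exponential series gives
      \<open>(1 + norm x) ^ m \<le> fact m * exp (1 + norm x)\<close>; completing the square bounds
      \<open>norm x - c * (norm x)\<^sup>2\<close> by \<open>1 / (4 * c)\<close>.\<close>
    have "(1 + norm x) ^ m * cmod (?g x) \<le> fact m * exp (1 + 1 / (4 * c))" for m and x :: "real^'n"
    proof -
      have "(1 + norm x) ^ m / fact m \<le> exp (1 + norm x)"
        using exp_ge_one_plus_x_over_n_power_n[of m] 
          sum_le_suminf[OF summable_exp_generic[of "1 + norm x"], of "{m}"]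
        by (simp add: exp_def scaleR_conv_of_real field_simps)
      then have "(1 + norm x) ^ m * exp (- (c * (norm x)\<^sup>2)) \<le> fact m * exp (1 + norm x) * exp (- (c * (norm x)\<^sup>2))"
        by (intro mult_right_mono) (auto simp: field_simps)
      also have "\<dots> = fact m * exp (1 + norm x - c * (norm x)\<^sup>2)"
        by (simp add: exp_diff exp_minus divide_inverse)
      also have "\<dots> \<le> fact m * exp (1 + 1 / (4 * c))"
      proof -
        have "0 \<le> c * (norm x - 1 / (2 * c))\<^sup>2" using c by simp
        also have "\<dots> = c * (norm x)\<^sup>2 - norm x + 1 / (4 * c)"
          using c by (simp add: power2_eq_square field_simps)
        finally show ?thesis by simp
      qed
      finally show ?thesis by simp
    qed
    with \<open>f \<in> S\<close> show "\<exists>C. \<forall>x. (1 + norm x) ^ m * cmod (f x) \<le> C"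
      unfolding S_def using slow_mult_decay[of _ ?g] by blast
  next
    fix f i assume "f \<in> S"
    then obtain h where h: "h \<in> slow" "f = (\<lambda>x. h x * ?g x)" unfolding S_def by blast
    have "partial i ?g x = (complex_of_real (- 2 * c) * complex_of_real (x $ i)) * ?g x" for x
      by (subst partial_eqI[OF der]) (simp add: inner_axis)
    then have "partial i f = (\<lambda>x. (h x * (complex_of_real (- 2 * c) * complex_of_real (x $ i)) + partial i h x) * ?g x)"
      unfolding h(2) by (subst partial_mult[OF slow_differentiable[OF h(1)] dg, THEN ext]) (auto simp: algebra_simps)
    moreover have "(\<lambda>x. h x * (complex_of_real (- 2 * c) * complex_of_real (x $ i)) + partial i h x) \<in> slow"
      using h(1) by (intro slow.intros slow_partial)
    ultimately show "partial i f \<in> S"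
      unfolding S_def by (intro CollectI exI[of _ "\<lambda>x. h x * (complex_of_real (- 2 * c) * complex_of_real (x $ i)) + partial i h x"] conjI)
  qed
qed

text \<open>The universal integrable majorant. The product form makes its integral a product of
  arctangent integrals, and its reciprocal is a polynomial in the coordinates, which matters for
  decay on the Fourier side.\<close>

definition weight :: "real^'n \<Rightarrow> real" where
  "weight x = (\<Prod>i\<in>UNIV. 1 / (1 + (x $ i)\<^sup>2))"

lemma weight_pos: "0 < weight x"
  unfolding weight_def by (intro prod_pos) (auto simp: add_pos_nonneg)

lemma weight_le_1: "weight x \<le> 1"
  unfolding weight_def by (intro prod_le_1) (auto simp: divide_le_eq add_pos_nonneg)

lemma weight_measurable [measurable]: "weight \<in> borel_measurable borel"
proof -
  have "continuous_on UNIV (weight :: real^'n \<Rightarrow> real)"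
    unfolding weight_def[abs_def]
    by (intro continuous_intros) (simp add: add_nonneg_eq_0_iff)
  then show ?thesis by (rule borel_measurable_continuous_onI)
qed

lemma integrable_one_over_one_plus_sq: "integrable lborel (\<lambda>t::real. 1 / (1 + t\<^sup>2))"
proof -
  have "set_integrable lborel (einterval (-\<infinity>) \<infinity>) (\<lambda>t::real. 1 / (1 + t\<^sup>2))"
  proof (rule interval_integral_FTC_nonneg)
    show "DERIV arctan x :> 1 / (1 + x\<^sup>2)" for x :: real
      by (rule derivative_eq_intros) (auto simp: field_simps)
    show "isCont (\<lambda>x. 1 / (1 + x\<^sup>2)) x" for x :: real
      by (intro continuous_intros) (simp add: add_nonneg_eq_0_iff)
    show "((arctan \<circ> real_of_ereal) \<longlongrightarrow> - (pi / 2)) (at_right (-\<infinity>))"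
      unfolding comp_def at_right_MInf by (simp add: filterlim_filtermap tendsto_arctan_at_bot)
    show "((arctan \<circ> real_of_ereal) \<longlongrightarrow> pi / 2) (at_left \<infinity>)"
      unfolding comp_def at_left_PInf by (simp add: filterlim_filtermap tendsto_arctan_at_top)
  qed auto
  then show ?thesis by (simp add: set_integrable_def)
qed

lemma prod_Basis_cart: "(\<Prod>b\<in>Basis. F ((x::real^'n) \<bullet> b)) = (\<Prod>i\<in>UNIV. F (x $ i))"
proof -
  have B: "(Basis :: (real^'n) set) = range (\<lambda>i. axis i 1)" by (auto simp: Basis_vec_def)
  have "inj (\<lambda>i. axis i (1::real) :: real^'n)" by (auto simp: inj_def axis_eq_axis)
  then show ?thesis unfolding B by (simp add: prod.reindex inner_axis)
qed

lemma weight_integrable: "integrable lborel weight"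
proof -
  have "integrable lborel (\<lambda>x::real^'n. \<Prod>b\<in>Basis. complex_of_real (1 / (1 + (x \<bullet> b)\<^sup>2)))"
    by (rule lborel_prod_coordinates(1)) (simp only: complex_of_real_integrable_eq integrable_one_over_one_plus_sq)
  then have "integrable lborel (\<lambda>x::real^'n. complex_of_real (weight x))"
    by (simp add: prod_Basis_cart[of "\<lambda>t. complex_of_real (1 / (1 + t\<^sup>2))", simplified] weight_def)
  then show ?thesis by (simp add: complex_of_real_integrable_eq)
qed

text \<open>Each of the N factors \<open>1 + (x $ i)\<^sup>2\<close> is at most
  \<open>(1 + norm x)\<^sup>2\<close>. Hence decay of order 2 N is enough for domination by a
  multiple of \<open>weight\<close>.\<close>

lemma weight_lower: "1 \<le> (1 + norm x) ^ (2 * CARD('n)) * weight x" for x :: "real^'n"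
proof -
  have "(\<Prod>i\<in>(UNIV::'n set). 1 + (x $ i)\<^sup>2) \<le> (\<Prod>i\<in>(UNIV::'n set). (1 + norm x)\<^sup>2)"
  proof (intro prod_mono conjI)
    fix i
    have "(x $ i)\<^sup>2 \<le> (norm x)\<^sup>2" using component_le_norm_cart[of x i] by (simp add: abs_le_square_iff[symmetric])
    then show "1 + (x $ i)\<^sup>2 \<le> (1 + norm x)\<^sup>2" using norm_ge_zero[of x] by (simp add: power2_sum del: norm_ge_zero)
  qed simp
  also have "\<dots> = (1 + norm x) ^ (2 * CARD('n))" by (simp add: power_mult)
  finally have "(\<Prod>i\<in>(UNIV::'n set). 1 + (x $ i)\<^sup>2) * weight x \<le> (1 + norm x) ^ (2 * CARD('n)) * weight x"
    using weight_pos[of x] by (intro mult_right_mono) auto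
  moreover have "(\<Prod>i\<in>(UNIV::'n set). 1 + (x $ i)\<^sup>2) * weight x = 1"
    unfolding weight_def prod.distrib[symmetric] by (rule prod.neutral) (simp add: add_nonneg_eq_0_iff)
  ultimately show ?thesis by simp
qed

lemma schwartz_le_weight:
  assumes "\<phi> \<in> schwartz"
  obtains C where "0 \<le> C" "\<And>x. cmod (\<phi> x) \<le> C * weight x"
proof -
  obtain C where C: "\<And>x. (1 + norm x) ^ (2 * CARD('a)) * cmod (\<phi> x) \<le> C"
    using schwartz_decay[OF assms] by blast
  have "cmod (\<phi> x) \<le> C * weight x" for x
  proof -
    have "cmod (\<phi> x) \<le> ((1 + norm x) ^ (2 * CARD('a)) * weight x) * cmod (\<phi> x)"
      using mult_right_mono[OF weight_lower[of x], of "cmod (\<phi> x)"] by simp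
    also have "\<dots> \<le> C * weight x"
      using mult_right_mono[OF C[of x], of "weight x"] weight_pos[of x] by (simp add: mult_ac)
    finally show ?thesis .
  qed
  moreover have "0 \<le> C" using C[of 0] by (meson order_trans mult_nonneg_nonneg norm_ge_zero zero_le_power add_nonneg_nonneg zero_le_one)
  ultimately show ?thesis using that by blast
qed

lemma schwartz_measurable: "\<phi> \<in> schwartz \<Longrightarrow> \<phi> \<in> borel_measurable borel"
  by (intro borel_measurable_continuous_onI)
    (simp add: continuous_on_eq_continuous_at differentiable_imp_continuous_within schwartz_differentiable)

lemma schwartz_integrable:
  assumes "\<phi> \<in> schwartz" shows "integrable lborel \<phi>"
proof -
  obtain C where C: "0 \<le> C" "\<And>x. cmod (\<phi> x) \<le> C * weight x" using schwartz_le_weight[OF assms] by blast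
  show ?thesis
    by (rule Bochner_Integration.integrable_bound[of _ "\<lambda>x. C * weight x"])
      (auto simp: weight_integrable schwartz_measurable assms intro!: order_trans[OF C(2)] abs_ge_self)
qed

text \<open>Difference quotients have integral 0 by translation invariance of Lebesgue measure, and
  dominated convergence passes this on to the derivative.\<close>

lemma integral_partial_zero:
  fixes \<phi> :: "real^'n \<Rightarrow> complex"
  assumes "\<phi> \<in> schwartz" shows "(\<integral>x. partial i \<phi> x \<partial>lborel) = 0"
proof -
  define e where "e = (axis i 1 :: real^'n)"
  have ne: "norm e = 1" by (simp add: e_def)
  define s where "s = (\<lambda>n. 1 / real (Suc n))"
  have s: "0 < s n" "s n \<le> 1" for n by (auto simp: s_def)
  have s0: "s \<longlonglongrightarrow> 0" unfolding s_def using LIMSEQ_inverse_real_of_nat by (simp add: inverse_eq_divide)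
  define q where "q = (\<lambda>n x. (\<phi> (x + s n *\<^sub>R e) - \<phi> x) /\<^sub>R s n)"
  have [measurable]: "\<phi> \<in> borel_measurable borel" "partial i \<phi> \<in> borel_measurable borel"
    using schwartz_measurable assms schwartz_partial by blast+
  have der: "((\<lambda>t. \<phi> (x + t *\<^sub>R e)) has_vector_derivative partial i \<phi> (x + t *\<^sub>R e)) (at t within A)" for x t A
  proof -
    have "(\<phi> has_derivative frechet_derivative \<phi> (at (x + t *\<^sub>R e))) (at (x + t *\<^sub>R e))"
      using schwartz_differentiable[OF assms] frechet_derivative_works by blast
    from this have "((\<lambda>t. \<phi> (x + t *\<^sub>R e)) has_derivative (\<lambda>h. frechet_derivative \<phi> (at (x + t *\<^sub>R e)) (h *\<^sub>R e))) (at t within A)"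
      by (rule has_derivative_compose[rotated]) (auto intro!: derivative_eq_intros)
    then show ?thesis unfolding has_vector_derivative_def
      by (simp add: linear_cmul[OF linear_frechet_derivative[OF schwartz_differentiable[OF assms]]] partial_def e_def)
  qed
  obtain C where C: "\<And>x. (1 + norm x) ^ (2 * CARD('n)) * cmod (partial i \<phi> x) \<le> C"
    using schwartz_decay[OF schwartz_partial[OF assms]] by blast
  define D where "D = C * 2 ^ (2 * CARD('n))"
  have le_double: "0 \<le> b \<Longrightarrow> a \<le> b + 1 \<Longrightarrow> 1 + a \<le> 2 * (1 + b)" for a b :: real
    by simp
  \<comment> \<open>A translation of length at most 1 changes \<open>1 + norm x\<close> by at most a
    factor 2; raised to the power 2 N this is the extra constant in \<open>D\<close>.\<close>
  have bd: "cmod (partial i \<phi> (x + t *\<^sub>R e)) \<le> D * weight x" if "0 \<le> t" "t \<le> 1" for x t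
  proof -
    let ?P = "cmod (partial i \<phi> (x + t *\<^sub>R e))"
    have "norm x \<le> norm (x + t *\<^sub>R e) + 1"
      using norm_triangle_ineq4[of "x + t *\<^sub>R e" "t *\<^sub>R e"] that ne by simp
    then have "1 + norm x \<le> 2 * (1 + norm (x + t *\<^sub>R e))"
      using le_double[OF norm_ge_zero[of "x + t *\<^sub>R e"]] by blast
    then have "(1 + norm x) ^ (2 * CARD('n)) \<le> (2 * (1 + norm (x + t *\<^sub>R e))) ^ (2 * CARD('n))"
      by (intro power_mono) auto
    then have "(1 + norm x) ^ (2 * CARD('n)) * ?P \<le> 2 ^ (2 * CARD('n)) * ((1 + norm (x + t *\<^sub>R e)) ^ (2 * CARD('n)) * ?P)"
      unfolding mult.assoc[symmetric] power_mult_distrib[symmetric] by (rule mult_right_mono) simp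
    also have "\<dots> \<le> D" unfolding D_def using C[of "x + t *\<^sub>R e"] by (simp add: mult.commute)
    finally have *: "(1 + norm x) ^ (2 * CARD('n)) * ?P \<le> D" .
    have "?P \<le> ((1 + norm x) ^ (2 * CARD('n)) * weight x) * ?P"
      using mult_right_mono[OF weight_lower[of x], of ?P] by simp
    also have "\<dots> \<le> D * weight x"
      using mult_right_mono[OF *, of "weight x"] weight_pos[of x] by (simp add: mult_ac)
    finally show ?thesis .
  qed
  have lim: "(\<lambda>n. q n x) \<longlonglongrightarrow> partial i \<phi> x" for x
  proof -
    have "((\<lambda>h. (\<phi> (x + h *\<^sub>R e) - \<phi> x) /\<^sub>R h) \<longlongrightarrow> partial i \<phi> x) (at 0)"
    proof -
      have "((\<lambda>h. norm (\<phi> (x + h *\<^sub>R e) - \<phi> x - h *\<^sub>R partial i \<phi> x) / norm h) \<longlongrightarrow> 0) (at 0)"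
        using der[of x 0 UNIV] by (simp add: has_vector_derivative_def has_derivative_at)
      also have "?this \<longleftrightarrow> ((\<lambda>h. norm ((\<phi> (x + h *\<^sub>R e) - \<phi> x) /\<^sub>R h - partial i \<phi> x)) \<longlongrightarrow> 0) (at 0)"
      proof (rule tendsto_cong, rule eventually_mono[OF eventually_neq_at_within[of 0 0]])
        fix h :: real assume "h \<noteq> 0"
        then have "(\<phi> (x + h *\<^sub>R e) - \<phi> x) /\<^sub>R h - partial i \<phi> x = (\<phi> (x + h *\<^sub>R e) - \<phi> x - h *\<^sub>R partial i \<phi> x) /\<^sub>R h"
          by (simp add: scaleR_diff_right)
        then show "norm (\<phi> (x + h *\<^sub>R e) - \<phi> x - h *\<^sub>R partial i \<phi> x) / norm h = norm ((\<phi> (x + h *\<^sub>R e) - \<phi> x) /\<^sub>R h - partial i \<phi> x)"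
          by (simp add: divide_inverse mult.commute)
      qed
      finally show ?thesis by (simp add: tendsto_norm_zero_iff LIM_zero_iff)
    qed
    moreover have "filterlim s (at 0) sequentially"
      unfolding filterlim_at using s0 s(1) by (auto simp: s_def)
    ultimately show ?thesis unfolding q_def by (rule filterlim_compose)
  qed
  have "(\<lambda>n. \<integral>x. q n x \<partial>lborel) \<longlonglongrightarrow> (\<integral>x. partial i \<phi> x \<partial>lborel)"
  proof (rule integral_dominated_convergence[where w = "\<lambda>x. D * weight x"])
    show "AE x in lborel. norm (q n x) \<le> D * weight x" for n
    proof (rule AE_I2)
      fix x
      \<comment> \<open>The mean value inequality on the segment from x in direction
        \<open>e\<close>, of length \<open>s n \<le> 1\<close>, makes the bound on the derivative a
        bound on the difference quotient.\<close>
      have "norm (\<phi> (x + s n *\<^sub>R e) - \<phi> (x + 0 *\<^sub>R e)) \<le> (D * weight x) * norm (s n - 0)"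
      proof (rule differentiable_bound[of "{0..1}"])
        show "((\<lambda>t. \<phi> (x + t *\<^sub>R e)) has_derivative (\<lambda>h. h *\<^sub>R partial i \<phi> (x + t *\<^sub>R e))) (at t within {0..1})" for t
          using der by (simp add: has_vector_derivative_def)
        show "onorm (\<lambda>h. h *\<^sub>R partial i \<phi> (x + t *\<^sub>R e)) \<le> D * weight x" if "t \<in> {0..1}" for t
          using bd[of t x] that by (intro onorm_le) (simp add: mult.commute mult_left_mono)
      qed (use s[of n] in auto)
      then show "norm (q n x) \<le> D * weight x"
        using s(1)[of n] pos_divide_le_eq[OF s(1)[of n], of "cmod (\<phi> (x + s n *\<^sub>R e) - \<phi> x)" "D * weight x"]
        by (simp add: q_def divide_inverse mult.commute)
    qed
  qed (use lim in \<open>auto simp: weight_integrable q_def\<close>)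
  moreover have "(\<integral>x. q n x \<partial>lborel) = 0" for n
    using schwartz_integrable[OF assms] integrable_lborel_shift[OF schwartz_integrable[OF assms], of "s n *\<^sub>R e"]
    by (simp add: q_def integral_lborel_shift)
  ultimately show ?thesis by (simp add: LIMSEQ_const_iff)
qed

section \<open>Derivatives, decay and Gaussians under the Fourier transform\<close>

lemma fourier_measurable [measurable]:
  assumes [measurable]: "\<phi> \<in> borel_measurable borel"
  shows "fourier \<phi> \<in> borel_measurable borel"
  unfolding fourier_def[abs_def] by measurable

lemma fourier_bounded:
  "cmod (fourier \<phi> \<xi>) \<le> (2 * pi) powr (- real CARD('n) / 2) * (\<integral>x. cmod (\<phi> x) \<partial>lborel)" for \<xi> :: "real^'n"
  unfolding fourier_def norm_mult
  by (rule mult_mono[OF _ order_trans[OF integral_norm_bound]]) (auto simp: norm_mult)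

lemma fourier_integrable:
  fixes \<phi> :: "real^'n \<Rightarrow> complex"
  assumes "integrable lborel \<phi>"
  shows "integrable lborel (\<lambda>x. exp (- \<i> * complex_of_real (\<xi> \<bullet> x)) * \<phi> x)"
  by (rule Bochner_Integration.integrable_bound[OF assms]) (use assms in \<open>auto simp: norm_mult\<close>)

text \<open>Integration by parts: the partial derivative of the character times \<phi> has integral
  0, and the product rule splits it into the two sides.\<close>

lemma fourier_partial:
  assumes "\<phi> \<in> schwartz"
  shows "fourier (partial i \<phi>) \<xi> = \<i> * complex_of_real (\<xi> $ i) * fourier \<phi> \<xi>"
proof -
  let ?e = "\<lambda>x. exp (\<i> * complex_of_real (x \<bullet> - \<xi>))"
  have sl: "?e \<in> slow" by (rule slow.character)
  have "(\<lambda>x. ?e x * \<phi> x) \<in> schwartz" by (rule schwartz_mult[OF sl assms])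
  then have "0 = (\<integral>x. partial i (\<lambda>x. ?e x * \<phi> x) x \<partial>lborel)"
    using integral_partial_zero by metis
  also have "partial i (\<lambda>x. ?e x * \<phi> x) = (\<lambda>x. ?e x * partial i \<phi> x - (\<i> * complex_of_real (\<xi> $ i)) * (?e x * \<phi> x))"
    by (subst partial_mult[OF slow_differentiable[OF sl] schwartz_differentiable[OF assms], THEN ext],
        subst partial_eqI[OF character_derivative]) (simp add: inner_axis' mult_ac)
  also have "?e = (\<lambda>x. exp (- \<i> * complex_of_real (\<xi> \<bullet> x)))"
    by (simp add: inner_commute)
  finally show ?thesis
    unfolding fourier_def
    using fourier_integrable[OF schwartz_integrable[OF assms], of \<xi>]
      fourier_integrable[OF schwartz_integrable[OF schwartz_partial[OF assms]], of \<xi> i]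
    by (simp add: mult.left_commute)
qed

lemma fourier_diff:
  assumes "integrable lborel \<phi>" "integrable lborel \<psi>"
  shows "fourier (\<lambda>x. \<phi> x - \<psi> x) \<xi> = fourier \<phi> \<xi> - fourier \<psi> \<xi>"
  unfolding fourier_def
  using fourier_integrable[OF assms(1), of \<xi>] fourier_integrable[OF assms(2), of \<xi>]
  by (simp add: algebra_simps)

text \<open>The product of the operators \<open>1 - \<partial>\<^sub>i\<^sup>2\<close> has the symbol \<open>1 / weight\<close>.\<close>

lemma fourier_le_weight:
  fixes \<phi> :: "real^'n \<Rightarrow> complex"
  assumes "\<phi> \<in> schwartz"
  obtains C where "0 \<le> C" "\<And>\<xi>. cmod (fourier \<phi> \<xi>) \<le> C * weight \<xi>"
proof -
  have "\<exists>\<psi>\<in>schwartz. \<forall>\<xi>. fourier \<psi> \<xi> = complex_of_real (\<Prod>i\<in>A. 1 + (\<xi> $ i)\<^sup>2) * fourier \<phi> \<xi>" if "finite A" for A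
    using that
  proof (induction A)
    case empty then show ?case using assms by auto
  next
    case (insert i A)
    then obtain \<psi> where \<psi>: "\<psi> \<in> schwartz" "\<And>\<xi>. fourier \<psi> \<xi> = complex_of_real (\<Prod>i\<in>A. 1 + (\<xi> $ i)\<^sup>2) * fourier \<phi> \<xi>"
      by blast
    let ?\<eta> = "\<lambda>x. \<psi> x - partial i (partial i \<psi>) x"
    have "fourier ?\<eta> \<xi> = (1 + (complex_of_real (\<xi> $ i))\<^sup>2) * fourier \<psi> \<xi>" for \<xi>
      by (subst fourier_diff) (auto simp: schwartz_integrable schwartz_partial \<psi>(1) fourier_partial algebra_simps power2_eq_square)
    then have "fourier ?\<eta> \<xi> = complex_of_real (\<Prod>i\<in>insert i A. 1 + (\<xi> $ i)\<^sup>2) * fourier \<phi> \<xi>" for \<xi>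
      using insert.hyps by (simp add: \<psi>(2))
    moreover have "?\<eta> \<in> schwartz" by (intro schwartz_diff schwartz_partial \<psi>(1))
    ultimately show ?case by blast
  qed
  from this[of UNIV] obtain \<psi> where \<psi>: "\<psi> \<in> schwartz"
    "\<And>\<xi>. fourier \<psi> \<xi> = complex_of_real (\<Prod>i\<in>UNIV. 1 + (\<xi> $ i)\<^sup>2) * fourier \<phi> \<xi>" by auto
  define C where "C = (2 * pi) powr (- real CARD('n) / 2) * (\<integral>x. cmod (\<psi> x) \<partial>lborel)"
  have "cmod (fourier \<phi> \<xi>) \<le> C * weight \<xi>" for \<xi>
  proof -
    have "complex_of_real (\<Prod>i\<in>UNIV. 1 + (\<xi> $ i)\<^sup>2) * complex_of_real (weight \<xi>) = 1"
      unfolding weight_def of_real_mult[symmetric] prod.distrib[symmetric]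
      by (subst prod.neutral) (auto simp: add_nonneg_eq_0_iff)
    then have "fourier \<phi> \<xi> = fourier \<psi> \<xi> * complex_of_real (weight \<xi>)"
      by (simp add: \<psi>(2) mult_ac)
    then show ?thesis
      using fourier_bounded[of \<psi> \<xi>] weight_pos[of \<xi>]
      by (simp add: norm_mult C_def mult_right_mono)
  qed
  moreover have "0 \<le> C" unfolding C_def by simp
  ultimately show ?thesis using that by blast
qed

text \<open>The substitution \<open>z = - c *\<^sub>R \<xi>\<close> brings the integral to
  \<open>gauss_fourier\<close>. The result is \<open>(2 * pi) powr (N / 2)\<close> times the heat
  kernel of standard deviation \<open>c\<close> centred at \<open>y\<close>, which makes this kernel
  an admissible test function on the Fourier side.\<close>

lemma fourier_gauss:
  fixes x y :: "real^'n"
  assumes c: "c > 0"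
  shows "fourier (\<lambda>\<xi>. exp (\<i> * complex_of_real (\<xi> \<bullet> y)) * complex_of_real (exp (- (c\<^sup>2 / 2 * (norm \<xi>)\<^sup>2)))) x
    = complex_of_real ((1 / c) ^ CARD('n) * (2 * pi) powr (real CARD('n) / 2)) * complex_of_real (gauss_density ((1 / c) *\<^sub>R (y - x)))"
proof -
  let ?\<eta> = "(1 / c) *\<^sub>R (x - y)"
  let ?K = "(2 * pi) powr (real CARD('n) / 2)"
  let ?f = "\<lambda>z. exp (\<i> * complex_of_real (?\<eta> \<bullet> z)) * complex_of_real (gauss_density z)"
  have K: "(2 * pi) powr (- real CARD('n) / 2) = 1 / ?K" "?K > 0"
    by (auto simp: powr_minus_divide)
  have e: "exp (- \<i> * complex_of_real (x \<bullet> \<xi>)) * (exp (\<i> * complex_of_real (\<xi> \<bullet> y)) * complex_of_real (exp (- (c\<^sup>2 / 2 * (norm \<xi>)\<^sup>2))))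
     = complex_of_real ?K * ?f (0 - c *\<^sub>R \<xi>)" for \<xi>
    using c K by (simp add: gauss_density_def mult_exp_exp inner_diff_left inner_commute power_mult_distrib algebra_simps)
  have [measurable]: "?f \<in> borel_measurable borel" by measurable
  have "(\<integral>\<xi>. exp (- \<i> * complex_of_real (x \<bullet> \<xi>)) * (exp (\<i> * complex_of_real (\<xi> \<bullet> y)) * complex_of_real (exp (- (c\<^sup>2 / 2 * (norm \<xi>)\<^sup>2)))) \<partial>lborel)
    = complex_of_real ?K * (\<integral>\<xi>. ?f (0 - c *\<^sub>R \<xi>) \<partial>lborel)"
    unfolding e by (rule integral_mult_right_zero)
  also have "(\<integral>\<xi>. ?f (0 - c *\<^sub>R \<xi>) \<partial>lborel) = ((1 / c) ^ CARD('n)) *\<^sub>R (\<integral>\<xi>. ?f \<xi> \<partial>lborel)"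
    using integral_lborel_scale[of ?f c 0] c by simp
  also have "(\<integral>\<xi>. ?f \<xi> \<partial>lborel) = exp (- (norm ?\<eta>)\<^sup>2 / 2)" by (rule gauss_fourier(2))
  also have "norm ?\<eta> = norm ((1 / c) *\<^sub>R (y - x))" by (simp add: norm_minus_commute)
  finally show ?thesis
    unfolding fourier_def using K by (simp add: gauss_density_def scaleR_conv_of_real)
qed

section \<open>Averages of translates of Lebesgue functions\<close>

text \<open>Since \<open>ennreal\<close> cuts off negative values, \<open>?M\<close> and
  \<open>?N\<close> have the positive and the negative part of \<open>u\<close> as densities. They
  are finite and equal on boxes, an intersection-stable generator, hence equal as measures; so both
  parts agree almost everywhere, which forces both to be 0.\<close>

lemma AE_zero_if_box_integrals_zero:
  fixes u :: "'a::euclidean_space \<Rightarrow> real"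
  assumes [measurable]: "u \<in> borel_measurable borel"
    and int: "\<And>a b. integrable lborel (\<lambda>x. indicator (box a b) x * u x)"
    and zero: "\<And>a b. (\<integral>x. indicator (box a b) x * u x \<partial>lborel) = 0"
  shows "AE x in lborel. u x = 0"
proof -
  let ?M = "density lborel (\<lambda>x. ennreal (u x))" and ?N = "density lborel (\<lambda>x. ennreal (- u x))"
  have eq: "emeasure ?M (box a b) = emeasure ?N (box a b)" and fin: "emeasure ?M (box a b) \<noteq> \<infinity>" for a b
  proof -
    let ?v = "\<lambda>x. indicator (box a b) x * u x"
    have *: "ennreal (u x) * indicator (box a b) x = ennreal (?v x)"
      "ennreal (- u x) * indicator (box a b) x = ennreal (- ?v x)" for x
      by (auto split: split_indicator)
    have f: "(\<integral>\<^sup>+x. ennreal (?v x) \<partial>lborel) < \<infinity>" "(\<integral>\<^sup>+x. ennreal (- ?v x) \<partial>lborel) < \<infinity>"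
      using int[of a b] unfolding real_integrable_def by (auto simp: less_top)
    then show "emeasure ?M (box a b) \<noteq> \<infinity>"
      by (simp add: emeasure_density *)
    have "enn2real (\<integral>\<^sup>+x. ennreal (?v x) \<partial>lborel) = enn2real (\<integral>\<^sup>+x. ennreal (- ?v x) \<partial>lborel)"
      using zero[of a b] real_lebesgue_integral_def[OF int[of a b]] by simp
    then have "(\<integral>\<^sup>+x. ennreal (?v x) \<partial>lborel) = (\<integral>\<^sup>+x. ennreal (- ?v x) \<partial>lborel)"
      using f by (metis ennreal_enn2real infinity_ennreal_def)
    then show "emeasure ?M (box a b) = emeasure ?N (box a b)"
      by (simp add: emeasure_density *)
  qed
  have "?M = ?N"
  proof (rule measure_eqI_generator_eq)
    let ?E = "range (\<lambda>(a, b). box a b::'a set)"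
    show "Int_stable ?E"
      by (auto simp: Int_stable_def box_Int_box)
    show "?E \<subseteq> Pow UNIV" "sets ?M = sigma_sets UNIV ?E" "sets ?N = sigma_sets UNIV ?E"
      by (simp_all add: borel_eq_box)
    let ?A = "\<lambda>n::nat. box (- (real n *\<^sub>R One)) (real n *\<^sub>R One) :: 'a set"
    show "range ?A \<subseteq> ?E" "(\<Union>i. ?A i) = UNIV"
      unfolding UN_box_eq_UNIV by auto
    show "emeasure ?M (?A i) \<noteq> \<infinity>" for i by (rule fin)
    show "emeasure ?M X = emeasure ?N X" if "X \<in> ?E" for X
      using that eq by auto
  qed
  then have "AE x in lborel. ennreal (u x) = ennreal (- u x)"
    by (intro sigma_finite_measure.density_unique[OF sigma_finite_lborel]) auto
  then show ?thesis
  proof eventually_elim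
    fix x assume "ennreal (u x) = ennreal (- u x)"
    then show "u x = 0"
      by (cases "0 \<le> u x") (auto simp: ennreal_neg ennreal_eq_0_iff dest: sym)
  qed
qed

section \<open>Lebesgue functions and their pairing with decaying functions\<close>

lemma Lp_iff: "f \<in> carr (Lp p) \<longleftrightarrow> f \<in> borel_measurable borel \<and> integrable lborel (\<lambda>x. cmod (f x) powr p)"
  by (simp add: Lp_def)

lemma Lp_measurable: "f \<in> carr (Lp p) \<Longrightarrow> f \<in> borel_measurable borel"
  by (simp add: Lp_iff)

lemma Lp_nn_iff: "f \<in> carr (Lp p) \<longleftrightarrow> f \<in> borel_measurable borel \<and> (\<integral>\<^sup>+x. ennreal (cmod (f x) powr p) \<partial>lborel) < \<infinity>"
  unfolding Lp_iff by (auto simp: integrable_iff_bounded)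

lemma Lp_nn_integral:
  "f \<in> carr (Lp p) \<Longrightarrow> (\<integral>\<^sup>+x. ennreal (cmod (f x) powr p) \<partial>lborel) = ennreal (\<integral>x. cmod (f x) powr p \<partial>lborel)"
  by (intro nn_integral_eq_integral) (auto simp: Lp_iff)

lemma fnorm_Lp: "fnorm (Lp p) f = (\<integral>x. cmod (f x) powr p \<partial>lborel) powr (1 / p)"
  by (simp add: Lp_def)

lemma fnorm_Lp_nonneg: "0 \<le> fnorm (Lp p) f"
  by (simp add: fnorm_Lp)

lemma fnorm_Lp_powr:
  assumes "0 < p" shows "fnorm (Lp p) f powr p = (\<integral>x. cmod (f x) powr p \<partial>lborel)"
proof -
  have "0 \<le> (\<integral>x. cmod (f x) powr p \<partial>lborel)" by (rule integral_nonneg_AE) simp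
  then show ?thesis using assms by (simp add: fnorm_Lp powr_powr)
qed

lemma fnorm_Lp_cong_AE:
  assumes "f \<in> borel_measurable borel" "g \<in> borel_measurable borel" "AE x in lborel. f x = g x"
  shows "fnorm (Lp p) f = fnorm (Lp p) g"
  unfolding fnorm_Lp using assms by (intro arg_cong2[where f = "(powr)"] integral_cong_AE) auto

lemma Lp_cong_AE:
  assumes "f \<in> carr (Lp p)" "g \<in> borel_measurable borel" "AE x in lborel. f x = g x"
  shows "g \<in> carr (Lp p)"
proof -
  have "(\<integral>\<^sup>+x. ennreal (cmod (f x) powr p) \<partial>lborel) = (\<integral>\<^sup>+x. ennreal (cmod (g x) powr p) \<partial>lborel)"
    using assms(3) by (intro nn_integral_cong_AE) auto
  then show ?thesis using assms by (simp add: Lp_nn_iff)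
qed

lemma Lp_shift:
  assumes "f \<in> carr (Lp p)"
  shows "(\<lambda>x. f (x - y)) \<in> carr (Lp p)"
proof -
  have [measurable]: "f \<in> borel_measurable borel" using assms by (rule Lp_measurable)
  show ?thesis
    using assms integrable_lborel_shift[of "\<lambda>x. cmod (f x) powr p" "- y"] by (simp add: Lp_iff)
qed

lemma powr_sum_le:
  fixes a b p :: real
  assumes "0 \<le> a" "0 \<le> b" "0 \<le> p"
  shows "(a + b) powr p \<le> 2 powr p * (a powr p + b powr p)"
proof -
  have "(a + b) powr p \<le> (2 * max a b) powr p" using assms by (intro powr_mono2) auto
  also have "\<dots> = 2 powr p * max a b powr p" using assms by (simp add: powr_mult)
  also have "max a b powr p \<le> a powr p + b powr p" by (simp add: max_def)
  finally show ?thesis by simp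
qed

lemma Lp_add:
  assumes p: "0 \<le> p" and f: "f \<in> carr (Lp p)" and g: "g \<in> carr (Lp p)"
  shows "(\<lambda>x. f x + g x) \<in> carr (Lp p)"
proof -
  have [measurable]: "f \<in> borel_measurable borel" "g \<in> borel_measurable borel"
    using f g by (auto dest: Lp_measurable)
  have le: "cmod (f x + g x) powr p \<le> 2 powr p * (cmod (f x) powr p + cmod (g x) powr p)" for x
    using powr_mono2[OF p norm_ge_zero norm_triangle_ineq[of "f x" "g x"]]
      powr_sum_le[OF norm_ge_zero[of "f x"] norm_ge_zero[of "g x"] p] by (rule order_trans)
  have int: "integrable lborel (\<lambda>x. 2 powr p * (cmod (f x) powr p + cmod (g x) powr p))"
    using f g by (simp add: Lp_iff)
  have "integrable lborel (\<lambda>x. cmod (f x + g x) powr p)"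
    by (rule Bochner_Integration.integrable_bound[OF int _ AE_I2])
      (measurable, simp only: real_norm_def abs_of_nonneg[OF powr_ge_zero], rule order_trans[OF le abs_ge_self])
  then show ?thesis by (simp add: Lp_iff)
qed

lemma Lp_cmult:
  assumes "f \<in> carr (Lp p)" shows "(\<lambda>x. c * f x) \<in> carr (Lp p)"
  using assms by (auto simp: Lp_iff norm_mult powr_mult)

lemma Lp_diff:
  assumes p: "0 \<le> p" and f: "f \<in> carr (Lp p)" and g: "g \<in> carr (Lp p)"
  shows "(\<lambda>x. f x - g x) \<in> carr (Lp p)"
  using Lp_add[OF p f Lp_cmult[OF g, of "-1"]] by simp

text \<open>An additive substitute for Hoelder's inequality:
  \<open>cmod (f x) \<le> 1 + cmod (f x) powr p\<close>, where the summand 1 is made integrable by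
  the weight and the other one only uses that the weight is at most 1. It covers p = 1 as well, and
  its integral is the same for all translates of \<open>f\<close>.\<close>

lemma Lp_integrable_bounded_by_weight:
  fixes f \<psi> :: "real^'n \<Rightarrow> complex"
  assumes p: "1 \<le> p" and f: "f \<in> carr (Lp p)" and [measurable]: "\<psi> \<in> borel_measurable borel"
    and C: "\<And>x. cmod (\<psi> x) \<le> C * weight x"
  shows "cmod (f x * \<psi> x) \<le> C * weight x + C * cmod (f x) powr p"
    and "integrable lborel (\<lambda>x. f x * \<psi> x)"
proof -
  have [measurable]: "f \<in> borel_measurable borel" using f by (rule Lp_measurable)
  have C0: "0 \<le> C" using order_trans[OF norm_ge_zero C[of 0]] weight_pos[of "0 :: real^'n"]
    by (simp add: zero_le_mult_iff)
  have le: "cmod (f x * \<psi> x) \<le> C * weight x + C * cmod (f x) powr p" for x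
  proof -
    have "cmod (f x * \<psi> x) \<le> (1 + cmod (f x) powr p) * (C * weight x)"
      unfolding norm_mult by (intro mult_mono le_one_plus_powr C) (use p in auto)
    also have "\<dots> = C * weight x + weight x * (C * cmod (f x) powr p)" by (simp add: algebra_simps)
    also have "\<dots> \<le> C * weight x + 1 * (C * cmod (f x) powr p)"
      using weight_le_1[of x] C0 by (intro add_left_mono mult_right_mono) auto
    finally show ?thesis by simp
  qed
  then show "cmod (f x * \<psi> x) \<le> C * weight x + C * cmod (f x) powr p" .
  show "integrable lborel (\<lambda>x. f x * \<psi> x)"
    by (rule Bochner_Integration.integrable_bound[of _ "\<lambda>x. C * weight x + C * cmod (f x) powr p"])
      (use f in \<open>auto simp: Lp_iff weight_integrable intro!: order_trans[OF le] abs_ge_self\<close>)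
qed

lemma Lp_fourier_integrable:
  assumes "1 \<le> p" "f \<in> carr (Lp p)" "\<phi> \<in> schwartz"
  shows "integrable lborel (\<lambda>x. f x * fourier \<phi> x)"
proof -
  obtain C where C: "\<And>x. cmod (fourier \<phi> x) \<le> C * weight x" using fourier_le_weight[OF assms(3)] by blast
  show ?thesis
    by (rule Lp_integrable_bounded_by_weight(2)[OF assms(1,2) fourier_measurable[OF schwartz_measurable[OF assms(3)]] C])
qed

lemma integrable_pair_if_nn_integral_finite:
  fixes f :: "'a \<Rightarrow> 'b \<Rightarrow> complex"
  assumes "sigma_finite_measure N" and m: "case_prod f \<in> borel_measurable (M \<Otimes>\<^sub>M N)"
    and "(\<integral>\<^sup>+x. \<integral>\<^sup>+y. ennreal (cmod (f x y)) \<partial>N \<partial>M) < \<infinity>"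
  shows "integrable (M \<Otimes>\<^sub>M N) (case_prod f)"
proof -
  interpret sigma_finite_measure N by fact
  have "(\<integral>\<^sup>+z. ennreal (cmod (case_prod f z)) \<partial>(M \<Otimes>\<^sub>M N)) = (\<integral>\<^sup>+x. \<integral>\<^sup>+y. ennreal (cmod (f x y)) \<partial>N \<partial>M)"
    using m by (subst nn_integral_fst[symmetric]) (auto simp: split_beta')
  then show ?thesis using assms by (intro integrableI_bounded) auto
qed

text \<open>Convolution with the law of \<open>Z\<close>, kept as an expectation: Jensen's
  inequality then applies directly, and the characteristic function of \<open>Z\<close> becomes the
  Fourier multiplier. The heat semigroup and the Bessel potentials are both instances.\<close>

definition avg :: "'b measure \<Rightarrow> ('b \<Rightarrow> real^'n) \<Rightarrow> (real^'n \<Rightarrow> complex) \<Rightarrow> real^'n \<Rightarrow> complex" where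
  "avg P Z h x = (\<integral>\<omega>. h (x - Z \<omega>) \<partial>P)"

context
  fixes P :: "'b measure" and Z :: "'b \<Rightarrow> real^'n"
  assumes P: "prob_space P" and Z [measurable]: "Z \<in> borel_measurable P"
begin

interpretation prob_space P by (rule P)
interpretation pair_sigma_finite P "lborel :: (real^'n) measure" ..

lemma avg_measurable [measurable]:
  assumes [measurable]: "h \<in> borel_measurable borel"
  shows "avg P Z h \<in> borel_measurable borel"
  unfolding avg_def[abs_def] by measurable

lemma nn_integral_shifts:
  assumes [measurable]: "h \<in> borel_measurable borel"
  shows "(\<integral>\<^sup>+\<omega>. \<integral>\<^sup>+x. h (x - Z \<omega>) \<partial>lborel \<partial>P) = (\<integral>\<^sup>+x. h x \<partial>lborel)"
proof -
  have "(\<integral>\<^sup>+x. h (x - Z \<omega>) \<partial>lborel) = (\<integral>\<^sup>+x. h x \<partial>lborel)" for \<omega>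
    using nn_integral_lborel_shift[of h "- Z \<omega>"] by simp
  then show ?thesis by (simp add: emeasure_space_1)
qed

lemma avg_powr_le:
  assumes [measurable]: "h \<in> borel_measurable borel" and q: "1 \<le> q"
  shows "ennreal (cmod (avg P Z h x) powr q) \<le> (\<integral>\<^sup>+\<omega>. ennreal (cmod (h (x - Z \<omega>)) powr q) \<partial>P)"
  unfolding avg_def by (rule powr_norm_expectation_le) (use q in auto)

text \<open>Jensen under the integral sign, interchange of the two integrals, and translation
  invariance.\<close>

lemma avg_nn_integral_le:
  assumes [measurable]: "h \<in> borel_measurable borel" and q: "1 \<le> q"
  shows "(\<integral>\<^sup>+x. ennreal (cmod (avg P Z h x) powr q) \<partial>lborel) \<le> (\<integral>\<^sup>+x. ennreal (cmod (h x) powr q) \<partial>lborel)"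
proof -
  have "(\<integral>\<^sup>+x. ennreal (cmod (avg P Z h x) powr q) \<partial>lborel) \<le> (\<integral>\<^sup>+x. \<integral>\<^sup>+\<omega>. ennreal (cmod (h (x - Z \<omega>)) powr q) \<partial>P \<partial>lborel)"
    by (intro nn_integral_mono avg_powr_le q) auto
  also have "\<dots> = (\<integral>\<^sup>+\<omega>. \<integral>\<^sup>+x. ennreal (cmod (h (x - Z \<omega>)) powr q) \<partial>lborel \<partial>P)"
    by (rule Fubini') measurable
  also have "\<dots> = (\<integral>\<^sup>+x. ennreal (cmod (h x) powr q) \<partial>lborel)"
    by (rule nn_integral_shifts) measurable
  finally show ?thesis .
qed

lemma avg_Lp:
  assumes "1 \<le> p" "h \<in> carr (Lp p)"
  shows "avg P Z h \<in> carr (Lp p)"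
  using assms avg_nn_integral_le[of h p] unfolding Lp_nn_iff
  by (auto intro: le_less_trans)

text \<open>These are the hypotheses for interchanging the integrals, before and after the
  translation is moved from \<open>h\<close> to the test function. The inner integral is at most
  \<open>B\<close> for every translation, and \<open>P\<close> has mass 1.\<close>

lemma avg_integrable_prod:
  fixes \<psi> :: "real^'n \<Rightarrow> complex"
  assumes p: "1 \<le> p" and h: "h \<in> carr (Lp p)" and [measurable]: "\<psi> \<in> borel_measurable borel"
    and C: "\<And>x. cmod (\<psi> x) \<le> C * weight x"
  shows "integrable (P \<Otimes>\<^sub>M lborel) (\<lambda>(\<omega>, x). h (x - Z \<omega>) * \<psi> x)"
    and "integrable (P \<Otimes>\<^sub>M lborel) (\<lambda>(\<omega>, x). h x * \<psi> (x + Z \<omega>))"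
proof -
  have [measurable]: "h \<in> borel_measurable borel" using h by (rule Lp_measurable)
  have C0: "0 \<le> C" using order_trans[OF norm_ge_zero C[of 0]] weight_pos[of "0 :: real^'n"]
    by (simp add: zero_le_mult_iff)
  define B where "B = (\<integral>\<^sup>+x. ennreal (C * weight (x :: real^'n)) \<partial>lborel) + ennreal C * (\<integral>\<^sup>+x. ennreal (cmod (h x) powr p) \<partial>lborel)"
  have "B < \<infinity>"
    using weight_integrable integrable_mult_right[OF weight_integrable, of C] h
    unfolding integrable_iff_bounded Lp_nn_iff B_def by (auto simp: ennreal_mult_less_top less_imp_le[OF weight_pos] C0 abs_mult)
  have le: "(\<integral>\<^sup>+x. ennreal (cmod (h (x - z) * \<psi> x)) \<partial>lborel) \<le> B" for z
  proof -
    have "(\<integral>\<^sup>+x. ennreal (cmod (h (x - z) * \<psi> x)) \<partial>lborel) \<le>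
      (\<integral>\<^sup>+x. ennreal (C * weight x) + ennreal C * ennreal (cmod (h (x - z)) powr p) \<partial>lborel)"
    proof (rule nn_integral_mono)
      fix x
      show "ennreal (cmod (h (x - z) * \<psi> x)) \<le> ennreal (C * weight x) + ennreal C * ennreal (cmod (h (x - z)) powr p)"
        using Lp_integrable_bounded_by_weight(1)[OF p Lp_shift[OF h, of z] _ C, of x] C0 weight_pos[of x]
        by (simp flip: ennreal_mult ennreal_plus)
    qed
    also have "\<dots> = (\<integral>\<^sup>+x. ennreal (C * weight (x :: real^'n)) \<partial>lborel) + ennreal C * (\<integral>\<^sup>+x. ennreal (cmod (h (x - z)) powr p) \<partial>lborel)"
      by (simp add: nn_integral_add nn_integral_cmult)
    also have "(\<integral>\<^sup>+x. ennreal (cmod (h (x - z)) powr p) \<partial>lborel) = (\<integral>\<^sup>+x. ennreal (cmod (h x) powr p) \<partial>lborel)"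
      using nn_integral_lborel_shift[of "\<lambda>x. ennreal (cmod (h x) powr p)" "- z"] by simp
    finally show ?thesis unfolding B_def .
  qed
  have "(\<integral>\<^sup>+\<omega>. \<integral>\<^sup>+x. ennreal (cmod (h (x - Z \<omega>) * \<psi> x)) \<partial>lborel \<partial>P) \<le> (\<integral>\<^sup>+\<omega>. B \<partial>P)"
    by (intro nn_integral_mono le)
  also have "\<dots> = B" by (simp add: emeasure_space_1)
  finally have fin: "(\<integral>\<^sup>+\<omega>. \<integral>\<^sup>+x. ennreal (cmod (h (x - Z \<omega>) * \<psi> x)) \<partial>lborel \<partial>P) < \<infinity>"
    using \<open>B < \<infinity>\<close> by (rule le_less_trans)
  then show "integrable (P \<Otimes>\<^sub>M lborel) (\<lambda>(\<omega>, x). h (x - Z \<omega>) * \<psi> x)"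
    by (intro integrable_pair_if_nn_integral_finite) (auto intro: lborel.sigma_finite_measure_axioms)
  have "(\<integral>\<^sup>+x. ennreal (cmod (h x * \<psi> (x + z))) \<partial>lborel) = (\<integral>\<^sup>+x. ennreal (cmod (h (x - z) * \<psi> x)) \<partial>lborel)" for z
    using nn_integral_lborel_shift[of "\<lambda>x. ennreal (cmod (h (x - z) * \<psi> x))" z] by simp
  with fin show "integrable (P \<Otimes>\<^sub>M lborel) (\<lambda>(\<omega>, x). h x * \<psi> (x + Z \<omega>))"
    by (intro integrable_pair_if_nn_integral_finite) (auto intro: lborel.sigma_finite_measure_axioms)
qed

text \<open>With \<open>weight\<close> as the test function, joint integrability yields
  integrability in \<omega> at almost every x, and the positive factor \<open>weight x\<close> is
  divided out.\<close>

lemma avg_AE_integrable: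
  assumes p: "1 \<le> p" and h: "h \<in> carr (Lp p)"
  shows "AE x in lborel. integrable P (\<lambda>\<omega>. h (x - Z \<omega>))"
proof -
  have [measurable]: "h \<in> borel_measurable borel" using h by (rule Lp_measurable)
  have "integrable (P \<Otimes>\<^sub>M lborel) (\<lambda>(\<omega>, x). h (x - Z \<omega>) * complex_of_real (weight x))"
    by (rule avg_integrable_prod(1)[OF p h, where C = 1]) (auto simp: less_imp_le[OF weight_pos])
  from AE_integrable_snd[OF this] show ?thesis
  proof eventually_elim
    case (elim x)
    have "(\<lambda>\<omega>. h (x - Z \<omega>)) = (\<lambda>\<omega>. inverse (complex_of_real (weight x)) * (h (x - Z \<omega>) * complex_of_real (weight x)))"
      using weight_pos[of x] by auto
    then show ?case using integrable_mult_right[OF elim, of "inverse (complex_of_real (weight x))"] by (simp only: split_conv)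
  qed
qed

text \<open>A translation by \<open>Z \<omega>\<close> moves from \<open>h\<close> to
  \<open>fourier \<psi>\<close>, where it is a character in front of \<psi>; the mean of these
  characters over \<open>P\<close> is \<open>m\<close>. One interchange of integrals happens on the
  side of x and one on the side of \<xi>.\<close>

lemma avg_fourier:
  fixes m :: "real^'n \<Rightarrow> complex"
  assumes p: "1 \<le> p" and h: "h \<in> carr (Lp p)" and \<psi>: "\<psi> \<in> schwartz"
    and m: "\<And>\<xi>. (\<integral>\<omega>. exp (- \<i> * complex_of_real (\<xi> \<bullet> Z \<omega>)) \<partial>P) = m \<xi>"
  shows "(\<integral>x. avg P Z h x * fourier \<psi> x \<partial>lborel) = (\<integral>x. h x * fourier (\<lambda>\<xi>. m \<xi> * \<psi> \<xi>) x \<partial>lborel)"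
proof -
  have [measurable]: "h \<in> borel_measurable borel" "\<psi> \<in> borel_measurable borel"
    using h \<psi> by (auto intro: Lp_measurable schwartz_measurable)
  obtain C where C: "\<And>x. cmod (fourier \<psi> x) \<le> C * weight x" using fourier_le_weight[OF \<psi>] by blast
  note int = avg_integrable_prod[OF p h fourier_measurable[of \<psi>] C]
  have *: "(\<integral>\<omega>. fourier \<psi> (x + Z \<omega>) \<partial>P) = fourier (\<lambda>\<xi>. m \<xi> * \<psi> \<xi>) x" for x
  proof -
    let ?f = "\<lambda>\<omega> \<xi>. exp (- \<i> * complex_of_real ((x + Z \<omega>) \<bullet> \<xi>)) * \<psi> \<xi>"
    have "integrable (P \<Otimes>\<^sub>M lborel) (case_prod ?f)"
    proof (rule integrable_pair_if_nn_integral_finite)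
      show "(\<integral>\<^sup>+\<omega>. \<integral>\<^sup>+\<xi>. ennreal (cmod (?f \<omega> \<xi>)) \<partial>lborel \<partial>P) < \<infinity>"
        using schwartz_integrable[OF \<psi>] by (simp add: norm_mult emeasure_space_1 integrable_iff_bounded)
    qed (auto intro: lborel.sigma_finite_measure_axioms)
    from Fubini_integral[OF this]
    have "(\<integral>\<omega>. \<integral>\<xi>. ?f \<omega> \<xi> \<partial>lborel \<partial>P) = (\<integral>\<xi>. \<integral>\<omega>. ?f \<omega> \<xi> \<partial>P \<partial>lborel)" by simp
    also have "\<dots> = (\<integral>\<xi>. exp (- \<i> * complex_of_real (x \<bullet> \<xi>)) * (m \<xi> * \<psi> \<xi>) \<partial>lborel)"
    proof (rule Bochner_Integration.integral_cong)
      fix \<xi>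
      have "?f \<omega> \<xi> = exp (- \<i> * complex_of_real (x \<bullet> \<xi>)) * \<psi> \<xi> * exp (- \<i> * complex_of_real (\<xi> \<bullet> Z \<omega>))" for \<omega>
        by (simp add: inner_add_left algebra_simps inner_commute[of \<xi>] exp_add exp_diff exp_minus divide_inverse)
      then have "(\<integral>\<omega>. ?f \<omega> \<xi> \<partial>P) = exp (- \<i> * complex_of_real (x \<bullet> \<xi>)) * \<psi> \<xi> * m \<xi>"
        by (simp only: integral_mult_right_zero m)
      then show "(\<integral>\<omega>. ?f \<omega> \<xi> \<partial>P) = exp (- \<i> * complex_of_real (x \<bullet> \<xi>)) * (m \<xi> * \<psi> \<xi>)"
        by (simp only: mult_ac)
    qed simp
    finally show ?thesis unfolding fourier_def by simp
  qed
  have "(\<integral>x. avg P Z h x * fourier \<psi> x \<partial>lborel) = (\<integral>x. \<integral>\<omega>. h (x - Z \<omega>) * fourier \<psi> x \<partial>P \<partial>lborel)"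
    unfolding avg_def by simp
  also have "\<dots> = (\<integral>\<omega>. \<integral>x. h (x - Z \<omega>) * fourier \<psi> x \<partial>lborel \<partial>P)"
    by (rule Fubini_integral) (use int(1) in simp)
  also have "\<dots> = (\<integral>\<omega>. \<integral>x. h x * fourier \<psi> (x + Z \<omega>) \<partial>lborel \<partial>P)"
  proof -
    have "(\<integral>x. h (x - z) * fourier \<psi> x \<partial>lborel) = (\<integral>x. h x * fourier \<psi> (x + z) \<partial>lborel)" for z
      using integral_lborel_shift[of "\<lambda>x. h (x - z) * fourier \<psi> x" z] by simp
    then show ?thesis by simp
  qed
  also have "\<dots> = (\<integral>x. \<integral>\<omega>. h x * fourier \<psi> (x + Z \<omega>) \<partial>P \<partial>lborel)"
    by (rule Fubini_integral[symmetric]) (use int(2) in simp)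
  also have "\<dots> = (\<integral>x. h x * fourier (\<lambda>\<xi>. m \<xi> * \<psi> \<xi>) x \<partial>lborel)"
    by (simp add: *)
  finally show ?thesis .
qed

end

section \<open>Injectivity of the Fourier transform on Lebesgue functions\<close>

lemma integral_gaussian_shift:
  fixes d :: "real^'n \<Rightarrow> complex"
  assumes [measurable]: "d \<in> borel_measurable borel" and c: "c > 0"
  shows "(\<integral>\<zeta>. d (y - c *\<^sub>R \<zeta>) \<partial>gaussian) =
    (\<integral>z. d z * complex_of_real ((1 / c) ^ CARD('n) * gauss_density ((1 / c) *\<^sub>R (y - z))) \<partial>lborel)"
proof -
  let ?f = "\<lambda>z. d z * complex_of_real (gauss_density ((1 / c) *\<^sub>R (y - z)))"
  have "(\<integral>\<zeta>. d (y - c *\<^sub>R \<zeta>) \<partial>gaussian) = (\<integral>\<zeta>. ?f (y - c *\<^sub>R \<zeta>) \<partial>lborel)"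
    unfolding gaussian_def using c by (subst integral_density) (auto simp: scaleR_conv_of_real[where 'a = complex] mult.commute)
  also have "\<dots> = ((1 / c) ^ CARD('n)) *\<^sub>R (\<integral>z. ?f z \<partial>lborel)"
    using integral_lborel_scale[of ?f c y] c by simp
  also have "\<dots> = (\<integral>z. ((1 / c) ^ CARD('n)) *\<^sub>R ?f z \<partial>lborel)"
    by (rule integral_scaleR_right[symmetric])
  finally show ?thesis by (simp add: scaleR_conv_of_real[where 'a = complex] mult_ac)
qed

lemma AE_not_frontier_box: "AE x in lborel. x \<notin> cbox a b - box a (b :: 'a::euclidean_space)"
proof -
  have "cbox a b - box a b \<in> null_sets lborel"
    using negligible_frontier_interval[of a b]
    by (simp add: negligible_iff_null_sets null_sets_completion_iff)
  then show ?thesis by (rule AE_not_in)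
qed

text \<open>Fourier transforms of Schwartz functions include all translated Gaussians. Hence the mean of
  \<open>I z = (\<integral>y\<in>B. d (y - z))\<close> over every centred Gaussian vanishes for each box \<open>B\<close>, and so does \<open>I 0\<close> in the
  limit of small variance.\<close>

lemma fourier_injective:
  fixes d :: "real^'n \<Rightarrow> complex"
  assumes p: "1 \<le> p" and d: "d \<in> carr (Lp p)"
    and zero: "\<And>\<phi>. \<phi> \<in> schwartz \<Longrightarrow> (\<integral>x. d x * fourier \<phi> x \<partial>lborel) = 0"
  shows "AE x in lborel. d x = 0"
proof -
  have [measurable]: "d \<in> borel_measurable borel" using d by (rule Lp_measurable)
  interpret G: prob_space "gaussian :: (real^'n) measure" by (rule prob_space_gaussian)
  interpret pair_sigma_finite "gaussian :: (real^'n) measure" "lborel :: (real^'n) measure" ..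
  have g0: "(\<integral>\<zeta>. d (y - c *\<^sub>R \<zeta>) \<partial>gaussian) = 0" if c: "c > 0" for c y
  proof -
    let ?\<phi> = "\<lambda>\<xi>. exp (\<i> * complex_of_real (\<xi> \<bullet> y)) * complex_of_real (exp (- (c\<^sup>2 / 2 * (norm \<xi>)\<^sup>2)))"
    let ?K = "complex_of_real (1 / (2 * pi) powr (real CARD('n) / 2))"
    have "?\<phi> \<in> schwartz"
      by (rule schwartz_mult[OF slow.character schwartz_gauss]) (use c in simp)
    then have "0 = (\<integral>z. d z * fourier ?\<phi> z \<partial>lborel) * ?K" by (simp only: zero mult_zero_left)
    also have "\<dots> = (\<integral>z. d z * fourier ?\<phi> z * ?K \<partial>lborel)" by simp
    also have "\<dots> = (\<integral>z. d z * complex_of_real ((1 / c) ^ CARD('n) * gauss_density ((1 / c) *\<^sub>R (y - z))) \<partial>lborel)"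
      unfolding fourier_gauss[OF c] by (simp add: mult_ac)
    finally show ?thesis using integral_gaussian_shift[OF _ c, of d y] by simp
  qed
  have box: "integrable lborel (\<lambda>x. indicator (box a b) x * d x)" 
    "(\<integral>x. indicator (box a b) x * d x \<partial>lborel) = 0" for a b
  proof -
    let ?B = "indicator (box a b) :: real^'n \<Rightarrow> complex"
    define K where "K = measure lborel (box a b) + (\<integral>x. cmod (d x) powr p \<partial>lborel)"
    define I where "I = (\<lambda>z. \<integral>y. ?B y * d (y - z) \<partial>lborel)"
    have bnd: "cmod (?B y * d (y - z)) \<le> indicator (box a b) y + cmod (d (y - z)) powr p" for y z
      using le_one_plus_powr[of "cmod (d (y - z))" p] p by (auto split: split_indicator)
    have ish: "integrable lborel (\<lambda>y. cmod (d (y - z)) powr p)"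
      "(\<integral>y. cmod (d (y - z)) powr p \<partial>lborel) = (\<integral>x. cmod (d x) powr p \<partial>lborel)" for z
      using Lp_shift[OF d, of z] integral_lborel_shift[of "\<lambda>x. cmod (d x) powr p" "-z"] by (auto simp: Lp_iff)
    have intb: "integrable lborel (\<lambda>y. indicator (box a b) y + cmod (d (y - z)) powr p)"
      "(\<integral>y. indicator (box a b) y + cmod (d (y - z)) powr p \<partial>lborel) = K" for z
    proof -
      have "integrable lborel (indicator (box a b) :: real^'n \<Rightarrow> real)"
        using emeasure_lborel_box_finite[of a b] by (simp add: integrable_indicator_iff)
      then show "integrable lborel (\<lambda>y. indicator (box a b) y + cmod (d (y - z)) powr p)"
        "(\<integral>y. indicator (box a b) y + cmod (d (y - z)) powr p \<partial>lborel) = K"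
        using ish[of z] by (simp_all add: K_def)
    qed
    have intI: "integrable lborel (\<lambda>y. ?B y * d (y - z))" for z
      by (rule Bochner_Integration.integrable_bound[OF intb(1)])
        (auto intro!: order_trans[OF bnd] abs_ge_self)
    from intI[of 0] show "integrable lborel (\<lambda>x. ?B x * d x)" by simp
    have nK: "(\<integral>\<^sup>+y. ennreal (cmod (?B y * d (y - z))) \<partial>lborel) \<le> ennreal K" for z
    proof -
      have "(\<integral>\<^sup>+y. ennreal (cmod (?B y * d (y - z))) \<partial>lborel) \<le> (\<integral>\<^sup>+y. ennreal (indicator (box a b) y + cmod (d (y - z)) powr p) \<partial>lborel)"
        by (rule nn_integral_mono, rule ennreal_leI, rule bnd)
      also have "\<dots> = ennreal K"
        by (subst nn_integral_eq_integral[OF intb(1)]) (auto simp: intb(2))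
      finally show ?thesis .
    qed
    have IK: "cmod (I z) \<le> K" for z
      unfolding I_def intb(2)[of z, symmetric] by (rule Bochner_Integration.integral_norm_bound_integral[OF intI intb(1) bnd])
    have I0: "(\<integral>\<zeta>. I (c *\<^sub>R \<zeta>) \<partial>gaussian) = 0" if c: "c > 0" for c
    proof -
      have "integrable (gaussian \<Otimes>\<^sub>M lborel) (\<lambda>(\<zeta>, y). ?B y * d (y - c *\<^sub>R \<zeta>))"
      proof (rule integrable_pair_if_nn_integral_finite)
        have "(\<integral>\<^sup>+\<zeta>. \<integral>\<^sup>+y. ennreal (cmod (?B y * d (y - c *\<^sub>R \<zeta>))) \<partial>lborel \<partial>gaussian) \<le> (\<integral>\<^sup>+\<zeta>. ennreal K \<partial>(gaussian :: (real^'n) measure))"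
          by (intro nn_integral_mono nK)
        also have "\<dots> < \<infinity>" using G.emeasure_space_1 by simp
        finally show "(\<integral>\<^sup>+\<zeta>. \<integral>\<^sup>+y. ennreal (cmod (?B y * d (y - c *\<^sub>R \<zeta>))) \<partial>lborel \<partial>gaussian) < \<infinity>" .
      qed (auto intro: lborel.sigma_finite_measure_axioms)
      from Fubini_integral[OF this]
      have "(\<integral>\<zeta>. I (c *\<^sub>R \<zeta>) \<partial>gaussian) = (\<integral>y. \<integral>\<zeta>. ?B y * d (y - c *\<^sub>R \<zeta>) \<partial>gaussian \<partial>lborel)"
        unfolding I_def by simp
      also have "\<dots> = 0" by (simp add: g0[OF c])
      finally show ?thesis .
    qed
    \<comment> \<open>With the translation on the indicator, \<open>d\<close> stays fixed and
      continuity of \<open>I\<close> at 0 along rays is dominated convergence: the translated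
      indicators converge off the frontier of the box, a null set.\<close>
    have I_shift: "I z = (\<integral>y. ?B (y + z) * d y \<partial>lborel)" for z
      unfolding I_def using integral_lborel_shift[of "\<lambda>y. ?B y * d (y - z)" z] by simp
    define s where "s = (\<lambda>n. 1 / real (Suc n))"
    have s: "0 < s n" "s n \<le> 1" for n by (auto simp: s_def)
    have s0: "s \<longlonglongrightarrow> 0" unfolding s_def using LIMSEQ_inverse_real_of_nat by (simp add: inverse_eq_divide)
    have cont: "(\<lambda>n. I (s n *\<^sub>R \<zeta>)) \<longlonglongrightarrow> I 0" for \<zeta>
    proof -
      obtain R where R: "\<And>y. y \<in> box a b \<Longrightarrow> norm y \<le> R"
        using bounded_box[of a b] unfolding bounded_iff by blast
      let ?R = "ball 0 (R + norm \<zeta> + 1) :: (real^'n) set"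
      show ?thesis unfolding I_shift
      proof (rule integral_dominated_convergence[where w = "\<lambda>y. indicator ?R y + cmod (d y) powr p"])
        show "integrable lborel (\<lambda>y. indicator ?R y + cmod (d y) powr p)"
        proof (rule Bochner_Integration.integrable_add)
          have "emeasure lborel ?R < \<infinity>" by (rule emeasure_lborel_ball_finite)
          then show "integrable lborel (indicator ?R :: real^'n \<Rightarrow> real)"
            by (simp add: integrable_indicator_iff)
        qed (use d in \<open>simp add: Lp_iff\<close>)
        show "AE y in lborel. norm (?B (y + s n *\<^sub>R \<zeta>) * d y) \<le> indicator ?R y + cmod (d y) powr p" for n
        proof (rule AE_I2)
          fix y
          have "y \<in> ?R" if "y + s n *\<^sub>R \<zeta> \<in> box a b"
          proof -
            have "norm y \<le> norm (y + s n *\<^sub>R \<zeta>) + norm (s n *\<^sub>R \<zeta>)"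
              using norm_triangle_ineq4[of "y + s n *\<^sub>R \<zeta>" "s n *\<^sub>R \<zeta>"] by simp
            moreover have "norm (s n *\<^sub>R \<zeta>) \<le> norm \<zeta>" using s[of n] by (simp add: mult_left_le_one_le)
            ultimately show ?thesis using R[OF that] by simp
          qed
          then show "norm (?B (y + s n *\<^sub>R \<zeta>) * d y) \<le> indicator ?R y + cmod (d y) powr p"
            using le_one_plus_powr[of "cmod (d y)" p] p by (auto split: split_indicator)
        qed
        show "AE y in lborel. (\<lambda>n. ?B (y + s n *\<^sub>R \<zeta>) * d y) \<longlonglongrightarrow> ?B (y + 0) * d y"
          using AE_not_frontier_box[of a b]
        proof eventually_elim
          case (elim y)
          have lim: "(\<lambda>n. y + s n *\<^sub>R \<zeta>) \<longlonglongrightarrow> y"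
            using tendsto_add[OF tendsto_const tendsto_scaleR[OF s0 tendsto_const[of \<zeta>]], of y] by simp
          have "eventually (\<lambda>n. ?B (y + s n *\<^sub>R \<zeta>) = ?B y) sequentially"
          proof (cases "y \<in> box a b")
            case True
            then have "eventually (\<lambda>n. y + s n *\<^sub>R \<zeta> \<in> box a b) sequentially"
              using topological_tendstoD[OF lim open_box] by blast
            then show ?thesis by eventually_elim (use True in simp)
          next
            case False
            then have "y \<in> - cbox a b" using elim by auto
            then have "eventually (\<lambda>n. y + s n *\<^sub>R \<zeta> \<in> - cbox a b) sequentially"
              using topological_tendstoD[OF lim, of "- cbox a b"] by (auto simp: closed_cbox open_Compl)
            then show ?thesis by eventually_elim (use False box_subset_cbox[of a b] in \<open>auto simp: indicator_def\<close>)
          qed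
          then have "(\<lambda>n. ?B (y + s n *\<^sub>R \<zeta>)) \<longlonglongrightarrow> ?B y" by (rule tendsto_eventually)
          then show ?case by (intro tendsto_mult) auto
        qed
      qed auto
    qed
    have "I \<in> borel_measurable borel" unfolding I_def by measurable
    then have "(\<lambda>n. \<integral>\<zeta>. I (s n *\<^sub>R \<zeta>) \<partial>gaussian) \<longlonglongrightarrow> (\<integral>\<zeta>. I 0 \<partial>(gaussian :: (real^'n) measure))"
      by (intro integral_dominated_convergence[where w = "\<lambda>_. K"]) (auto simp: cont IK)
    then have "I 0 = 0" using I0[OF s(1)] G.prob_space by (simp add: LIMSEQ_const_iff)
    then show "(\<integral>x. ?B x * d x \<partial>lborel) = 0" unfolding I_def by simp
  qed
  have re: "indicator (box a b) x * Re (d x) = Re (indicator (box a b) x * d x)"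
    and im: "indicator (box a b) x * Im (d x) = Im (indicator (box a b) x * d x)" for a b x
    by (auto split: split_indicator)
  have "AE x in lborel. Re (d x) = 0"
  proof (rule AE_zero_if_box_integrals_zero)
    show "integrable lborel (\<lambda>x. indicator (box a b) x * Re (d x))" for a b
      unfolding re by (rule integrable_Re[OF box(1)])
    show "(\<integral>x. indicator (box a b) x * Re (d x) \<partial>lborel) = 0" for a b
      unfolding re by (subst integral_Re[OF box(1)]) (simp add: box(2))
  qed simp
  moreover have "AE x in lborel. Im (d x) = 0"
  proof (rule AE_zero_if_box_integrals_zero)
    show "integrable lborel (\<lambda>x. indicator (box a b) x * Im (d x))" for a b
      unfolding im by (rule integrable_Im[OF box(1)])
    show "(\<integral>x. indicator (box a b) x * Im (d x) \<partial>lborel) = 0" for a b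
      unfolding im by (subst integral_Im[OF box(1)]) (simp add: box(2))
  qed simp
  ultimately show ?thesis by eventually_elim (simp add: complex_eq_iff)
qed

section \<open>Bessel potentials\<close>

definition gamma_density :: "real \<Rightarrow> real \<Rightarrow> real" where
  "gamma_density a s = indicator {0..} s * s powr (a - 1) / exp s / Gamma a"

definition gamma_measure :: "real \<Rightarrow> real measure" where
  "gamma_measure a = density lborel (\<lambda>s. ennreal (gamma_density a s))"

lemma gamma_density_nonneg: "0 < a \<Longrightarrow> 0 \<le> gamma_density a s"
  by (simp add: gamma_density_def Gamma_real_pos less_imp_le)

lemma gamma_density_measurable [measurable]: "gamma_density a \<in> borel_measurable borel"
  unfolding gamma_density_def[abs_def] by measurable

lemma sets_gamma_measure [measurable_cong, simp]: "sets (gamma_measure a) = sets borel"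
  and space_gamma_measure [simp]: "space (gamma_measure a) = UNIV"
  by (auto simp: gamma_measure_def)

lemma nn_integral_gamma_measure:
  assumes "f \<in> borel_measurable borel"
  shows "(\<integral>\<^sup>+s. f s \<partial>gamma_measure a) = (\<integral>\<^sup>+s. ennreal (gamma_density a s) * f s \<partial>lborel)"
  unfolding gamma_measure_def using assms by (subst nn_integral_density) auto

text \<open>The substitution \<open>t = (1 + c) * s\<close> leads back to the Gamma integral. The
  case c = 0 gives total mass 1, and \<open>c = (norm \<xi>)\<^sup>2\<close> gives the Bessel
  symbol.\<close>

lemma nn_integral_gamma_laplace:
  assumes a: "0 < a" and c: "0 \<le> c"
  shows "(\<integral>\<^sup>+s. ennreal (exp (- (s * c))) \<partial>gamma_measure a) = ennreal ((1 + c) powr (- a))"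
proof -
  let ?k = "1 / (1 + c)"
  have k: "0 < ?k" using c by simp
  have G: "0 < Gamma a" by (rule Gamma_real_pos[OF a])
  have "(\<integral>\<^sup>+s. ennreal (exp (- (s * c))) \<partial>gamma_measure a) = (\<integral>\<^sup>+s. ennreal (gamma_density a s * exp (- (s * c))) \<partial>lborel)"
    using gamma_density_nonneg[OF a] by (simp add: nn_integral_gamma_measure ennreal_mult')
  also have "\<dots> = ennreal ?k * (\<integral>\<^sup>+t. ennreal (gamma_density a (0 + ?k * t) * exp (- ((0 + ?k * t) * c))) \<partial>lborel)"
    using k by (subst nn_integral_real_affine[where c = ?k and t = 0]) auto
  also have "(\<lambda>t. gamma_density a (0 + ?k * t) * exp (- ((0 + ?k * t) * c))) = 
      (\<lambda>t. (?k powr (a - 1) / Gamma a) * (indicator {0..} t * t powr (a - 1) / exp t))"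
  proof
    fix t :: real
    have "?k * t + ?k * t * c = ?k * (1 + c) * t" by (simp only: distrib_left distrib_right mult_1_right mult.commute mult.left_commute mult.assoc)
    also have "\<dots> = t" using c by simp
    finally have e: "?k * t + ?k * t * c = t" .
    have "indicator {0..} (?k * t) = (indicator {0..} t :: real)"
      using k c by (auto simp: indicator_def zero_le_divide_iff)
    moreover have "indicator {0..} t * (?k * t) powr (a - 1) = indicator {0..} t * (?k powr (a - 1) * t powr (a - 1))"
      using k by (auto simp: indicator_def powr_mult powr_divide)
    moreover have "exp (- (?k * t * c)) / exp (?k * t) = 1 / exp t"
      by (subst e[symmetric], subst exp_add) (simp add: exp_minus field_simps)
    ultimately show "gamma_density a (0 + ?k * t) * exp (- ((0 + ?k * t) * c)) =
       (?k powr (a - 1) / Gamma a) * (indicator {0..} t * t powr (a - 1) / exp t)"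
      unfolding gamma_density_def by (simp add: field_simps)
  qed
  also have "(\<integral>\<^sup>+t. ennreal ((?k powr (a - 1) / Gamma a) * (indicator {0..} t * t powr (a - 1) / exp t)) \<partial>lborel)
      = ennreal (?k powr (a - 1) / Gamma a) * ennreal (Gamma a)"
    unfolding Gamma_conv_nn_integral_real[OF a] using G
    by (subst nn_integral_cmult[symmetric]) (auto simp: ennreal_mult[symmetric])
  also have "ennreal ?k * (ennreal (?k powr (a - 1) / Gamma a) * ennreal (Gamma a)) = ennreal (?k * ?k powr (a - 1))"
    using G k by (simp flip: ennreal_mult)
  also have "?k * ?k powr (a - 1) = ?k powr a" using k by (simp add: powr_diff)
  also have "\<dots> = (1 + c) powr (- a)" using c by (simp add: powr_minus_divide powr_divide)
  finally show ?thesis .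
qed

lemma prob_space_gamma_measure: "0 < a \<Longrightarrow> prob_space (gamma_measure a)"
  using nn_integral_gamma_laplace[of a 0] by (intro prob_spaceI) simp

lemma integral_gamma_laplace:
  assumes "0 < a" "0 \<le> c"
  shows "(\<integral>s. exp (- (s * c)) \<partial>gamma_measure a) = (1 + c) powr (- a)"
  by (subst integral_eq_nn_integral) (auto simp: nn_integral_gamma_laplace[OF assms])

lemma AE_gamma_measure_pos: "AE s in gamma_measure a. 0 < s"
proof -
  have "AE s in lborel. s \<noteq> (0::real)" by (rule AE_lborel_singleton)
  then show ?thesis unfolding gamma_measure_def
    by (subst AE_density) (auto simp: gamma_density_def indicator_def elim: eventually_mono)
qed

definition bessel_measure :: "real \<Rightarrow> (real \<times> (real^'n)) measure" where
  "bessel_measure \<alpha> = gamma_measure (\<alpha> / 2) \<Otimes>\<^sub>M gaussian"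

definition bessel_var :: "real \<times> (real^'n) \<Rightarrow> real^'n" where
  "bessel_var = (\<lambda>(s, \<zeta>). sqrt (2 * s) *\<^sub>R \<zeta>)"

text \<open>\<open>bessel_op \<alpha>\<close> is convolution with the Bessel kernel, the law of \<open>bessel_var\<close>: given \<open>s\<close>,
  \<open>sqrt (2 * s) *\<^sub>R \<zeta>\<close> has the heat kernel at time \<open>s\<close> as its density.\<close>

definition bessel_op :: "real \<Rightarrow> (real^'n \<Rightarrow> complex) \<Rightarrow> real^'n \<Rightarrow> complex" where
  "bessel_op \<alpha> = avg (bessel_measure \<alpha>) bessel_var"

text \<open>The parameter is the standard deviation \<open>c\<close>, so this is the heat semigroup at time \<open>c\<^sup>2 / 2\<close>.\<close>

definition heat :: "real \<Rightarrow> (real^'n \<Rightarrow> complex) \<Rightarrow> real^'n \<Rightarrow> complex" where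
  "heat c = avg gaussian (\<lambda>\<zeta>. c *\<^sub>R \<zeta>)"

lemma sets_bessel_measure [measurable_cong, simp]: "sets (bessel_measure \<alpha> :: (real \<times> (real^'n)) measure) = sets (borel \<Otimes>\<^sub>M borel)"
  unfolding bessel_measure_def by (intro sets_pair_measure_cong) auto

lemma bessel_var_measurable [measurable]: "bessel_var \<in> borel_measurable (bessel_measure \<alpha>)"
  unfolding bessel_var_def by (subst measurable_cong_sets[OF sets_bessel_measure refl]) measurable

lemma prob_space_bessel_measure: "0 < \<alpha> \<Longrightarrow> prob_space (bessel_measure \<alpha>)"
  unfolding bessel_measure_def
  by (intro prob_space_pair prob_space_gaussian prob_space_gamma_measure) simp

lemma scale_measurable: "(\<lambda>\<zeta>. c *\<^sub>R \<zeta>) \<in> borel_measurable gaussian"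
  by measurable

text \<open>Given s, the vector is Gaussian with variance 2 s in each coordinate, so its
  characteristic function is \<open>exp (- (s * (norm \<xi>)\<^sup>2))\<close>. The Laplace
  transform of the gamma law finishes; the shape \<alpha> / 2 is dictated by the exponent of the
  symbol.\<close>

lemma bessel_char:
  fixes \<xi> :: "real^'n"
  assumes \<alpha>: "0 < \<alpha>"
  shows "(\<integral>\<omega>. exp (- \<i> * complex_of_real (\<xi> \<bullet> bessel_var \<omega>)) \<partial>bessel_measure \<alpha>) = bessel_symbol (- \<alpha>) \<xi>"
proof -
  interpret A: prob_space "gamma_measure (\<alpha> / 2)" using \<alpha> by (intro prob_space_gamma_measure) simp
  interpret B: prob_space "gaussian :: (real^'n) measure" by (rule prob_space_gaussian)
  interpret pair_prob_space "gamma_measure (\<alpha> / 2)" "gaussian :: (real^'n) measure" ..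
  let ?f = "\<lambda>\<omega>. exp (- \<i> * complex_of_real (\<xi> \<bullet> bessel_var \<omega>))"
  have m: "?f \<in> borel_measurable (bessel_measure \<alpha>)" by measurable
  have "integrable (gamma_measure (\<alpha> / 2) \<Otimes>\<^sub>M gaussian) ?f"
    using m unfolding bessel_measure_def by (intro integrable_const_bound[of _ 1]) auto
  from integral_fst'[OF this]
  have "(\<integral>\<omega>. ?f \<omega> \<partial>bessel_measure \<alpha>) = (\<integral>s. \<integral>\<zeta>. ?f (s, \<zeta>) \<partial>gaussian \<partial>gamma_measure (\<alpha> / 2))"
    unfolding bessel_measure_def by simp
  also have "\<dots> = (\<integral>s. complex_of_real (exp (- (s * (norm \<xi>)\<^sup>2))) \<partial>gamma_measure (\<alpha> / 2))"
  proof (rule integral_cong_AE)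
    show "AE s in gamma_measure (\<alpha> / 2). (\<integral>\<zeta>. ?f (s, \<zeta>) \<partial>gaussian) = complex_of_real (exp (- (s * (norm \<xi>)\<^sup>2)))"
      using AE_gamma_measure_pos
    proof eventually_elim
      case (elim s)
      have "(\<integral>\<zeta>. ?f (s, \<zeta>) \<partial>gaussian) = (\<integral>\<zeta>. exp (\<i> * complex_of_real ((- (sqrt (2 * s) *\<^sub>R \<xi>)) \<bullet> \<zeta>)) \<partial>gaussian)"
        by (simp add: bessel_var_def)
      also have "\<dots> = exp (- (norm (- (sqrt (2 * s) *\<^sub>R \<xi>)))\<^sup>2 / 2)" by (rule gaussian_char)
      also have "- (norm (- (sqrt (2 * s) *\<^sub>R \<xi>)))\<^sup>2 / 2 = - (s * (norm \<xi>)\<^sup>2)" using elim by (simp add: power_mult_distrib)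
      finally show ?case .
    qed
    show "(\<lambda>s. \<integral>\<zeta>. ?f (s, \<zeta>) \<partial>gaussian) \<in> borel_measurable (gamma_measure (\<alpha> / 2))"
      using m unfolding bessel_measure_def by (intro B.borel_measurable_lebesgue_integral) (simp add: split_beta')
  qed measurable
  also have "\<dots> = complex_of_real ((1 + (norm \<xi>)\<^sup>2) powr (- (\<alpha> / 2)))"
    using \<alpha> by (simp add: integral_gamma_laplace)
  finally show ?thesis unfolding bessel_symbol_def by simp
qed

lemma bessel_op_measurable:
  fixes h :: "real^'n \<Rightarrow> complex"
  assumes "0 < \<alpha>" "h \<in> borel_measurable borel"
  shows "bessel_op \<alpha> h \<in> borel_measurable borel"
  unfolding bessel_op_def by (rule avg_measurable[OF prob_space_bessel_measure[OF assms(1)] bessel_var_measurable assms(2)])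

lemma bessel_op_Lp:
  fixes h :: "real^'n \<Rightarrow> complex"
  assumes "0 < \<alpha>" "1 \<le> p" "h \<in> carr (Lp p)"
  shows "bessel_op \<alpha> h \<in> carr (Lp p)"
  unfolding bessel_op_def by (rule avg_Lp[OF prob_space_bessel_measure[OF assms(1)] bessel_var_measurable assms(2,3)])

lemma bessel_op_fourier:
  fixes h :: "real^'n \<Rightarrow> complex"
  assumes "0 < \<alpha>" "1 \<le> p" "h \<in> carr (Lp p)" "\<psi> \<in> schwartz"
  shows "(\<integral>x. bessel_op \<alpha> h x * fourier \<psi> x \<partial>lborel) = (\<integral>x. h x * fourier (\<lambda>\<xi>. bessel_symbol (- \<alpha>) \<xi> * \<psi> \<xi>) x \<partial>lborel)"
  unfolding bessel_op_def
  by (rule avg_fourier[OF prob_space_bessel_measure[OF assms(1)] bessel_var_measurable assms(2,3,4) bessel_char[OF assms(1)]])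

text \<open>Fubini on the product measure. It is restricted to almost every x because only there is
  the integrand known to be integrable.\<close>

lemma bessel_op_eq_heat:
  fixes h :: "real^'n \<Rightarrow> complex"
  assumes \<alpha>: "0 < \<alpha>" and "1 \<le> p" "h \<in> carr (Lp p)"
  shows "AE x in lborel. bessel_op \<alpha> h x = (\<integral>s. heat (sqrt (2 * s)) h x \<partial>gamma_measure (\<alpha> / 2))"
  using avg_AE_integrable[OF prob_space_bessel_measure[OF \<alpha>] bessel_var_measurable assms(2,3)]
proof eventually_elim
  case (elim x)
  interpret A: prob_space "gamma_measure (\<alpha> / 2)" using \<alpha> by (intro prob_space_gamma_measure) simp
  interpret B: prob_space "gaussian :: (real^'n) measure" by (rule prob_space_gaussian)
  interpret pair_prob_space "gamma_measure (\<alpha> / 2)" "gaussian :: (real^'n) measure" ..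
  from integral_fst'[OF elim[unfolded bessel_measure_def]]
  show ?case by (simp add: bessel_op_def heat_def avg_def bessel_var_def bessel_measure_def)
qed

section \<open>Decay of the heat semigroup between Lebesgue spaces\<close>

lemma heat_measurable [measurable]:
  fixes h :: "real^'n \<Rightarrow> complex"
  assumes [measurable]: "h \<in> borel_measurable borel"
  shows "heat c h \<in> borel_measurable borel"
  unfolding heat_def by (rule avg_measurable[OF prob_space_gaussian scale_measurable assms])

lemma heat_pair_measurable [measurable]:
  fixes h :: "real^'n \<Rightarrow> complex"
  assumes [measurable]: "h \<in> borel_measurable borel"
  shows "(\<lambda>(s, x). heat (sqrt (2 * s)) h x) \<in> borel_measurable (borel \<Otimes>\<^sub>M borel)"
proof -
  interpret B: prob_space "gaussian :: (real^'n) measure" by (rule prob_space_gaussian)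
  show ?thesis unfolding heat_def avg_def by measurable
qed

lemma heat_powr_le:
  fixes h :: "real^'n \<Rightarrow> complex"
  assumes p: "1 \<le> p" and h: "h \<in> carr (Lp p)" and c: "0 < c"
  shows "cmod (heat c h x) powr p \<le> (2 * pi * c\<^sup>2) powr (- real CARD('n) / 2) * (\<integral>x. cmod (h x) powr p \<partial>lborel)"
proof -
  have [measurable]: "h \<in> borel_measurable borel" using h by (rule Lp_measurable)
  have "ennreal (cmod (heat c h x) powr p) \<le> (\<integral>\<^sup>+\<zeta>. ennreal (cmod (h (x - c *\<^sub>R \<zeta>)) powr p) \<partial>gaussian)"
    unfolding heat_def by (rule avg_powr_le[OF prob_space_gaussian scale_measurable _ p]) simp
  also have "\<dots> \<le> ennreal ((2 * pi * c\<^sup>2) powr (- real CARD('n) / 2)) * (\<integral>\<^sup>+z. ennreal (cmod (h z) powr p) \<partial>lborel)"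
    by (rule nn_integral_gaussian_scale_le[OF _ c, of "\<lambda>z. ennreal (cmod (h z) powr p)"]) measurable
  also have "\<dots> = ennreal ((2 * pi * c\<^sup>2) powr (- real CARD('n) / 2) * (\<integral>x. cmod (h x) powr p \<partial>lborel))"
    by (simp add: Lp_nn_integral[OF h] ennreal_mult')
  finally show ?thesis
    by (subst (asm) ennreal_le_iff) (auto intro!: mult_nonneg_nonneg integral_nonneg_AE)
qed

text \<open>Interpolation between the sup bound \<open>S\<close> and the contraction in exponent p,
  by \<open>t powr q \<le> S powr (q - p) * t powr p\<close>. It serves twice: with the explicit
  kernel bound it yields the rate in s, and with an arbitrarily small \<open>S\<close> it yields
  convergence to 0.\<close>

lemma heat_nn_integral_le:
  fixes h :: "real^'n \<Rightarrow> complex"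
  assumes p: "1 \<le> p" and q: "p \<le> q" and h: "h \<in> carr (Lp p)" and S: "\<And>x. cmod (heat c h x) \<le> S"
  shows "(\<integral>\<^sup>+x. ennreal (cmod (heat c h x) powr q) \<partial>lborel) \<le> ennreal (S powr (q - p) * (\<integral>x. cmod (h x) powr p \<partial>lborel))"
proof -
  have [measurable]: "h \<in> borel_measurable borel" using h by (rule Lp_measurable)
  have "(\<integral>\<^sup>+x. ennreal (cmod (heat c h x) powr q) \<partial>lborel) \<le> (\<integral>\<^sup>+x. ennreal (S powr (q - p)) * ennreal (cmod (heat c h x) powr p) \<partial>lborel)"
  proof (rule nn_integral_mono)
    fix x
    have "cmod (heat c h x) powr q = cmod (heat c h x) powr (q - p) * cmod (heat c h x) powr p"
      by (simp flip: powr_add)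
    also have "\<dots> \<le> S powr (q - p) * cmod (heat c h x) powr p"
      using S q by (intro mult_right_mono powr_mono2) auto
    finally show "ennreal (cmod (heat c h x) powr q) \<le> ennreal (S powr (q - p)) * ennreal (cmod (heat c h x) powr p)"
      by (simp flip: ennreal_mult add: ennreal_leI)
  qed
  also have "\<dots> = ennreal (S powr (q - p)) * (\<integral>\<^sup>+x. ennreal (cmod (heat c h x) powr p) \<partial>lborel)"
    by (rule nn_integral_cmult) measurable
  also have "\<dots> \<le> ennreal (S powr (q - p)) * (\<integral>\<^sup>+x. ennreal (cmod (h x) powr p) \<partial>lborel)"
    unfolding heat_def by (intro mult_left_mono avg_nn_integral_le[OF prob_space_gaussian scale_measurable _ p]) auto
  also have "\<dots> = ennreal (S powr (q - p) * (\<integral>x. cmod (h x) powr p \<partial>lborel))"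
    by (simp add: Lp_nn_integral[OF h] ennreal_mult')
  finally show ?thesis .
qed

text \<open>\<sigma> is the rate at which the heat semigroup smooths from p to q. The sup bound
  carries \<open>(4 * pi * s) powr (- N / 2)\<close> to the power \<open>(q - p) / p\<close>, and
  \<open>N / 2 * ((q - p) / p) = \<sigma> * q\<close>, so the weight removes s entirely.\<close>

lemma heat_nn_integral_decay:
  fixes h :: "real^'n \<Rightarrow> complex"
  assumes p: "1 \<le> p" and q: "p \<le> q" and h: "h \<in> carr (Lp p)" and s: "0 < s"
    and \<sigma>: "\<sigma> = real CARD('n) / 2 * (1 / p - 1 / q)"
  shows "ennreal (s powr (\<sigma> * q)) * (\<integral>\<^sup>+x. ennreal (cmod (heat (sqrt (2 * s)) h x) powr q) \<partial>lborel)
    \<le> ennreal ((4 * pi) powr (- (\<sigma> * q)) * (\<integral>x. cmod (h x) powr p \<partial>lborel) powr (q / p))"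
proof -
  define A where "A = (\<integral>x. cmod (h x) powr p \<partial>lborel)"
  have A: "0 \<le> A" unfolding A_def by (rule integral_nonneg_AE) simp
  define S where "S = ((4 * pi * s) powr (- real CARD('n) / 2) * A) powr (1 / p)"
  have "cmod (heat (sqrt (2 * s)) h x) \<le> S" for x
  proof -
    have "cmod (heat (sqrt (2 * s)) h x) powr p \<le> (4 * pi * s) powr (- real CARD('n) / 2) * A"
      using heat_powr_le[OF p h, of "sqrt (2 * s)" x] s by (simp add: A_def mult_ac)
    then have "(cmod (heat (sqrt (2 * s)) h x) powr p) powr (1 / p) \<le> S"
      unfolding S_def using p by (intro powr_mono2) auto
    then show ?thesis using p by (simp add: powr_powr)
  qed
  from heat_nn_integral_le[OF p q h this]
  have le: "(\<integral>\<^sup>+x. ennreal (cmod (heat (sqrt (2 * s)) h x) powr q) \<partial>lborel) \<le> ennreal (S powr (q - p) * A)"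
    unfolding A_def .
  have "S powr (q - p) = ((4 * pi * s) powr (- real CARD('n) / 2)) powr ((q - p) / p) * A powr ((q - p) / p)"
    unfolding S_def using A by (simp add: powr_powr powr_mult)
  also have "((4 * pi * s) powr (- real CARD('n) / 2)) powr ((q - p) / p) = (4 * pi * s) powr (- (\<sigma> * q))"
  proof -
    have "- real CARD('n) / 2 * ((q - p) / p) = - (\<sigma> * q)"
      unfolding \<sigma> using p q by (simp add: field_simps)
    then show ?thesis by (simp only: powr_powr)
  qed
  also have "\<dots> = (4 * pi) powr (- (\<sigma> * q)) * s powr (- (\<sigma> * q))" using s by (simp add: powr_mult)
  finally have "s powr (\<sigma> * q) * (S powr (q - p) * A) = (4 * pi) powr (- (\<sigma> * q)) * (A powr ((q - p) / p) * A)"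
    using s by (simp add: powr_minus field_simps)
  also have "A powr ((q - p) / p) * A = A powr (q / p)"
  proof (cases "A = 0")
    case False
    then have "A powr ((q - p) / p) * A powr 1 = A powr ((q - p) / p + 1)" by (simp only: powr_add)
    moreover have "(q - p) / p + 1 = q / p" using p by (simp add: field_simps)
    ultimately show ?thesis using A by simp
  qed simp
  finally have eq: "s powr (\<sigma> * q) * (S powr (q - p) * A) = (4 * pi) powr (- (\<sigma> * q)) * A powr (q / p)" .
  have "ennreal (s powr (\<sigma> * q)) * (\<integral>\<^sup>+x. ennreal (cmod (heat (sqrt (2 * s)) h x) powr q) \<partial>lborel)
    \<le> ennreal (s powr (\<sigma> * q)) * ennreal (S powr (q - p) * A)"
    by (intro mult_left_mono le) auto
  also have "\<dots> = ennreal ((4 * pi) powr (- (\<sigma> * q)) * A powr (q / p))"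
    using A by (subst eq[symmetric], subst ennreal_mult[symmetric]) auto
  finally show ?thesis unfolding A_def .
qed

text \<open>The weight \<open>s powr \<sigma>\<close> compensates the decay of the heat semigroup from
  \<open>L\<^sup>p\<close> to \<open>L\<^sup>q\<close>; moving it into the gamma distribution lowers its shape parameter
  by \<open>\<sigma>\<close>, which stays positive exactly below the critical exponent.\<close>

lemma bessel_op_nn_integral_le:
  fixes h :: "real^'n \<Rightarrow> complex"
  assumes p: "1 \<le> p" and q: "p \<le> q" and h: "h \<in> carr (Lp p)" and \<sigma>: "0 \<le> \<sigma>" "\<sigma> < \<alpha> / 2"
  shows "(\<integral>\<^sup>+x. ennreal (cmod (bessel_op \<alpha> h x) powr q) \<partial>lborel) \<le> ennreal ((Gamma (\<alpha> / 2 - \<sigma>) / Gamma (\<alpha> / 2)) powr q) *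
    (\<integral>\<^sup>+s. ennreal (s powr (\<sigma> * q)) * (\<integral>\<^sup>+x. ennreal (cmod (heat (sqrt (2 * s)) h x) powr q) \<partial>lborel) \<partial>gamma_measure (\<alpha> / 2 - \<sigma>))"
proof -
  have [measurable]: "h \<in> borel_measurable borel" using h by (rule Lp_measurable)
  note heat_pair_measurable[measurable]
  let ?a = "\<alpha> / 2" and ?b = "\<alpha> / 2 - \<sigma>"
  have pos: "0 < ?a" "0 < ?b" using \<sigma> by auto
  have G: "0 < Gamma ?a" "0 < Gamma ?b" using pos by (auto intro: Gamma_real_pos)
  let ?\<kappa> = "Gamma ?b / Gamma ?a"
  interpret A: prob_space "gamma_measure ?a" using pos by (intro prob_space_gamma_measure)
  interpret B: prob_space "gamma_measure ?b" using pos by (intro prob_space_gamma_measure)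
  interpret pair_sigma_finite "gamma_measure ?b" "lborel :: (real^'n) measure" ..
  let ?F = "\<lambda>s x. heat (sqrt (2 * s)) h x"
  have eq: "(\<integral>s. ?F s x \<partial>gamma_measure ?a) = (\<integral>s. complex_of_real (?\<kappa> * s powr \<sigma>) * ?F s x \<partial>gamma_measure ?b)" for x
  proof -
    \<comment> \<open>Lowering the shape by \<sigma> frees the factor
      \<open>s powr \<sigma>\<close>; \<open>?\<kappa>\<close> is the quotient of the two
      normalising constants.\<close>
    have "gamma_density ?a s = gamma_density ?b s * (?\<kappa> * s powr \<sigma>)" for s
    proof (cases "s > 0")
      case True
      then have "s powr (?a - 1) = s powr (?b - 1) * s powr \<sigma>" by (simp flip: powr_add)
      then show ?thesis using G by (simp add: gamma_density_def)
    qed (auto simp: gamma_density_def indicator_def)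
    note dens = this
    define F where "F = (\<lambda>s. ?F s x)"
    have [measurable]: "F \<in> borel_measurable borel"
      using measurable_compose[OF measurable_Pair2'[of x borel borel] heat_pair_measurable[of h]] by (simp add: F_def)
    have "(\<integral>s. F s \<partial>gamma_measure ?a) = (\<integral>s. complex_of_real (?\<kappa> * s powr \<sigma>) * F s \<partial>gamma_measure ?b)"
      unfolding gamma_measure_def using pos
      by (subst (1 2) integral_density) (auto simp: gamma_density_nonneg scaleR_conv_of_real dens mult_ac)
    then show ?thesis unfolding F_def .
  qed
  have "(\<integral>\<^sup>+x. ennreal (cmod (bessel_op \<alpha> h x) powr q) \<partial>lborel) \<le>
    (\<integral>\<^sup>+x. \<integral>\<^sup>+s. ennreal (cmod (complex_of_real (?\<kappa> * s powr \<sigma>) * ?F s x) powr q) \<partial>gamma_measure ?b \<partial>lborel)"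
  proof (rule nn_integral_mono_AE)
    have "AE x in lborel. bessel_op \<alpha> h x = (\<integral>s. ?F s x \<partial>gamma_measure ?a)"
      by (rule bessel_op_eq_heat[OF _ p h]) (use pos in simp)
    then show "AE x in lborel. ennreal (cmod (bessel_op \<alpha> h x) powr q) \<le>
      (\<integral>\<^sup>+s. ennreal (cmod (complex_of_real (?\<kappa> * s powr \<sigma>) * ?F s x) powr q) \<partial>gamma_measure ?b)"
    proof eventually_elim
      case (elim x)
      \<comment> \<open>Jensen is applied only after the change of measure, so the factor
        \<open>s powr \<sigma>\<close> is raised to the power q along with the heat term and can
        cancel its rate.\<close>
      show ?case unfolding elim eq
        by (rule B.powr_norm_expectation_le) (use p q in auto)
    qed
  qed
  also have "\<dots> = (\<integral>\<^sup>+s. \<integral>\<^sup>+x. ennreal (cmod (complex_of_real (?\<kappa> * s powr \<sigma>) * ?F s x) powr q) \<partial>lborel \<partial>gamma_measure ?b)"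
    by (rule Fubini') measurable
  also have "\<dots> = (\<integral>\<^sup>+s. ennreal (?\<kappa> powr q) * (ennreal (s powr (\<sigma> * q)) * (\<integral>\<^sup>+x. ennreal (cmod (?F s x) powr q) \<partial>lborel)) \<partial>gamma_measure ?b)"
  proof (rule nn_integral_cong)
    fix s
    have "cmod (complex_of_real (?\<kappa> * s powr \<sigma>) * ?F s x) powr q = ?\<kappa> powr q * s powr (\<sigma> * q) * cmod (?F s x) powr q" for x
    proof -
      have "cmod (complex_of_real (?\<kappa> * s powr \<sigma>) * ?F s x) = (?\<kappa> * s powr \<sigma>) * cmod (?F s x)"
        using G by (simp only: norm_mult norm_of_real abs_mult abs_of_pos abs_of_nonneg[OF powr_ge_zero] divide_pos_pos)
      then show ?thesis using G by (simp only: powr_mult powr_powr) 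
    qed
    then show "(\<integral>\<^sup>+x. ennreal (cmod (complex_of_real (?\<kappa> * s powr \<sigma>) * ?F s x) powr q) \<partial>lborel) =
      ennreal (?\<kappa> powr q) * (ennreal (s powr (\<sigma> * q)) * (\<integral>\<^sup>+x. ennreal (cmod (?F s x) powr q) \<partial>lborel))"
      by (simp add: ennreal_mult nn_integral_cmult mult.assoc)
  qed
  also have "\<dots> = ennreal (?\<kappa> powr q) * (\<integral>\<^sup>+s. ennreal (s powr (\<sigma> * q)) * (\<integral>\<^sup>+x. ennreal (cmod (?F s x) powr q) \<partial>lborel) \<partial>gamma_measure ?b)"
    by (rule nn_integral_cmult) measurable
  finally show ?thesis .
qed

text \<open>The weighted heat integral is at most a constant free of s, and the gamma law of shape
  \<alpha> / 2 - \<sigma> has mass 1.\<close>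

lemma bessel_op_Lq_bound:
  fixes p q \<alpha> :: real
  assumes p: "1 \<le> p" and q: "p \<le> q" and sub: "real CARD('n) * (1 / p - 1 / q) < \<alpha>"
  obtains K where "\<And>h :: real^'n \<Rightarrow> complex. h \<in> carr (Lp p) \<Longrightarrow>
    (\<integral>\<^sup>+x. ennreal (cmod (bessel_op \<alpha> h x) powr q) \<partial>lborel) \<le> ennreal (K * (\<integral>x. cmod (h x) powr p \<partial>lborel) powr (q / p))"
proof -
  define \<sigma> where "\<sigma> = real CARD('n) / 2 * (1 / p - 1 / q)"
  have \<sigma>: "0 \<le> \<sigma>" "\<sigma> < \<alpha> / 2" using assms by (auto simp: \<sigma>_def frac_le)
  interpret B: prob_space "gamma_measure (\<alpha> / 2 - \<sigma>)" using \<sigma> by (intro prob_space_gamma_measure) simp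
  let ?\<kappa> = "Gamma (\<alpha> / 2 - \<sigma>) / Gamma (\<alpha> / 2)"
  let ?K = "?\<kappa> powr q * (4 * pi) powr (- (\<sigma> * q))"
  have "(\<integral>\<^sup>+x. ennreal (cmod (bessel_op \<alpha> h x) powr q) \<partial>lborel) \<le> ennreal (?K * (\<integral>x. cmod (h x) powr p \<partial>lborel) powr (q / p))"
    if h: "h \<in> carr (Lp p)" for h :: "real^'n \<Rightarrow> complex"
  proof -
    let ?R = "(4 * pi) powr (- (\<sigma> * q)) * (\<integral>x. cmod (h x) powr p \<partial>lborel) powr (q / p)"
    have "(\<integral>\<^sup>+s. ennreal (s powr (\<sigma> * q)) * (\<integral>\<^sup>+x. ennreal (cmod (heat (sqrt (2 * s)) h x) powr q) \<partial>lborel) \<partial>gamma_measure (\<alpha> / 2 - \<sigma>))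
      \<le> (\<integral>\<^sup>+s. ennreal ?R \<partial>gamma_measure (\<alpha> / 2 - \<sigma>))"
      using AE_gamma_measure_pos by (intro nn_integral_mono_AE, eventually_elim) (rule heat_nn_integral_decay[OF p q h _ \<sigma>_def])
    also have "\<dots> = ennreal ?R" using B.emeasure_space_1 by simp
    finally have "ennreal (?\<kappa> powr q) * (\<integral>\<^sup>+s. ennreal (s powr (\<sigma> * q)) * (\<integral>\<^sup>+x. ennreal (cmod (heat (sqrt (2 * s)) h x) powr q) \<partial>lborel) \<partial>gamma_measure (\<alpha> / 2 - \<sigma>))
      \<le> ennreal (?\<kappa> powr q) * ennreal ?R" by (intro mult_left_mono) auto
    also have "\<dots> = ennreal (?K * (\<integral>x. cmod (h x) powr p \<partial>lborel) powr (q / p))"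
      by (simp add: ennreal_mult' mult.assoc)
    finally show ?thesis using bessel_op_nn_integral_le[OF p q h \<sigma>] by (rule order_trans[rotated])
  qed
  then show ?thesis using that by blast
qed

text \<open>The constant \<open>?R\<close> majorises the weighted heat integrals for all s > 0 and
  all k at once, so their convergence to 0 at each fixed s passes to the gamma integral.\<close>

lemma bessel_op_Lq_tendsto:
  fixes h :: "nat \<Rightarrow> real^'n \<Rightarrow> complex"
  assumes p: "1 \<le> p" and q: "p \<le> q" and sub: "real CARD('n) * (1 / p - 1 / q) < \<alpha>"
    and h: "\<And>k. h k \<in> carr (Lp p)" and bdd: "\<And>k. (\<integral>x. cmod (h k x) powr p \<partial>lborel) \<le> M"
    and heat: "\<And>c. 0 < c \<Longrightarrow> (\<lambda>k. \<integral>\<^sup>+x. ennreal (cmod (heat c (h k) x) powr q) \<partial>lborel) \<longlonglongrightarrow> 0"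
  shows "(\<lambda>k. \<integral>\<^sup>+x. ennreal (cmod (bessel_op \<alpha> (h k) x) powr q) \<partial>lborel) \<longlonglongrightarrow> 0"
proof -
  define \<sigma> where "\<sigma> = real CARD('n) / 2 * (1 / p - 1 / q)"
  have \<sigma>: "0 \<le> \<sigma>" "\<sigma> < \<alpha> / 2" using assms by (auto simp: \<sigma>_def frac_le)
  interpret B: prob_space "gamma_measure (\<alpha> / 2 - \<sigma>)" using \<sigma> by (intro prob_space_gamma_measure) simp
  have [measurable]: "h k \<in> borel_measurable borel" for k using h by (rule Lp_measurable)
  note heat_pair_measurable[measurable]
  let ?\<kappa> = "Gamma (\<alpha> / 2 - \<sigma>) / Gamma (\<alpha> / 2)"
  let ?D = "\<lambda>k s. ennreal (s powr (\<sigma> * q)) * (\<integral>\<^sup>+x. ennreal (cmod (heat (sqrt (2 * s)) (h k) x) powr q) \<partial>lborel)"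
  let ?R = "(4 * pi) powr (- (\<sigma> * q)) * M powr (q / p)"
  have "(\<lambda>k. \<integral>\<^sup>+s. ?D k s \<partial>gamma_measure (\<alpha> / 2 - \<sigma>)) \<longlonglongrightarrow> (\<integral>\<^sup>+s. 0 \<partial>gamma_measure (\<alpha> / 2 - \<sigma>))"
  proof (rule nn_integral_dominated_convergence[where w = "\<lambda>_. ennreal ?R"])
    show "AE s in gamma_measure (\<alpha> / 2 - \<sigma>). ?D k s \<le> ennreal ?R" for k
      using AE_gamma_measure_pos
    proof eventually_elim
      case (elim s)
      have "?D k s \<le> ennreal ((4 * pi) powr (- (\<sigma> * q)) * (\<integral>x. cmod (h k x) powr p \<partial>lborel) powr (q / p))"
        by (rule heat_nn_integral_decay[OF p q h elim \<sigma>_def])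
      also have "\<dots> \<le> ennreal ?R"
        using p q bdd[of k] by (intro ennreal_leI mult_left_mono powr_mono2 integral_nonneg_AE) auto
      finally show ?case .
    qed
    show "AE s in gamma_measure (\<alpha> / 2 - \<sigma>). (\<lambda>k. ?D k s) \<longlonglongrightarrow> 0"
      using AE_gamma_measure_pos
    proof eventually_elim
      case (elim s)
      then have "(\<lambda>k. ?D k s) \<longlonglongrightarrow> ennreal (s powr (\<sigma> * q)) * 0"
        by (intro ennreal_tendsto_cmult heat) auto
      then show ?case by simp
    qed
    show "(\<integral>\<^sup>+s. ennreal ?R \<partial>gamma_measure (\<alpha> / 2 - \<sigma>)) < \<infinity>" using B.emeasure_space_1 by simp
  qed measurable
  then have "(\<lambda>k. ennreal (?\<kappa> powr q) * (\<integral>\<^sup>+s. ?D k s \<partial>gamma_measure (\<alpha> / 2 - \<sigma>))) \<longlonglongrightarrow> ennreal (?\<kappa> powr q) * 0"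
    by (intro ennreal_tendsto_cmult) auto
  then have lim: "(\<lambda>k. ennreal (?\<kappa> powr q) * (\<integral>\<^sup>+s. ?D k s \<partial>gamma_measure (\<alpha> / 2 - \<sigma>))) \<longlonglongrightarrow> 0" by simp
  show ?thesis
    by (rule tendsto_sandwich[OF _ _ tendsto_const lim])
      (auto intro!: always_eventually bessel_op_nn_integral_le[OF p q h \<sigma>])
qed

section \<open>Uniform decay under the heat semigroup\<close>

lemma Holder:
  fixes f g :: "real^'n \<Rightarrow> complex"
  assumes p: "1 < p" and q: "1 < q" and pq: "1 / p + 1 / q = 1"
    and f: "f \<in> carr (Lp p)" and g: "g \<in> carr (Lp q)"
  shows "integrable lborel (\<lambda>x. f x * g x)"
    and "cmod (\<integral>x. f x * g x \<partial>lborel) \<le> fnorm (Lp p) f * fnorm (Lp q) g"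
proof -
  have [measurable]: "f \<in> borel_measurable borel" "g \<in> borel_measurable borel"
    using f g by (auto dest: Lp_measurable)
  have fi: "integrable lborel (\<lambda>x. cmod (f x) powr p)" and gi: "integrable lborel (\<lambda>x. cmod (g x) powr q)"
    using f g by (auto simp: Lp_iff)
  have young: "cmod (f x * g x) \<le> cmod (f x) powr p / p + cmod (g x) powr q / q" for x
    using Youngs_inequality[OF p q pq, of "cmod (f x)" "cmod (g x)"] by (simp add: norm_mult)
  show int: "integrable lborel (\<lambda>x. f x * g x)"
    by (rule Bochner_Integration.integrable_bound[of _ "\<lambda>x. cmod (f x) powr p / p + cmod (g x) powr q / q"])
      (use fi gi in \<open>auto intro!: order_trans[OF young] abs_ge_self\<close>)
  define a where "a = fnorm (Lp p) f"
  define b where "b = fnorm (Lp q) g"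
  have ab: "0 \<le> a" "0 \<le> b" unfolding a_def b_def by (rule fnorm_Lp_nonneg)+
  have A: "a powr p = (\<integral>x. cmod (f x) powr p \<partial>lborel)" and B: "b powr q = (\<integral>x. cmod (g x) powr q \<partial>lborel)"
    unfolding a_def b_def using p q by (auto intro: fnorm_Lp_powr)
  show "cmod (\<integral>x. f x * g x \<partial>lborel) \<le> fnorm (Lp p) f * fnorm (Lp q) g"
  proof (cases "a = 0 \<or> b = 0")
    case True
    have "AE x in lborel. f x * g x = 0"
    proof (cases "a = 0")
      case True
      then have "AE x in lborel. cmod (f x) powr p = 0"
        using A integral_nonneg_eq_0_iff_AE[OF fi] by simp
      then show ?thesis by eventually_elim simp
    next
      case False
      with \<open>a = 0 \<or> b = 0\<close> have "AE x in lborel. cmod (g x) powr q = 0"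
        using B integral_nonneg_eq_0_iff_AE[OF gi] by simp
      then show ?thesis by eventually_elim simp
    qed
    then have "(\<integral>x. f x * g x \<partial>lborel) = 0" by (rule integral_eq_zero_AE)
    then show ?thesis using ab by (simp add: a_def b_def)
  next
    case False
    then have ab: "0 < a" "0 < b" using ab by auto
    have "cmod (f x * g x) \<le> a * b * (cmod (f x) powr p / a powr p / p + cmod (g x) powr q / b powr q / q)" for x
    proof -
      have "cmod (f x * g x) = a * b * (cmod (f x) / a * (cmod (g x) / b))"
        using ab by (simp add: norm_mult)
      also have "\<dots> \<le> a * b * ((cmod (f x) / a) powr p / p + (cmod (g x) / b) powr q / q)"
        using ab by (intro mult_left_mono Youngs_inequality[OF p q pq]) auto
      finally show ?thesis using ab by (simp add: powr_divide)
    qed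
    then have "cmod (\<integral>x. f x * g x \<partial>lborel) \<le> (\<integral>x. a * b * (cmod (f x) powr p / a powr p / p + cmod (g x) powr q / b powr q / q) \<partial>lborel)"
      by (intro Bochner_Integration.integral_norm_bound_integral int) (use fi gi in auto)
    also have "\<dots> = a * b * (a powr p / a powr p / p + b powr q / b powr q / q)"
      using fi gi by (simp add: A B)
    also have "\<dots> = a * b" using ab pq by simp
    finally show ?thesis by (simp add: a_def b_def)
  qed
qed

definition heat_kernel :: "real \<Rightarrow> real^'n \<Rightarrow> real" where
  "heat_kernel c x = (1 / c) ^ CARD('n) * gauss_density ((1 / c) *\<^sub>R x)"

lemma heat_kernel_nonneg: "0 < c \<Longrightarrow> 0 \<le> heat_kernel c x"
  by (simp add: heat_kernel_def)

lemma heat_kernel_continuous: "continuous_on UNIV (heat_kernel c)"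
  unfolding heat_kernel_def[abs_def] gauss_density_def[abs_def] by (intro continuous_intros) auto

lemma heat_kernel_measurable [measurable]: "heat_kernel c \<in> borel_measurable borel"
  by (rule borel_measurable_continuous_onI[OF heat_kernel_continuous])

lemma heat_eq_heat_kernel:
  assumes "h \<in> borel_measurable borel" "0 < c"
  shows "heat c h x = (\<integral>z. h z * complex_of_real (heat_kernel c (x - z)) \<partial>lborel)"
  unfolding heat_def avg_def heat_kernel_def by (rule integral_gaussian_shift[OF assms])

text \<open>From \<open>1 + norm z \<le> (1 + norm t) * (1 + norm (t - z))\<close> and the rapid
  decay of the Gaussian. The point is one majorant for all centres \<open>t\<close> in a ball, which
  makes translation of the kernel continuous in every Lebesgue norm by dominated
  convergence.\<close>

lemma heat_kernel_le_weight:
  assumes c: "0 < c"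
  obtains D where "0 \<le> D" "\<And>t z :: real^'n. norm t \<le> R \<Longrightarrow> heat_kernel c (t - z) \<le> D * weight z"
proof -
  let ?m = "2 * CARD('n)"
  let ?K = "(1 / c) ^ CARD('n) * (2 * pi) powr (- real CARD('n) / 2)"
  obtain C where C: "\<And>x::real^'n. (1 + norm x) ^ ?m * cmod (complex_of_real (exp (- (1 / (2 * c\<^sup>2) * (norm x)\<^sup>2)))) \<le> C"
    using schwartz_decay[OF schwartz_gauss[of "1 / (2 * c\<^sup>2)"], of ?m] c by auto
  have C0: "0 \<le> C" by (rule order_trans[OF _ C[of 0]]) simp
  have k: "(1 + norm x) ^ ?m * heat_kernel c x \<le> ?K * C" for x :: "real^'n"
  proof -
    have "heat_kernel c x = ?K * exp (- (1 / (2 * c\<^sup>2) * (norm x)\<^sup>2))"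
      using c by (simp add: heat_kernel_def gauss_density_def power_mult_distrib power_divide)
    then have "(1 + norm x) ^ ?m * heat_kernel c x = ?K * ((1 + norm x) ^ ?m * exp (- (1 / (2 * c\<^sup>2) * (norm x)\<^sup>2)))"
      by (simp add: mult_ac)
    also have "\<dots> \<le> ?K * C" using C[of x] c by (intro mult_left_mono) auto
    finally show ?thesis .
  qed
  define D where "D = (1 + \<bar>R\<bar>) ^ ?m * (?K * C)"
  have "heat_kernel c (t - z) \<le> D * weight z" if t: "norm t \<le> R" for t z :: "real^'n"
  proof -
    let ?k = "heat_kernel c (t - z)"
    have k0: "0 \<le> ?k" by (rule heat_kernel_nonneg[OF c])
    have "1 + norm z \<le> 1 + norm t + norm (t - z)" using norm_triangle_ineq4[of t "t - z"] by simp
    also have "\<dots> \<le> (1 + norm t) * (1 + norm (t - z))" by (simp add: algebra_simps)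
    also have "\<dots> \<le> (1 + \<bar>R\<bar>) * (1 + norm (t - z))" using t by (intro mult_right_mono) auto
    finally have "(1 + norm z) ^ ?m \<le> ((1 + \<bar>R\<bar>) * (1 + norm (t - z))) ^ ?m" by (intro power_mono) auto
    then have "(1 + norm z) ^ ?m * ?k \<le> ((1 + \<bar>R\<bar>) * (1 + norm (t - z))) ^ ?m * ?k"
      using k0 by (rule mult_right_mono)
    also have "\<dots> = (1 + \<bar>R\<bar>) ^ ?m * ((1 + norm (t - z)) ^ ?m * ?k)" by (simp add: power_mult_distrib)
    also have "\<dots> \<le> D" unfolding D_def by (intro mult_left_mono k) auto
    finally have *: "(1 + norm z) ^ ?m * ?k \<le> D" .
    have "1 * ?k \<le> ((1 + norm z) ^ ?m * weight z) * ?k" by (rule mult_right_mono[OF weight_lower k0])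
    also have "\<dots> = ((1 + norm z) ^ ?m * ?k) * weight z" by simp
    also have "\<dots> \<le> D * weight z" using * weight_pos[of z] by (intro mult_right_mono) auto
    finally show ?thesis by simp
  qed
  moreover have "0 \<le> D" unfolding D_def using C0 c by auto
  ultimately show ?thesis using that by blast
qed

lemma weight_powr_le: "1 \<le> q \<Longrightarrow> 0 \<le> D \<Longrightarrow> (D * weight x) powr q \<le> D powr q * weight x"
proof -
  assume q: "1 \<le> q" and D: "0 \<le> D"
  have "weight x powr q \<le> weight x powr 1"
    by (rule powr_mono'[OF q less_imp_le[OF weight_pos] weight_le_1])
  then have "weight x powr q \<le> weight x" using weight_pos[of x] by simp
  then have "D powr q * weight x powr q \<le> D powr q * weight x" by (rule mult_left_mono) simp
  then show ?thesis by (simp only: powr_mult)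
qed

lemma Lp_bounded_by_weight:
  fixes \<phi> :: "real^'n \<Rightarrow> complex"
  assumes q: "1 \<le> q" and D: "0 \<le> D" and [measurable]: "\<phi> \<in> borel_measurable borel"
    and le: "\<And>x. cmod (\<phi> x) \<le> D * weight x"
  shows "\<phi> \<in> carr (Lp q)"
proof -
  have l: "cmod (\<phi> x) powr q \<le> D powr q * weight x" for x
  proof -
    have "cmod (\<phi> x) powr q \<le> (D * weight x) powr q"
      by (rule powr_mono2[OF _ norm_ge_zero le]) (use q in simp)
    also have "\<dots> \<le> D powr q * weight x" by (rule weight_powr_le[OF q D])
    finally show ?thesis .
  qed
  have "integrable lborel (\<lambda>x. cmod (\<phi> x) powr q)"
  proof (rule Bochner_Integration.integrable_bound[OF integrable_mult_right[OF weight_integrable, of "D powr q"] _ AE_I2])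
    fix x
    show "norm (cmod (\<phi> x) powr q) \<le> norm (D powr q * weight x)"
      unfolding real_norm_def abs_of_nonneg[OF powr_ge_zero] by (rule order_trans[OF l abs_ge_self])
  qed measurable
  then show ?thesis by (simp add: Lp_iff)
qed

text \<open>A lattice translation moves the point of evaluation into the unit cube, and the translates of the
  heat kernel by points of the unit cube form a compact set in the dual Lebesgue space.\<close>

lemma heat_uniform_tendsto:
  fixes h :: "nat \<Rightarrow> real^'n \<Rightarrow> complex"
  assumes p: "1 < p" and q: "1 < q" and pq: "1 / p + 1 / q = 1"
    and h: "\<And>k. h k \<in> carr (Lp p)" and bdd: "\<And>k. fnorm (Lp p) (h k) \<le> M"
    and weak: "\<And>\<phi> y. \<phi> \<in> carr (Lp q) \<Longrightarrow> (\<And>k i. y k $ i \<in> \<int>) \<Longrightarrow>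
      (\<lambda>k. \<integral>x. h k (x - y k) * \<phi> x \<partial>lborel) \<longlonglongrightarrow> 0"
    and c: "0 < c" and \<epsilon>: "0 < \<epsilon>"
  shows "\<forall>\<^sub>F k in sequentially. \<forall>x. cmod (heat c (h k) x) \<le> \<epsilon>"
proof (rule ccontr)
  define bad where "bad = {k. \<exists>x. \<epsilon> < cmod (heat c (h k) x)}"
  assume "\<not> ?thesis"
  then have inf: "infinite bad"
    unfolding bad_def by (auto simp: not_eventually frequently_cofinite[symmetric] cofinite_eq_sequentially not_le)
  define x where "x k = (SOME x. \<epsilon> < cmod (heat c (h k) x))" for k
  have x: "\<epsilon> < cmod (heat c (h k) (x k))" if "k \<in> bad" for k
    using that unfolding bad_def x_def by (auto intro: someI)
  \<comment> \<open>Minus the integer parts of the coordinates, so that \<open>x k + y k\<close>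
    lies in the unit cube.\<close>
  define y where "y k = (\<chi> i. - real_of_int \<lfloor>x k $ i\<rfloor>)" for k
  define t where "t k = x k + y k" for k
  have [measurable]: "h k \<in> borel_measurable borel" for k using h by (rule Lp_measurable)
  have y: "y k $ i \<in> \<int>" for k i by (simp add: y_def)
  have t: "t k \<in> cbox 0 1" for k
    unfolding mem_box_cart by (auto simp: t_def y_def) linarith+
  then have "\<forall>j. (t \<circ> enumerate bad) j \<in> cbox 0 1" by simp
  then obtain l s where l: "l \<in> cbox 0 1" and s: "strict_mono s" and lim: "((t \<circ> enumerate bad) \<circ> s) \<longlonglongrightarrow> l"
    using compact_imp_seq_compact[OF compact_cbox] unfolding seq_compact_def by metis
  \<comment> \<open>Every index selected by \<open>r\<close> is bad, so the lower bound \<epsilon>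
    survives along the convergent subsequence and contradicts the limit 0 found below.\<close>
  define r where "r = enumerate bad \<circ> s"
  have r: "strict_mono r" unfolding r_def using s strict_mono_enumerate[OF inf] by (rule strict_mono_o[rotated])
  have rb: "r j \<in> bad" for j unfolding r_def using enumerate_in_set[OF inf] by simp
  have lim: "(\<lambda>j. t (r j)) \<longlonglongrightarrow> l" using lim by (simp add: r_def o_def)
  obtain R where R: "\<And>u :: real^'n. u \<in> cbox 0 1 \<Longrightarrow> norm u \<le> R"
    using bounded_cbox[of 0 "1 :: real^'n"] unfolding bounded_iff by blast
  obtain D where D: "0 \<le> D" "\<And>u z :: real^'n. norm u \<le> R \<Longrightarrow> heat_kernel c (u - z) \<le> D * weight z"
    using heat_kernel_le_weight[OF c] by blast
  let ?g = "\<lambda>u z. complex_of_real (heat_kernel c (u - z))"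
  have gle: "cmod (?g u z) \<le> D * weight z" if "u \<in> cbox 0 1" for u z :: "real^'n"
    using D(2)[OF R[OF that], of z] heat_kernel_nonneg[OF c, of "u - z"] by simp
  have g: "?g u \<in> carr (Lp q)" if "u \<in> cbox 0 1" for u :: "real^'n"
    by (rule Lp_bounded_by_weight[OF _ D(1) _ gle[OF that]]) (use q in auto)
  let ?d = "\<lambda>j z. ?g (t (r j)) z - ?g l z"
  have d: "?d j \<in> carr (Lp q)" for j by (rule Lp_diff) (use q g t l in auto)
  have "(\<lambda>j. \<integral>z. cmod (?d j z) powr q \<partial>lborel) \<longlonglongrightarrow> (\<integral>z. 0 \<partial>(lborel :: (real^'n) measure))"
  proof (rule integral_dominated_convergence[where w = "\<lambda>z. (2 * D) powr q * weight z"])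
    show "AE z in lborel. norm (cmod (?d j z) powr q) \<le> (2 * D) powr q * weight z" for j
    proof (rule AE_I2)
      fix z
      have "cmod (?d j z) \<le> (2 * D) * weight z"
        using norm_triangle_ineq4[of "?g (t (r j)) z" "?g l z"] gle[OF t[of "r j"], of z] gle[OF l, of z] by simp
      then have "cmod (?d j z) powr q \<le> ((2 * D) * weight z) powr q" using q by (intro powr_mono2) auto
      also have "\<dots> \<le> (2 * D) powr q * weight z" by (rule weight_powr_le) (use q D in auto)
      finally show "norm (cmod (?d j z) powr q) \<le> (2 * D) powr q * weight z" by simp
    qed
    show "AE z in lborel. (\<lambda>j. cmod (?d j z) powr q) \<longlonglongrightarrow> 0"
    proof (rule AE_I2)
      fix z
      have "(\<lambda>j. heat_kernel c (t (r j) - z)) \<longlonglongrightarrow> heat_kernel c (l - z)"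
        using heat_kernel_continuous[of c] lim
        by (intro continuous_on_tendsto_compose[where s = UNIV and f = "heat_kernel c"] tendsto_diff tendsto_const) auto
      then have "(\<lambda>j. ?d j z) \<longlonglongrightarrow> 0" by (intro LIM_zero tendsto_of_real)
      then have "(\<lambda>j. cmod (?d j z)) \<longlonglongrightarrow> 0" by (rule tendsto_norm_zero)
      then have "(\<lambda>j. cmod (?d j z) powr q) \<longlonglongrightarrow> 0 powr q"
        using q by (intro tendsto_powr2 tendsto_const) auto
      then show "(\<lambda>j. cmod (?d j z) powr q) \<longlonglongrightarrow> 0" using q by simp
    qed
    show "integrable lborel (\<lambda>z. (2 * D) powr q * weight (z :: real^'n))" by (intro integrable_mult_right weight_integrable)
  qed measurable
  then have "(\<lambda>j. fnorm (Lp q) (?d j)) \<longlonglongrightarrow> 0 powr (1 / q)"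
    unfolding fnorm_Lp using q by (intro tendsto_powr2 tendsto_const) (auto intro!: always_eventually integral_nonneg_AE)
  then have dlim: "(\<lambda>j. M * fnorm (Lp q) (?d j)) \<longlonglongrightarrow> 0"
    using q by (intro tendsto_mult_right_zero) simp
  have hs: "(\<lambda>z. h k (z - y k)) \<in> carr (Lp p)" for k by (rule Lp_shift[OF h])
  have hn: "fnorm (Lp p) (\<lambda>z. h k (z - y k)) \<le> M" for k
    using bdd[of k] integral_lborel_shift[of "\<lambda>x. cmod (h k x) powr p" "- y k"] by (simp add: fnorm_Lp)
  \<comment> \<open>The value at the far point \<open>x k\<close> is the pairing of a lattice
    translate of \<open>h k\<close> with a kernel centred in the cube.\<close>
  have F: "heat c (h k) (x k) = (\<integral>z. h k (z - y k) * ?g (t k) z \<partial>lborel)" for k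
  proof -
    have "heat c (h k) (x k) = (\<integral>z. h k z * ?g (x k) z \<partial>lborel)" by (rule heat_eq_heat_kernel[OF _ c]) simp
    also have "\<dots> = (\<integral>z. h k (z + - y k) * ?g (x k) (z + - y k) \<partial>lborel)"
      by (rule integral_lborel_shift[symmetric]) measurable
    also have "\<dots> = (\<integral>z. h k (z - y k) * ?g (t k) z \<partial>lborel)"
      by (rule Bochner_Integration.integral_cong) (simp_all add: t_def algebra_simps)
    finally show ?thesis .
  qed
  \<comment> \<open>The kernel is split at its limit. The fixed kernel centred at \<open>l\<close>
    is handled by the weak hypothesis along \<open>r\<close>; the remainder tends to 0 in the dual
    norm and is paired with functions of norm at most \<open>M\<close>.\<close>
  have "(\<lambda>j. (\<integral>z. h (r j) (z - y (r j)) * ?g l z \<partial>lborel) + (\<integral>z. h (r j) (z - y (r j)) * ?d j z \<partial>lborel)) \<longlonglongrightarrow> 0 + 0"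
  proof (rule tendsto_add)
    show "(\<lambda>j. \<integral>z. h (r j) (z - y (r j)) * ?g l z \<partial>lborel) \<longlonglongrightarrow> 0"
      using LIMSEQ_subseq_LIMSEQ[OF weak[OF g[OF l] y] r] by (simp add: o_def)
    show "(\<lambda>j. \<integral>z. h (r j) (z - y (r j)) * ?d j z \<partial>lborel) \<longlonglongrightarrow> 0"
    proof (rule Lim_null_comparison[OF always_eventually dlim], rule allI)
      fix j
      have "cmod (\<integral>z. h (r j) (z - y (r j)) * ?d j z \<partial>lborel) \<le> fnorm (Lp p) (\<lambda>z. h (r j) (z - y (r j))) * fnorm (Lp q) (?d j)"
        by (rule Holder(2)[OF p q pq hs d])
      also have "\<dots> \<le> M * fnorm (Lp q) (?d j)" by (intro mult_right_mono hn fnorm_Lp_nonneg)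
      finally show "cmod (\<integral>z. h (r j) (z - y (r j)) * ?d j z \<partial>lborel) \<le> M * fnorm (Lp q) (?d j)" .
    qed
  qed
  moreover have "(\<integral>z. h (r j) (z - y (r j)) * ?g l z \<partial>lborel) + (\<integral>z. h (r j) (z - y (r j)) * ?d j z \<partial>lborel) = heat c (h (r j)) (x (r j))" for j
    unfolding F Bochner_Integration.integral_add[OF Holder(1)[OF p q pq hs g[OF l]] Holder(1)[OF p q pq hs d], symmetric]
    by (rule Bochner_Integration.integral_cong[OF refl]) (simp add: right_diff_distrib)
  ultimately have hlim: "(\<lambda>j. heat c (h (r j)) (x (r j))) \<longlonglongrightarrow> 0" by simp
  then have "\<forall>\<^sub>F j in sequentially. cmod (heat c (h (r j)) (x (r j))) < \<epsilon>"
    using tendstoD[OF hlim \<epsilon>] by simp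
  then obtain j where "cmod (heat c (h (r j)) (x (r j))) < \<epsilon>" 
    using eventually_happens'[OF sequentially_bot] by blast
  with x[OF rb[of j]] show False by simp
qed

text \<open>The strict inequality p < q leaves a positive power of the uniform bound in
  \<open>heat_nn_integral_le\<close>.\<close>

lemma heat_Lq_tendsto:
  fixes h :: "nat \<Rightarrow> real^'n \<Rightarrow> complex"
  assumes p: "1 \<le> p" and q: "p < q" and h: "\<And>k. h k \<in> carr (Lp p)"
    and bdd: "\<And>k. (\<integral>x. cmod (h k x) powr p \<partial>lborel) \<le> M"
    and unif: "\<And>\<epsilon>. 0 < \<epsilon> \<Longrightarrow> \<forall>\<^sub>F k in sequentially. \<forall>x. cmod (heat c (h k) x) \<le> \<epsilon>"
  shows "(\<lambda>k. \<integral>\<^sup>+x. ennreal (cmod (heat c (h k) x) powr q) \<partial>lborel) \<longlonglongrightarrow> 0"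
proof (rule tendsto_zero_ennreal)
  fix r :: real assume r: "0 < r"
  have M: "0 \<le> M" by (rule order_trans[OF integral_nonneg_AE bdd[of 0]]) simp
  \<comment> \<open>Chosen so that \<open>?\<epsilon> powr (q - p) * M\<close> equals
    \<open>r / (M + 1) * M\<close>, which is below \<open>r\<close>; adding 1 admits M = 0.\<close>
  let ?\<epsilon> = "(r / (M + 1)) powr (1 / (q - p))"
  have "0 < ?\<epsilon>" using r M by simp
  from unif[OF this] show "\<forall>\<^sub>F k in sequentially. (\<integral>\<^sup>+x. ennreal (cmod (heat c (h k) x) powr q) \<partial>lborel) < ennreal r"
  proof eventually_elim
    case (elim k)
    have "(\<integral>\<^sup>+x. ennreal (cmod (heat c (h k) x) powr q) \<partial>lborel) \<le> ennreal (?\<epsilon> powr (q - p) * (\<integral>x. cmod (h k x) powr p \<partial>lborel))"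
      by (rule heat_nn_integral_le[OF p _ h]) (use q elim in auto)
    also have "\<dots> < ennreal r"
    proof (rule ennreal_lessI[OF r])
      have "?\<epsilon> powr (q - p) * (\<integral>x. cmod (h k x) powr p \<partial>lborel) \<le> r / (M + 1) * M"
        using q r M bdd[of k] by (simp add: powr_powr) (intro divide_right_mono mult_left_mono, auto)
      also have "\<dots> < r" using r M by (simp add: field_simps)
      finally show "?\<epsilon> powr (q - p) * (\<integral>x. cmod (h k x) powr p \<partial>lborel) < r" .
    qed
    finally show ?case .
  qed
qed

section \<open>Weakly null sequences in Sobolev spaces\<close>

text \<open>A gliding hump argument. Only the dual space has to be complete, and it always is: the series
  of functionals built here converges pointwise.\<close>

lemma weakly_null_bounded:
  fixes A :: "'a fspace"
  assumes wn: "weakly_null A v" and v: "\<And>k. v k \<in> carr A"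
    and norming: "\<And>k. \<exists>l\<in>dual A. (\<forall>f\<in>carr A. cmod (l f) \<le> fnorm A f) \<and> fnorm A (v k) \<le> cmod (l (v k))"
  shows "\<exists>M. \<forall>k. fnorm A (v k) \<le> M"
proof (rule ccontr)
  assume "\<not> ?thesis"
  then have "\<exists>k. 4 ^ j \<le> fnorm A (v k)" for j :: nat by (meson not_le less_imp_le)
  then obtain \<kappa> where \<kappa>: "\<And>j::nat. 4 ^ j \<le> fnorm A (v (\<kappa> j))" by metis
  define V where "V j = v (\<kappa> j)" for j
  have V: "V j \<in> carr A" and V4: "4 ^ j \<le> fnorm A (V j)" for j by (auto simp: V_def v \<kappa>)
  obtain L where L: "\<And>j. L j \<in> dual A" "\<And>j f. f \<in> carr A \<Longrightarrow> cmod (L j f) \<le> fnorm A f"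
    "\<And>j. fnorm A (V j) \<le> cmod (L j (V j))"
    using norming[of "\<kappa> _"] unfolding V_def by metis
  \<comment> \<open>Partial sums of signed functionals. Of \<open>t + a\<close> and
    \<open>t - a\<close> at least one has modulus at least that of \<open>a\<close>; the sign is
    chosen accordingly at \<open>V j\<close>, so the earlier terms cannot cancel the new one
    there.\<close>
  define T where "T = rec_nat (\<lambda>f. 0) (\<lambda>j t f. if (1 / 3) ^ j * fnorm A (V j) \<le> cmod (t (V j) + (1 / 3) ^ j * L j (V j))
    then t f + (1 / 3) ^ j * L j f else t f - (1 / 3) ^ j * L j f)"
  have T0: "T 0 f = 0" for f by (simp add: T_def)
  have TSuc: "(\<forall>f. T (Suc j) f = T j f + (1 / 3) ^ j * L j f) \<or> (\<forall>f. T (Suc j) f = T j f - (1 / 3) ^ j * L j f)" for j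
    by (auto simp: T_def)
  have Tbig: "(1 / 3) ^ j * fnorm A (V j) \<le> cmod (T (Suc j) (V j))" for j
  proof (cases "(1 / 3) ^ j * fnorm A (V j) \<le> cmod (T j (V j) + (1 / 3) ^ j * L j (V j))")
    case True
    then show ?thesis by (simp add: T_def)
  next
    case False
    let ?a = "(1 / 3) ^ j * L j (V j)"
    have e: "T (Suc j) (V j) = T j (V j) - ?a" using False by (simp add: T_def)
    have "2 * cmod ?a \<le> cmod (T j (V j) + ?a) + cmod (T j (V j) - ?a)"
      using norm_triangle_ineq4[of "T j (V j) + ?a" "T j (V j) - ?a"] by (simp add: norm_mult mult_ac)
    moreover have "(1 / 3) ^ j * fnorm A (V j) \<le> cmod ?a"
      using L(3)[of j] by (simp add: norm_mult norm_power norm_divide)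
    ultimately show ?thesis unfolding e using False by linarith
  qed
  \<comment> \<open>The j-th term with its sign, recovered as a difference of partial sums.\<close>
  define D where "D j f = T (Suc j) f - T j f" for j f
  have D: "(\<forall>f. D j f = (1 / 3) ^ j * L j f) \<or> (\<forall>f. D j f = - ((1 / 3) ^ j * L j f))" for j
    using TSuc[of j] by (auto simp: D_def)
  have Dle: "cmod (D j f) \<le> (1 / 3) ^ j * fnorm A f" if "f \<in> carr A" for j f
  proof -
    have "cmod (D j f) = (1 / 3) ^ j * cmod (L j f)" using D[of j] by (auto simp: norm_mult norm_power norm_divide)
    then show ?thesis using L(2)[OF that, of j] by (simp add: mult_left_mono)
  qed
  have geo: "(\<lambda>j. (1 / 3) ^ j * x) sums (3 / 2 * x)" for x :: real
    using sums_mult2[OF geometric_sums[of "1 / 3 :: real"], of x] by simp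
  have Dsum: "summable (\<lambda>j. D j f)" if "f \<in> carr A" for f
    by (rule summable_comparison_test'[OF sums_summable[OF geo] Dle[OF that]])
  define l where "l f = (\<Sum>j. D j f)" for f
  have LD: "L j (\<lambda>x. f x + g x) = L j f + L j g" "L j (\<lambda>x. c * f x) = c * L j f" if "f \<in> carr A" "g \<in> carr A" for j f g c
    using L(1)[of j] that unfolding dual_def by auto
  have "l \<in> dual A"
    unfolding dual_def
  proof (intro CollectI conjI ballI allI exI)
    fix f g assume fg: "f \<in> carr A" "g \<in> carr A"
    have "D j (\<lambda>x. f x + g x) = D j f + D j g" for j
      using D[of j] by (auto simp: LD fg algebra_simps)
    then show "l (\<lambda>x. f x + g x) = l f + l g"
      unfolding l_def by (simp add: suminf_add Dsum fg)
  next
    fix c f assume f: "f \<in> carr A"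
    have "D j (\<lambda>x. c * f x) = c * D j f" for j
      using D[of j] by (auto simp: LD[OF f f])
    then show "l (\<lambda>x. c * f x) = c * l f"
      unfolding l_def by (simp add: suminf_mult Dsum f)
  next
    fix f assume f: "f \<in> carr A"
    have "cmod (l f) \<le> (\<Sum>j. (1 / 3) ^ j * fnorm A f)"
      unfolding l_def by (rule norm_suminf_le[OF Dle[OF f] sums_summable[OF geo]])
    also have "\<dots> = 3 / 2 * fnorm A f" by (rule sums_unique[OF geo, symmetric])
    finally show "cmod (l f) \<le> 3 / 2 * fnorm A f" .
  qed
  then have "(\<lambda>k. l (v k)) \<longlonglongrightarrow> 0" using wn unfolding weakly_null_def by blast
  then have "Bseq (\<lambda>k. l (v k))" by (intro convergent_imp_Bseq convergentI)
  then obtain B where B: "\<And>k. cmod (l (v k)) \<le> B" by (auto simp: Bseq_def)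
  \<comment> \<open>At \<open>V j\<close> the partial sum is at least \<open>(1 / 3) ^ j\<close>
    times the norm, and the later terms add up to at most half of that since 1/3 + 1/9 + ... = 1/2.
    The growth \<open>4 ^ j\<close> of the norms beats the factor
    \<open>(1 / 3) ^ j\<close>.\<close>
  have "(4 / 3) ^ j / 2 \<le> B" for j
  proof -
    let ?n = "fnorm A (V j)"
    have "l (V j) = (\<Sum>i. D (i + Suc j) (V j)) + (\<Sum>i<Suc j. D i (V j))"
      unfolding l_def by (rule suminf_split_initial_segment[OF Dsum[OF V]])
    also have "(\<Sum>i<Suc j. D i (V j)) = T (Suc j) (V j)"
      unfolding D_def by (subst sum_lessThan_telescope) (simp add: T0)
    finally have "cmod (T (Suc j) (V j)) \<le> cmod (l (V j)) + cmod (\<Sum>i. D (i + Suc j) (V j))"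
      by (metis add_diff_cancel_left' norm_triangle_ineq4 add.commute)
    moreover have "cmod (\<Sum>i. D (i + Suc j) (V j)) \<le> (1 / 3) ^ j * ?n / 2"
    proof -
      have s: "(\<lambda>i. (1 / 3) ^ i * ((1 / 3) ^ Suc j * ?n)) sums (3 / 2 * ((1 / 3) ^ Suc j * ?n))" by (rule geo)
      have le: "cmod (D (i + Suc j) (V j)) \<le> (1 / 3) ^ i * ((1 / 3) ^ Suc j * ?n)" for i
        using Dle[OF V, of "i + Suc j" j] by (simp add: power_add mult_ac)
      have "cmod (\<Sum>i. D (i + Suc j) (V j)) \<le> (\<Sum>i. (1 / 3) ^ i * ((1 / 3) ^ Suc j * ?n))"
        by (rule norm_suminf_le[OF le sums_summable[OF s]])
      also have "\<dots> = (1 / 3) ^ j * ?n / 2" by (subst sums_unique[OF s, symmetric]) simp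
      finally show ?thesis .
    qed
    ultimately have "(1 / 3) ^ j * ?n / 2 \<le> cmod (l (V j))" using Tbig[of j] by linarith
    also have "\<dots> \<le> B" unfolding V_def by (rule B)
    finally have "(1 / 3) ^ j * ?n / 2 \<le> B" .
    moreover have "(1 / 3) ^ j * 4 ^ j \<le> (1 / 3) ^ j * ?n" by (intro mult_left_mono V4) simp
    moreover have "(1 / 3) ^ j * 4 ^ j = ((4 / 3) ^ j :: real)" by (simp flip: power_mult_distrib)
    ultimately show ?thesis by simp
  qed
  moreover obtain j where "2 * B < (4 / 3) ^ j" using real_arch_pow[of "4 / 3" "2 * B"] by auto
  ultimately show False by (smt (verit, best) field_sum_of_halves)
qed

section \<open>Calculus of Bessel images\<close>

lemma bessel_symbol_slow: "bessel_symbol s \<in> slow"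
  unfolding bessel_symbol_def[abs_def] by (rule slow.bracket)

lemma bessel_symbol_add: "bessel_symbol (s + t) \<xi> = bessel_symbol s \<xi> * bessel_symbol t \<xi>"
  unfolding bessel_symbol_def by (simp add: add_divide_distrib powr_add)

lemma bessel_symbol_0 [simp]: "bessel_symbol 0 \<xi> = 1"
  by (simp add: bessel_symbol_def add_nonneg_eq_0_iff)

lemma bessel_image_Lp: "is_bessel_image \<alpha> p f g \<Longrightarrow> g \<in> carr (Lp p)"
  by (simp add: is_bessel_image_def)

lemma bessel_imageD:
  "is_bessel_image \<alpha> p f g \<Longrightarrow> \<phi> \<in> schwartz \<Longrightarrow>
    (\<integral>x. f x * fourier (\<lambda>\<xi>. bessel_symbol \<alpha> \<xi> * \<phi> \<xi>) x \<partial>lborel) = (\<integral>x. g x * fourier \<phi> x \<partial>lborel)"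
  unfolding is_bessel_image_def mult_dist_def fourier_dist_def by blast

lemma bessel_imageI:
  "g \<in> carr (Lp p) \<Longrightarrow> (\<And>\<phi>. \<phi> \<in> schwartz \<Longrightarrow>
    (\<integral>x. f x * fourier (\<lambda>\<xi>. bessel_symbol \<alpha> \<xi> * \<phi> \<xi>) x \<partial>lborel) = (\<integral>x. g x * fourier \<phi> x \<partial>lborel)) \<Longrightarrow>
    is_bessel_image \<alpha> p f g"
  unfolding is_bessel_image_def mult_dist_def fourier_dist_def by blast

text \<open>The defining equation of \<open>g\<close> is tested with
  \<open>bessel_symbol (- \<alpha>)\<close> times \<phi>, again a Schwartz function, and the orders
  of the symbols add up to \<gamma>. With \<gamma> = 0 and q = p this inverts the Bessel operator;
  with \<gamma> > 0 it identifies the image in the second imbedding.\<close>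

lemma bessel_image_lower:
  assumes "0 < \<alpha>" "1 \<le> p" and g: "is_bessel_image (\<alpha> + \<gamma>) p f g" and Lq: "bessel_op \<alpha> g \<in> carr (Lp q)"
  shows "is_bessel_image \<gamma> q f (bessel_op \<alpha> g)"
proof (rule bessel_imageI[OF Lq])
  fix \<phi> :: "real^'a \<Rightarrow> complex" assume \<phi>: "\<phi> \<in> schwartz"
  let ?\<psi> = "\<lambda>\<xi>. bessel_symbol (- \<alpha>) \<xi> * \<phi> \<xi>"
  have \<psi>: "?\<psi> \<in> schwartz" by (rule schwartz_mult[OF bessel_symbol_slow \<phi>])
  have e: "bessel_symbol (\<alpha> + \<gamma>) \<xi> * ?\<psi> \<xi> = bessel_symbol \<gamma> \<xi> * \<phi> \<xi>" for \<xi>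
    using bessel_symbol_add[of "\<alpha> + \<gamma>" "- \<alpha>" \<xi>] by simp
  show "(\<integral>x. f x * fourier (\<lambda>\<xi>. bessel_symbol \<gamma> \<xi> * \<phi> \<xi>) x \<partial>lborel) = (\<integral>x. bessel_op \<alpha> g x * fourier \<phi> x \<partial>lborel)"
    using bessel_imageD[OF g \<psi>] bessel_op_fourier[OF assms(1,2) bessel_image_Lp[OF g] \<phi>] unfolding e by simp
qed

text \<open>Two images have the same pairings with all \<open>fourier \<phi>\<close>, so injectivity
  applies to their difference. This makes the choice by \<open>SOME\<close> in the Sobolev norm
  harmless.\<close>

lemma bessel_image_unique:
  assumes p: "1 \<le> p" and g: "is_bessel_image \<alpha> p f g" and g': "is_bessel_image \<alpha> p f g'"
  shows "AE x in lborel. g x = g' x"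
proof -
  have d: "(\<lambda>x. g x - g' x) \<in> carr (Lp p)"
    using p by (intro Lp_diff bessel_image_Lp[OF g] bessel_image_Lp[OF g']) simp
  have "AE x in lborel. g x - g' x = 0"
  proof (rule fourier_injective[OF p d])
    fix \<phi> :: "real^'a \<Rightarrow> complex" assume \<phi>: "\<phi> \<in> schwartz"
    show "(\<integral>x. (g x - g' x) * fourier \<phi> x \<partial>lborel) = 0"
      using Lp_fourier_integrable[OF p bessel_image_Lp[OF g] \<phi>] Lp_fourier_integrable[OF p bessel_image_Lp[OF g'] \<phi>]
        bessel_imageD[OF g \<phi>] bessel_imageD[OF g' \<phi>]
      by (simp add: left_diff_distrib)
  qed
  then show ?thesis by simp
qed

text \<open>Both functions are Bessel images of \<open>f\<close> of order 0, hence equal almost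
  everywhere.\<close>

lemma bessel_op_image:
  fixes f :: "real^'n \<Rightarrow> complex"
  assumes \<alpha>: "0 < \<alpha>" and p: "1 \<le> p" and f: "f \<in> carr (Lp p)" and g: "is_bessel_image \<alpha> p f g"
  shows "AE x in lborel. f x = bessel_op \<alpha> g x"
proof (rule bessel_image_unique[OF p, where f = f and \<alpha> = 0])
  show "is_bessel_image 0 p f f" by (rule bessel_imageI[OF f]) simp
  show "is_bessel_image 0 p f (bessel_op \<alpha> g)"
    by (rule bessel_image_lower[OF \<alpha> p _ bessel_op_Lp[OF \<alpha> p bessel_image_Lp[OF g]]]) (simp add: g)
qed

lemma bessel_image_add:
  assumes p: "1 \<le> p" and f: "f \<in> carr (Lp p)" "f' \<in> carr (Lp p)"
    and g: "is_bessel_image \<alpha> p f g" "is_bessel_image \<alpha> p f' g'"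
  shows "is_bessel_image \<alpha> p (\<lambda>x. f x + f' x) (\<lambda>x. g x + g' x)"
proof (rule bessel_imageI)
  show "(\<lambda>x. g x + g' x) \<in> carr (Lp p)" using p by (intro Lp_add bessel_image_Lp[OF g(1)] bessel_image_Lp[OF g(2)]) simp
  fix \<phi> :: "real^'a \<Rightarrow> complex" assume \<phi>: "\<phi> \<in> schwartz"
  note m = schwartz_mult[OF bessel_symbol_slow[of \<alpha>] \<phi>]
  show "(\<integral>x. (f x + f' x) * fourier (\<lambda>\<xi>. bessel_symbol \<alpha> \<xi> * \<phi> \<xi>) x \<partial>lborel) = (\<integral>x. (g x + g' x) * fourier \<phi> x \<partial>lborel)"
    using Lp_fourier_integrable[OF p f(1) m] Lp_fourier_integrable[OF p f(2) m]
      Lp_fourier_integrable[OF p bessel_image_Lp[OF g(1)] \<phi>] Lp_fourier_integrable[OF p bessel_image_Lp[OF g(2)] \<phi>]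
      bessel_imageD[OF g(1) \<phi>] bessel_imageD[OF g(2) \<phi>]
    by (simp add: distrib_right)
qed

lemma bessel_image_cmult:
  assumes g: "is_bessel_image \<alpha> p f g"
  shows "is_bessel_image \<alpha> p (\<lambda>x. c * f x) (\<lambda>x. c * g x)"
  using bessel_imageD[OF g] by (intro bessel_imageI Lp_cmult bessel_image_Lp[OF g]) (simp add: mult.assoc)

lemma fourier_translate:
  "fourier (\<lambda>\<xi>. exp (\<i> * complex_of_real (\<xi> \<bullet> - y)) * \<phi> \<xi>) x = fourier \<phi> (x + y)"
proof -
  have "exp (- \<i> * complex_of_real (x \<bullet> \<xi>)) * (exp (\<i> * complex_of_real (\<xi> \<bullet> - y)) * \<phi> \<xi>)
    = exp (- \<i> * complex_of_real ((x + y) \<bullet> \<xi>)) * \<phi> \<xi>" for \<xi>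
  proof -
    have "- \<i> * complex_of_real (x \<bullet> \<xi>) + \<i> * complex_of_real (\<xi> \<bullet> - y) = - \<i> * complex_of_real ((x + y) \<bullet> \<xi>)"
      by (simp add: inner_add_left inner_commute[of \<xi> y] distrib_left)
    then show ?thesis by (simp only: mult.assoc[symmetric] exp_add[symmetric])
  qed
  then show ?thesis unfolding fourier_def by (simp only:)
qed

text \<open>A translation acts on the test function as multiplication by a character, which commutes
  with the Bessel symbol.\<close>

lemma bessel_image_shift:
  assumes p: "1 \<le> p" and f: "f \<in> carr (Lp p)" and g: "is_bessel_image \<alpha> p f g"
  shows "is_bessel_image \<alpha> p (\<lambda>x. f (x - y)) (\<lambda>x. g (x - y))"
proof (rule bessel_imageI)
  show "(\<lambda>x. g (x - y)) \<in> carr (Lp p)" by (rule Lp_shift[OF bessel_image_Lp[OF g]])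
  fix \<phi> :: "real^'a \<Rightarrow> complex" assume \<phi>: "\<phi> \<in> schwartz"
  have [measurable]: "f \<in> borel_measurable borel" "g \<in> borel_measurable borel"
    using f bessel_image_Lp[OF g] by (auto dest: Lp_measurable)
  have s: "(\<integral>x. F (x - y) * fourier \<eta> x \<partial>lborel) = (\<integral>x. F x * fourier (\<lambda>\<xi>. exp (\<i> * complex_of_real (\<xi> \<bullet> - y)) * \<eta> \<xi>) x \<partial>lborel)"
    if "\<eta> \<in> schwartz" and [measurable]: "F \<in> borel_measurable borel" for F \<eta>
  proof -
    have [measurable]: "fourier \<eta> \<in> borel_measurable borel" by (intro fourier_measurable schwartz_measurable that)
    have "(\<integral>x. F (x - y) * fourier \<eta> x \<partial>lborel) = (\<integral>x. F (x + y - y) * fourier \<eta> (x + y) \<partial>lborel)"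
      by (rule integral_lborel_shift[symmetric, of "\<lambda>x. F (x - y) * fourier \<eta> x"]) measurable
    then show ?thesis unfolding fourier_translate by simp
  qed
  let ?\<phi> = "\<lambda>\<xi>. exp (\<i> * complex_of_real (\<xi> \<bullet> - y)) * \<phi> \<xi>"
  have "(\<integral>x. f (x - y) * fourier (\<lambda>\<xi>. bessel_symbol \<alpha> \<xi> * \<phi> \<xi>) x \<partial>lborel)
      = (\<integral>x. f x * fourier (\<lambda>\<xi>. bessel_symbol \<alpha> \<xi> * ?\<phi> \<xi>) x \<partial>lborel)"
    by (subst s[OF schwartz_mult[OF bessel_symbol_slow \<phi>]]) (auto simp: mult.left_commute)
  also have "\<dots> = (\<integral>x. g x * fourier ?\<phi> x \<partial>lborel)"
    by (rule bessel_imageD[OF g schwartz_mult[OF slow.character \<phi>]])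
  also have "\<dots> = (\<integral>x. g (x - y) * fourier \<phi> x \<partial>lborel)"
    by (rule s[OF \<phi>, symmetric]) simp
  finally show "(\<integral>x. f (x - y) * fourier (\<lambda>\<xi>. bessel_symbol \<alpha> \<xi> * \<phi> \<xi>) x \<partial>lborel) = (\<integral>x. g (x - y) * fourier \<phi> x \<partial>lborel)" .
qed

definition bessel_image :: "real \<Rightarrow> real \<Rightarrow> (real^'n \<Rightarrow> complex) \<Rightarrow> real^'n \<Rightarrow> complex" where
  "bessel_image \<alpha> p f = (SOME g. is_bessel_image \<alpha> p f g)"

lemma sobolev_carr_iff: "f \<in> carr (sobolev \<alpha> p) \<longleftrightarrow> f \<in> carr (Lp p) \<and> (\<exists>g. is_bessel_image \<alpha> p f g)"
  by (simp add: sobolev_def)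

lemma bessel_image_some: "is_bessel_image \<alpha> p f g \<Longrightarrow> is_bessel_image \<alpha> p f (bessel_image \<alpha> p f)"
  unfolding bessel_image_def by (rule someI[of "is_bessel_image \<alpha> p f"])

lemma bessel_image_is_image: "f \<in> carr (sobolev \<alpha> p) \<Longrightarrow> is_bessel_image \<alpha> p f (bessel_image \<alpha> p f)"
  unfolding sobolev_carr_iff by (auto intro: bessel_image_some)

lemma fnorm_sobolev: "fnorm (sobolev \<alpha> p) f = fnorm (Lp p) (bessel_image \<alpha> p f)"
  by (simp add: sobolev_def bessel_image_def)

lemma fnorm_sobolev_eq:
  assumes p: "1 \<le> p" and g: "is_bessel_image \<alpha> p f g"
  shows "fnorm (sobolev \<alpha> p) f = fnorm (Lp p) g"
proof -
  have g': "is_bessel_image \<alpha> p f (bessel_image \<alpha> p f)" using g by (rule bessel_image_some)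
  show ?thesis unfolding fnorm_sobolev
    by (intro fnorm_Lp_cong_AE Lp_measurable[OF bessel_image_Lp] bessel_image_unique[OF p g' g]) (rule g' g)+
qed

lemma sobolev_add:
  assumes p: "1 \<le> p" and f: "f \<in> carr (sobolev \<alpha> p)" "g \<in> carr (sobolev \<alpha> p)"
  shows "(\<lambda>x. f x + g x) \<in> carr (sobolev \<alpha> p)"
  using f p bessel_image_add[OF p] unfolding sobolev_carr_iff by (auto intro!: Lp_add) blast

lemma sobolev_cmult: "f \<in> carr (sobolev \<alpha> p) \<Longrightarrow> (\<lambda>x. c * f x) \<in> carr (sobolev \<alpha> p)"
  using bessel_image_cmult unfolding sobolev_carr_iff by (blast intro: Lp_cmult)

lemma sobolev_diff:
  assumes "1 \<le> p" "f \<in> carr (sobolev \<alpha> p)" "g \<in> carr (sobolev \<alpha> p)"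
  shows "(\<lambda>x. f x - g x) \<in> carr (sobolev \<alpha> p)"
  using sobolev_add[OF assms(1,2) sobolev_cmult[OF assms(3), of "-1"]] by simp

section \<open>Functionals on Sobolev spaces from the dual Lebesgue exponent\<close>

context
  fixes p q :: real
  assumes p: "1 < p" and q: "1 < q" and pq: "1 / p + 1 / q = 1"
begin

text \<open>The pairing of conjugate Lebesgue spaces, pulled back along the Bessel image. Through
  these functionals weak convergence in the Sobolev space becomes weak convergence of the Bessel
  images.\<close>

definition sobolev_functional :: "real \<Rightarrow> (real^'n \<Rightarrow> complex) \<Rightarrow> (real^'n \<Rightarrow> complex) \<Rightarrow> complex" where
  "sobolev_functional \<alpha> \<phi> f = (\<integral>x. bessel_image \<alpha> p f x * \<phi> x \<partial>lborel)"

lemma sobolev_functional_eq: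
  assumes \<phi>: "\<phi> \<in> carr (Lp q)" and g: "is_bessel_image \<alpha> p f g"
  shows "sobolev_functional \<alpha> \<phi> f = (\<integral>x. g x * \<phi> x \<partial>lborel)"
proof -
  have g': "is_bessel_image \<alpha> p f (bessel_image \<alpha> p f)" using g by (rule bessel_image_some)
  have [measurable]: "\<phi> \<in> borel_measurable borel" "g \<in> borel_measurable borel" "bessel_image \<alpha> p f \<in> borel_measurable borel"
    using \<phi> bessel_image_Lp[OF g] bessel_image_Lp[OF g'] by (auto dest: Lp_measurable)
  have "AE x in lborel. bessel_image \<alpha> p f x = g x" using p by (intro bessel_image_unique[OF _ g' g]) simp
  then show ?thesis unfolding sobolev_functional_def
    by (intro integral_cong_AE) auto
qed

lemma sobolev_functional_le:
  assumes \<phi>: "\<phi> \<in> carr (Lp q)" and f: "f \<in> carr (sobolev \<alpha> p)"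
  shows "cmod (sobolev_functional \<alpha> \<phi> f) \<le> fnorm (Lp q) \<phi> * fnorm (sobolev \<alpha> p) f"
  using Holder(2)[OF p q pq bessel_image_Lp[OF bessel_image_is_image[OF f]] \<phi>]
  by (simp add: sobolev_functional_def fnorm_sobolev mult.commute)

lemma sobolev_functional_dual:
  fixes \<phi> :: "real^'n \<Rightarrow> complex"
  assumes \<phi>: "\<phi> \<in> carr (Lp q)"
  shows "sobolev_functional \<alpha> \<phi> \<in> dual (sobolev \<alpha> p)"
  unfolding dual_def
proof (intro CollectI conjI ballI allI exI)
  fix f g :: "real^'n \<Rightarrow> complex" assume f: "f \<in> carr (sobolev \<alpha> p)" and g: "g \<in> carr (sobolev \<alpha> p)"
  note F = bessel_image_is_image[OF f] and G = bessel_image_is_image[OF g]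
  have "is_bessel_image \<alpha> p (\<lambda>x. f x + g x) (\<lambda>x. bessel_image \<alpha> p f x + bessel_image \<alpha> p g x)"
    using f g p by (intro bessel_image_add F G) (auto simp: sobolev_carr_iff)
  then show "sobolev_functional \<alpha> \<phi> (\<lambda>x. f x + g x) = sobolev_functional \<alpha> \<phi> f + sobolev_functional \<alpha> \<phi> g"
    using Holder(1)[OF p q pq bessel_image_Lp[OF F] \<phi>] Holder(1)[OF p q pq bessel_image_Lp[OF G] \<phi>]
    by (simp add: sobolev_functional_eq[OF \<phi>] sobolev_functional_eq[OF \<phi> F] sobolev_functional_eq[OF \<phi> G] distrib_right)
next
  fix c and f :: "real^'n \<Rightarrow> complex" assume f: "f \<in> carr (sobolev \<alpha> p)"
  note F = bessel_image_is_image[OF f]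
  show "sobolev_functional \<alpha> \<phi> (\<lambda>x. c * f x) = c * sobolev_functional \<alpha> \<phi> f"
    by (simp add: sobolev_functional_eq[OF \<phi> F] sobolev_functional_eq[OF \<phi> bessel_image_cmult[OF F]] mult.assoc)
next
  fix f :: "real^'n \<Rightarrow> complex" assume "f \<in> carr (sobolev \<alpha> p)"
  then show "cmod (sobolev_functional \<alpha> \<phi> f) \<le> fnorm (Lp q) \<phi> * fnorm (sobolev \<alpha> p) f"
    by (rule sobolev_functional_le[OF \<phi>])
qed

lemma Lp_norming:
  fixes g :: "real^'n \<Rightarrow> complex"
  assumes g: "g \<in> carr (Lp p)" and pos: "0 < fnorm (Lp p) g"
  obtains \<phi> where "\<phi> \<in> carr (Lp q)" "fnorm (Lp q) \<phi> = 1"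
    "(\<integral>x. g x * \<phi> x \<partial>lborel) = complex_of_real (fnorm (Lp p) g)"
proof -
  have [measurable]: "g \<in> borel_measurable borel" using g by (rule Lp_measurable)
  define a where "a = fnorm (Lp p) g"
  have a: "0 < a" and A: "(\<integral>x. cmod (g x) powr p \<partial>lborel) = a powr p"
    using pos p by (auto simp: a_def fnorm_Lp_powr)
  have qp: "(p - 1) * q = p"
    using p q pq by (simp add: field_simps)
  \<comment> \<open>The extremal function for Hoelder's inequality, normalised: its modulus is
    \<open>(cmod (g x) / a) powr (p - 1)\<close> and its phase cancels that of \<open>g\<close>.
    Where \<open>g\<close> vanishes, the factor \<open>cnj (g x)\<close> makes it 0.\<close>
  define \<phi> where "\<phi> x = cnj (g x) * complex_of_real (cmod (g x) powr (p - 2) / a powr (p - 1))" for x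
  have "cnj \<in> borel_measurable borel" by (intro borel_measurable_continuous_onI continuous_intros)
  from measurable_compose[OF _ this] have [measurable]: "(\<lambda>x. cnj (g x)) \<in> borel_measurable borel" by measurable
  have [measurable]: "\<phi> \<in> borel_measurable borel" unfolding \<phi>_def[abs_def] by measurable
  have n: "t * t powr (p - 2) = t powr (p - 1)" if "0 \<le> t" for t :: real
    using that powr_add[of t 1 "p - 2"] by (cases "t = 0") auto
  have "cmod (\<phi> x) = cmod (g x) powr (p - 1) / a powr (p - 1)" for x
    using n[of "cmod (g x)"] a by (simp add: \<phi>_def norm_mult norm_divide)
  then have \<phi>q: "cmod (\<phi> x) powr q = cmod (g x) powr p / a powr p" for x
    by (simp add: powr_divide powr_powr qp)
  have "\<phi> \<in> carr (Lp q)" using g by (auto simp: Lp_iff \<phi>q)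
  moreover have "fnorm (Lp q) \<phi> = 1" using a by (simp add: fnorm_Lp \<phi>q A)
  moreover have "(\<integral>x. g x * \<phi> x \<partial>lborel) = complex_of_real a"
  proof -
    have "g x * \<phi> x = complex_of_real (cmod (g x) powr p / a powr (p - 1))" for x
    proof -
      have "g x * \<phi> x = complex_of_real ((cmod (g x))\<^sup>2 * cmod (g x) powr (p - 2) / a powr (p - 1))"
        unfolding \<phi>_def mult.assoc[symmetric] complex_norm_square[symmetric] of_real_mult[symmetric] by simp
      also have "(cmod (g x))\<^sup>2 * cmod (g x) powr (p - 2) = cmod (g x) powr p"
        using powr_add[of "cmod (g x)" 2 "p - 2"] by (cases "g x = 0") (use p in auto)
      finally show ?thesis .
    qed
    then have "(\<integral>x. g x * \<phi> x \<partial>lborel) = complex_of_real (a powr p / a powr (p - 1))"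
      by (simp only: integral_complex_of_real A[symmetric]) simp
    also have "a powr p / a powr (p - 1) = a" using a by (simp add: powr_diff)
    finally show ?thesis .
  qed
  ultimately show ?thesis using that unfolding a_def by blast
qed

lemma sobolev_norming:
  fixes f :: "real^'n \<Rightarrow> complex"
  assumes f: "f \<in> carr (sobolev \<alpha> p)"
  shows "\<exists>l\<in>dual (sobolev \<alpha> p). (\<forall>f\<in>carr (sobolev \<alpha> p). cmod (l f) \<le> fnorm (sobolev \<alpha> p) f)
    \<and> fnorm (sobolev \<alpha> p) f \<le> cmod (l f)"
proof (cases "fnorm (sobolev \<alpha> p) f = 0")
  case True
  have "(\<lambda>_. 0) \<in> dual (sobolev \<alpha> p)" unfolding dual_def by (auto intro: exI[of _ 0])
  then show ?thesis using True by (intro bexI[of _ "\<lambda>_. 0"]) (auto simp: fnorm_sobolev fnorm_Lp_nonneg)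
next
  case False
  note F = bessel_image_is_image[OF f]
  have "0 < fnorm (Lp p) (bessel_image \<alpha> p f)"
    using False fnorm_Lp_nonneg[of p "bessel_image \<alpha> p f"] by (simp add: fnorm_sobolev)
  from Lp_norming[OF bessel_image_Lp[OF F] this] obtain \<phi> where \<phi>: "\<phi> \<in> carr (Lp q)" "fnorm (Lp q) \<phi> = 1"
    "(\<integral>x. bessel_image \<alpha> p f x * \<phi> x \<partial>lborel) = complex_of_real (fnorm (Lp p) (bessel_image \<alpha> p f))" by blast
  show ?thesis
  proof (intro bexI[of _ "sobolev_functional \<alpha> \<phi>"] conjI ballI)
    show "cmod (sobolev_functional \<alpha> \<phi> g) \<le> fnorm (sobolev \<alpha> p) g" if "g \<in> carr (sobolev \<alpha> p)" for g
      using sobolev_functional_le[OF \<phi>(1) that] \<phi>(2) by simp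
    show "fnorm (sobolev \<alpha> p) f \<le> cmod (sobolev_functional \<alpha> \<phi> f)"
      using \<phi>(3) by (simp add: sobolev_functional_def fnorm_sobolev)
    show "sobolev_functional \<alpha> \<phi> \<in> dual (sobolev \<alpha> p)" by (rule sobolev_functional_dual[OF \<phi>(1)])
  qed
qed

end

section \<open>Cocompactness\<close>

text \<open>The scaling form of subcriticality, which treats both cases of the critical exponent
  alike. If N \<le> \<alpha> p then N / p \<le> \<alpha> already, and the strict inequality comes
  from the term 1 / q > 0.\<close>

lemma subcritical:
  fixes \<alpha> p q :: real
  assumes "1 < p" "p < q" and crit: "ereal q < critical_exponent N \<alpha> p" and N: "0 < N"
  shows "real N * (1 / p - 1 / q) < \<alpha>"
proof (cases "real N > \<alpha> * p")
  case True
  then have "q < p * real N / (real N - \<alpha> * p)" using crit by (simp add: critical_exponent_def)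
  then have "q * (real N - \<alpha> * p) < p * real N" using True by (simp add: pos_less_divide_eq)
  then have "real N * (q - p) < \<alpha> * (p * q)" by (simp add: algebra_simps)
  then have "real N * (q - p) / (p * q) < \<alpha>" using assms by (simp add: pos_divide_less_eq)
  moreover have "real N * (q - p) / (p * q) = real N * (1 / p - 1 / q)" using assms by (simp add: field_simps)
  ultimately show ?thesis by simp
next
  case False
  have "real N * (1 / p - 1 / q) < real N * (1 / p)" using N assms by (intro mult_strict_left_mono) auto
  also have "\<dots> \<le> \<alpha>" using False assms by (simp add: pos_divide_le_eq)
  finally show ?thesis .
qed

lemma fnorm_Lp_le_if_nn_integral_le:
  assumes q: "0 < q" and A: "0 \<le> A" and [measurable]: "f \<in> borel_measurable borel"
    and le: "(\<integral>\<^sup>+x. ennreal (cmod (f x) powr q) \<partial>lborel) \<le> ennreal (K * A powr (q / p))"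
  shows "f \<in> carr (Lp q)" and "fnorm (Lp q) f \<le> \<bar>K\<bar> powr (1 / q) * A powr (1 / p)"
proof -
  show f: "f \<in> carr (Lp q)"
    unfolding Lp_nn_iff using le by (auto intro: le_less_trans)
  have "ennreal (\<integral>x. cmod (f x) powr q \<partial>lborel) \<le> ennreal (\<bar>K\<bar> * A powr (q / p))"
    unfolding Lp_nn_integral[OF f, symmetric]
    by (rule order_trans[OF le]) (intro ennreal_leI mult_right_mono, auto)
  then have "(\<integral>x. cmod (f x) powr q \<partial>lborel) \<le> \<bar>K\<bar> * A powr (q / p)"
    by (subst (asm) ennreal_le_iff) auto
  then have "fnorm (Lp q) f \<le> (\<bar>K\<bar> * A powr (q / p)) powr (1 / q)"
    unfolding fnorm_Lp using q by (intro powr_mono2) (auto intro: integral_nonneg_AE)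
  also have "\<dots> = \<bar>K\<bar> powr (1 / q) * A powr (1 / p)"
    using q by (simp add: powr_mult powr_powr)
  finally show "fnorm (Lp q) f \<le> \<bar>K\<bar> powr (1 / q) * A powr (1 / p)" .
qed

lemma bessel_op_bounded:
  fixes p q \<alpha> :: real
  assumes p: "1 \<le> p" and q: "p \<le> q" and sub: "real CARD('n) * (1 / p - 1 / q) < \<alpha>"
  shows "\<And>h :: real^'n \<Rightarrow> complex. h \<in> carr (Lp p) \<Longrightarrow> bessel_op \<alpha> h \<in> carr (Lp q)"
    and "\<exists>C. \<forall>h\<in>carr (Lp p :: (real^'n) fspace). fnorm (Lp q) (bessel_op \<alpha> h) \<le> C * fnorm (Lp p) h"
proof -
  have "0 \<le> real CARD('n) * (1 / p - 1 / q)" using p q by (simp add: frac_le)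
  then have \<alpha>: "0 < \<alpha>" using sub by linarith
  obtain K where K: "\<And>h :: real^'n \<Rightarrow> complex. h \<in> carr (Lp p) \<Longrightarrow>
    (\<integral>\<^sup>+x. ennreal (cmod (bessel_op \<alpha> h x) powr q) \<partial>lborel) \<le> ennreal (K * (\<integral>x. cmod (h x) powr p \<partial>lborel) powr (q / p))"
    using bessel_op_Lq_bound[OF assms] by blast
  have q0: "0 < q" using p q by simp
  have i: "0 \<le> (\<integral>x. cmod (h x) powr p \<partial>lborel)" for h :: "real^'n \<Rightarrow> complex" by (rule integral_nonneg_AE) simp
  note * = fnorm_Lp_le_if_nn_integral_le[OF q0 i bessel_op_measurable[OF \<alpha> Lp_measurable] K]
  show "bessel_op \<alpha> h \<in> carr (Lp q)" if "h \<in> carr (Lp p)" for h :: "real^'n \<Rightarrow> complex"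
    by (rule *(1)[OF that that])
  show "\<exists>C. \<forall>h\<in>carr (Lp p :: (real^'n) fspace). fnorm (Lp q) (bessel_op \<alpha> h) \<le> C * fnorm (Lp p) h"
    using *(2) by (intro exI[of _ "\<bar>K\<bar> powr (1 / q)"] ballI) (simp add: fnorm_Lp[of p])
qed

text \<open>The order \<beta> of the space and the order \<alpha> of the potential are kept apart
  because the second imbedding has \<beta> = \<alpha> + \<gamma>. The zero translation in
  \<open>weak\<close> gives boundedness of the Bessel images, and arbitrary lattice translations
  give the uniform decay of their heat evolution.\<close>

lemma bessel_op_cocompact:
  fixes v :: "nat \<Rightarrow> real^'n \<Rightarrow> complex"
  assumes p: "1 < p" and q: "p < q" and sub: "real CARD('n) * (1 / p - 1 / q) < \<alpha>"
    and v: "\<And>k. v k \<in> carr (sobolev \<beta> p)"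
    and weak: "\<And>y. (\<And>k i. y k $ i \<in> \<int>) \<Longrightarrow> weakly_null (sobolev \<beta> p) (\<lambda>k x. v k (x - y k))"
  shows "(\<lambda>k. fnorm (Lp q) (bessel_op \<alpha> (bessel_image \<beta> p (v k)))) \<longlonglongrightarrow> 0"
proof -
  define p' where "p' = p / (p - 1)"
  have p': "1 < p'" "1 / p + 1 / p' = 1" using p by (auto simp: p'_def field_simps)
  have p1: "1 \<le> p" using p by simp
  define h where "h k = bessel_image \<beta> p (v k)" for k
  have img: "is_bessel_image \<beta> p (v k) (h k)" for k unfolding h_def by (rule bessel_image_is_image[OF v])
  note h = bessel_image_Lp[OF img]
  have "weakly_null (sobolev \<beta> p) v" using weak[of "\<lambda>_. 0"] by simp
  from weakly_null_bounded[OF this v sobolev_norming[OF p p' v]]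
  obtain M where M: "\<And>k. fnorm (Lp p) (h k) \<le> M" unfolding fnorm_sobolev h_def by blast
  have unif: "\<forall>\<^sub>F k in sequentially. \<forall>x. cmod (heat c (h k) x) \<le> \<epsilon>" if c: "0 < c" and \<epsilon>: "0 < \<epsilon>" for c \<epsilon>
  proof (rule heat_uniform_tendsto[OF p p' h M _ c \<epsilon>])
    fix \<phi> :: "real^'n \<Rightarrow> complex" and y :: "nat \<Rightarrow> real^'n"
    assume \<phi>: "\<phi> \<in> carr (Lp p')" and y: "\<And>k i. y k $ i \<in> \<int>"
    have "(\<lambda>k. sobolev_functional p \<beta> \<phi> (\<lambda>x. v k (x - y k))) \<longlonglongrightarrow> 0"
      using weak[OF y] sobolev_functional_dual[OF p p' \<phi>, of \<beta>] unfolding weakly_null_def by (rule bspec)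
    moreover have "sobolev_functional p \<beta> \<phi> (\<lambda>x. v k (x - y k)) = (\<integral>x. h k (x - y k) * \<phi> x \<partial>lborel)" for k
      using v[of k] by (intro sobolev_functional_eq[OF p p' \<phi>] bessel_image_shift[OF p1 _ img]) (simp add: sobolev_carr_iff)
    ultimately show "(\<lambda>k. \<integral>x. h k (x - y k) * \<phi> x \<partial>lborel) \<longlonglongrightarrow> 0" by simp
  qed
  have bdd: "(\<integral>x. cmod (h k x) powr p \<partial>lborel) \<le> M powr p" for k
    using powr_mono2[OF _ fnorm_Lp_nonneg M[of k], of p] p by (simp add: fnorm_Lp_powr)
  have "(\<lambda>k. \<integral>\<^sup>+x. ennreal (cmod (bessel_op \<alpha> (h k) x) powr q) \<partial>lborel) \<longlonglongrightarrow> 0"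
    by (rule bessel_op_Lq_tendsto[OF p1 less_imp_le[OF q] sub h bdd heat_Lq_tendsto[OF p1 q h bdd unif]])
  then have "(\<lambda>k. enn2real (\<integral>\<^sup>+x. ennreal (cmod (bessel_op \<alpha> (h k) x) powr q) \<partial>lborel)) \<longlonglongrightarrow> 0"
    by (intro tendsto_enn2real) simp_all
  moreover have "(\<integral>x. cmod (bessel_op \<alpha> (h k) x) powr q \<partial>lborel) = enn2real (\<integral>\<^sup>+x. ennreal (cmod (bessel_op \<alpha> (h k) x) powr q) \<partial>lborel)" for k
    using bessel_op_bounded(1)[OF p1 less_imp_le[OF q] sub h, of k] by (simp add: Lp_nn_integral integral_nonneg_AE)
  ultimately have "(\<lambda>k. (\<integral>x. cmod (bessel_op \<alpha> (h k) x) powr q \<partial>lborel) powr (1 / q)) \<longlonglongrightarrow> 0 powr (1 / q)"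
    using p q by (intro tendsto_powr2 tendsto_const) (auto intro!: always_eventually integral_nonneg_AE)
  then show ?thesis using p q by (simp add: fnorm_Lp h_def)
qed

lemma D_weakly_convergent_lattice_shifts:
  assumes "D_weakly_convergent lattice_shifts A u w" and y: "\<And>k i. y k $ i \<in> \<int>"
  shows "weakly_null A (\<lambda>k x. u k (x - y k) - w (x - y k))"
proof -
  have "(\<lambda>u x. u (x - y k)) \<in> lattice_shifts" for k
    unfolding lattice_shifts_def using y by blast
  then show ?thesis
    using assms(1)[unfolded D_weakly_convergent_def, rule_format, of "\<lambda>k u x. u (x - y k)"] by simp
qed

text \<open>The common core of both imbeddings: in each case the target norm of \<open>f\<close> is
  the \<open>Lp q\<close> norm of the potential of order \<alpha> of its Bessel image. Continuity
  and cocompactness then both come from properties of that potential.\<close>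

lemma cocompact_imbeddingI:
  fixes B :: "(real^'n) fspace"
  assumes p: "1 < p" and q: "p < q" and sub: "real CARD('n) * (1 / p - 1 / q) < \<alpha>"
    and carr: "\<And>f. f \<in> carr (sobolev \<beta> p) \<Longrightarrow> f \<in> carr B"
    and norm: "\<And>f. f \<in> carr (sobolev \<beta> p) \<Longrightarrow> fnorm B f = fnorm (Lp q) (bessel_op \<alpha> (bessel_image \<beta> p f))"
  shows "cocompact_imbedding lattice_shifts (sobolev \<beta> p) B"
  unfolding cocompact_imbedding_def continuous_imbedding_def
proof (intro conjI allI impI)
  have p1: "1 \<le> p" using p by simp
  show "carr (sobolev \<beta> p) \<subseteq> carr B" using carr by blast
  obtain C where C: "\<forall>h\<in>carr (Lp p :: (real^'n) fspace). fnorm (Lp q) (bessel_op \<alpha> h) \<le> C * fnorm (Lp p) h"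
    using bessel_op_bounded(2)[OF p1 less_imp_le[OF q] sub] by blast
  show "\<exists>C. \<forall>f\<in>carr (sobolev \<beta> p). fnorm B f \<le> C * fnorm (sobolev \<beta> p) f"
  proof (intro exI[of _ C] ballI)
    fix f :: "real^'n \<Rightarrow> complex" assume f: "f \<in> carr (sobolev \<beta> p)"
    show "fnorm B f \<le> C * fnorm (sobolev \<beta> p) f"
      unfolding norm[OF f] fnorm_sobolev by (rule bspec[OF C bessel_image_Lp[OF bessel_image_is_image[OF f]]])
  qed
  fix u :: "nat \<Rightarrow> real^'n \<Rightarrow> complex" and w assume u: "\<forall>k. u k \<in> carr (sobolev \<beta> p)" and w: "w \<in> carr (sobolev \<beta> p)"
    and D: "D_weakly_convergent lattice_shifts (sobolev \<beta> p) u w"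
  have v: "(\<lambda>x. u k x - w x) \<in> carr (sobolev \<beta> p)" for k using u w by (intro sobolev_diff p1) auto
  show "(\<lambda>k. fnorm B (\<lambda>x. u k x - w x)) \<longlonglongrightarrow> 0"
    unfolding norm[OF v] by (rule bessel_op_cocompact[OF p q sub v D_weakly_convergent_lattice_shifts[OF D]])
qed

theorem theorem2p5:
  fixes \<alpha> p q :: real
  assumes "0 < \<alpha>" and "1 < p"
    and "p < q" and "ereal q < critical_exponent CARD('n::finite) \<alpha> p"
  shows "cocompact_imbedding lattice_shifts (sobolev \<alpha> p :: (real^'n) fspace) (Lp q)
    \<and> (\<forall>\<gamma>>0. cocompact_imbedding lattice_shifts
          (sobolev (\<alpha> + \<gamma>) p :: (real^'n) fspace) (sobolev \<gamma> q))"
proof (intro conjI allI impI)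
  note \<alpha> = assms(1) and p = assms(2) and q = assms(3)
  have p1: "1 \<le> p" and q1: "1 \<le> q" using p q by auto
  have sub: "real CARD('n) * (1 / p - 1 / q) < \<alpha>" by (rule subcritical[OF p q assms(4)]) simp
  have Lq: "bessel_op \<beta> h \<in> carr (Lp q)" if "real CARD('n) * (1 / p - 1 / q) < \<beta>" "h \<in> carr (Lp p)"
    for \<beta> and h :: "real^'n \<Rightarrow> complex"
    by (rule bessel_op_bounded(1)[OF p1 less_imp_le[OF q] that])
  have eq: "AE x in lborel. f x = bessel_op \<beta> (bessel_image \<beta> p f) x" if "0 < \<beta>" "f \<in> carr (sobolev \<beta> p)"
    for \<beta> and f :: "real^'n \<Rightarrow> complex"
    using that(2) by (intro bessel_op_image[OF that(1) p1 _ bessel_image_is_image[OF that(2)]]) (simp add: sobolev_carr_iff)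
  \<comment> \<open>The order is left free because membership is wanted for \<alpha> and for
    \<alpha> + \<gamma>. In both cases \<open>f\<close> is the potential, of the full order, of its
    own Bessel image, and raising the order preserves subcriticality.\<close>
  have carr: "f \<in> carr (Lp q)" if "real CARD('n) * (1 / p - 1 / q) < \<beta>" "0 < \<beta>" "f \<in> carr (sobolev \<beta> p)"
    for \<beta> and f :: "real^'n \<Rightarrow> complex"
  proof (rule Lp_cong_AE[OF Lq[OF that(1)]])
    show "bessel_image \<beta> p f \<in> carr (Lp p)" by (rule bessel_image_Lp[OF bessel_image_is_image[OF that(3)]])
    show "f \<in> borel_measurable borel" using that(3) by (auto simp: sobolev_carr_iff dest: Lp_measurable)
    show "AE x in lborel. bessel_op \<beta> (bessel_image \<beta> p f) x = f x"
      using eq[OF that(2,3)] by eventually_elim simp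
  qed
  show "cocompact_imbedding lattice_shifts (sobolev \<alpha> p :: (real^'n) fspace) (Lp q)"
  proof (rule cocompact_imbeddingI[OF p q sub carr[OF sub \<alpha>]])
    fix f :: "real^'n \<Rightarrow> complex" assume f: "f \<in> carr (sobolev \<alpha> p)"
    show "fnorm (Lp q) f = fnorm (Lp q) (bessel_op \<alpha> (bessel_image \<alpha> p f))"
      by (intro fnorm_Lp_cong_AE eq[OF \<alpha> f] Lp_measurable[OF carr[OF sub \<alpha> f]]
        bessel_op_measurable[OF \<alpha>] Lp_measurable[OF bessel_image_Lp[OF bessel_image_is_image[OF f]]])
  qed
  fix \<gamma> :: real assume \<gamma>: "0 < \<gamma>"
  show "cocompact_imbedding lattice_shifts (sobolev (\<alpha> + \<gamma>) p :: (real^'n) fspace) (sobolev \<gamma> q)"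
  proof (rule cocompact_imbeddingI[OF p q sub])
    fix f :: "real^'n \<Rightarrow> complex" assume f: "f \<in> carr (sobolev (\<alpha> + \<gamma>) p)"
    note F = bessel_image_is_image[OF f]
    have img: "is_bessel_image \<gamma> q f (bessel_op \<alpha> (bessel_image (\<alpha> + \<gamma>) p f))"
      by (rule bessel_image_lower[OF \<alpha> p1 F Lq[OF sub bessel_image_Lp[OF F]]])
    have "f \<in> carr (Lp q)" by (rule carr[OF _ _ f]) (use sub \<alpha> \<gamma> in auto)
    then show "f \<in> carr (sobolev \<gamma> q)" using img by (auto simp: sobolev_carr_iff)
    show "fnorm (sobolev \<gamma> q) f = fnorm (Lp q) (bessel_op \<alpha> (bessel_image (\<alpha> + \<gamma>) p f))"
      by (rule fnorm_sobolev_eq[OF q1 img])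
  qed
qed

end
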